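(* Let $\mathcal{C}$ be a cartesian closed category, regarded as enriched over itself, and let $\mathbf{M}=(M,u,m)$ be a monoid object in $\mathcal{C}$. Let $\mathcal{B}:=\mathbb{B}\mathbf{Cat}_{\mathcal{C}}[\mathcal{C},\mathcal{C}]$ be the delooping of the (monoidal) category of $\mathcal{C}$-enriched endofunctors of $\mathcal{C}$, and let $\mathcal{D}:=\mathbf{Mnd}(\mathcal{B})$. Then there is an object of $PDist(\mathcal{D},\mathcal{B})$, that is, a strict 2-functor $$(\mathbf{Mnd}(\mathbb{B}\mathbf{Cat}_{\mathcal{C}}[\mathcal{C},\mathcal{C}])\otimes_l\mathbb{B}\Delta_\alpha)\otimes_l\mathbb{B}\Delta_\alpha\to\mathbb{B}\mathbf{Cat}_{\mathcal{C}}[\mathcal{C},\mathcal{C}],$$ such that the underlying monads, encoded as strict 2-functors $$\mathbf{Mnd}(\mathbb{B}\mathbf{Cat}_{\mathcal{C}}[\mathcal{C},\mathcal{C}])\to\mathbf{Mnd}(\mathbb{B}\mathbf{Cat}_{\mathcal{C}}[\mathcal{C},\mathcal{C}]),$$ are, respectively, constantly the writer monad $\mathbf{Writer}_{\mathbf{M}}$ and the identity.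
   Context: The monoidal structure on the category $\mathbf{Cat}_{\mathcal{C}}[\mathcal{C},\mathcal{C}]$ of $\mathcal{C}$-enriched endofunctors and $\mathcal{C}$-enriched natural transformations is composition. The delooping $\mathbb{B}\mathcal{V}$ of a strict monoidal category $\mathcal{V}$ is the strict 2-category with one object $*$ and hom-category $\mathcal{V}$, whose horizontal composition is the tensor product. $\cdot$ is horizontal and $\circ$ vertical composition. For a strict 2-category $\mathcal{B}$, $\mathbf{Mnd}(\mathcal{B})$ is the following strict 2-category. - Objects are monads $(X,t,\eta,\mu)$ in $\mathcal{B}$. - A 1-cell $(X,t^X,\eta^X,\mu^X)\to(Y,t^Y,\eta^Y,\mu^Y)$ is a pair $(f,\phi)$ with $f:X\to Y$ and $\phi:t^Y\cdot f\to f\cdot t^X$ satisfying $\phi\circ(\eta^Y\cdot f)=f\cdot\eta^X$ and $\phi\circ(\mu^Y\cdot f)=(f\cdot\mu^X)\circ(\phi\cdot t^X)\circ(t^Y\cdot\phi)$. - A 2-cell $(f,\phi)\to(g,\psi)$ is a 2-cell $\gamma:f\to g$ with $(\gamma\cdot t^X)\circ\phi=\psi\circ(t^Y\cdot\gamma)$. $\mathbf{Dist}(\mathcal{B}):=\mathbf{Mnd}(\mathbf{Mnd}(\mathcal{B}))$. Its objects are tuples $((X,t,\eta^t,\mu^t),(s,\sigma),\eta^s,\mu^s)$, which amount to two monads on $X$ with a distributive law $\sigma:s\cdot t\to t\cdot s$, and its 1-cells are written $((f,\phi),\psi)$. The strict 2-functors $\mathcal{U}_1,\mathcal{U}_2:\mathbf{Dist}(\mathcal{B})\to\mathbf{Mnd}(\mathcal{B})$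 send such an object to $(X,t,\eta^t,\mu^t)$ and $(X,s,\eta^s,\mu^s)$ respectively, a 1-cell $((f,\phi),\psi)$ to $(f,\phi)$ and $(f,\psi)$ respectively, and a 2-cell $\gamma$ to $\gamma$. For strict 2-categories $\mathcal{D},\mathcal{B}$, $PDist(\mathcal{D},\mathcal{B}):=\mathbf{2Cat}[\mathcal{D},\mathbf{Dist}(\mathcal{B})]$, the strict 2-functors $\mathcal{D}\to\mathbf{Dist}(\mathcal{B})$. The two underlying monads of such a strict 2-functor are its composites with $\mathcal{U}_1$ and $\mathcal{U}_2$, which are strict 2-functors $\mathcal{D}\to\mathbf{Mnd}(\mathcal{B})$. $\Delta_\alpha$ is the augmented simplex category (finite, possibly empty, totally ordered sets and monotone maps) with ordinal sum as strict monoidal structure. $\otimes_l$ is the lax Gray tensor product: strict 2-functors $\mathcal{A}\otimes_l\mathcal{E}\to\mathcal{B}$ correspond naturally to strict 2-functors from $\mathcal{A}$ to the 2-category of strict 2-functors $\mathcal{E}\to\mathcal{B}$, lax 2-natural transformations (with components $\Phi_f:\mathcal{G}(f)\cdot\Phi_X\to\Phi_Y\cdot\mathcal{F}(f)$ for $\Phi:\mathcal{F}\to\mathcal{G}$ and $f:X\to Y$) and modifications. For $\mathcal{E}=\mathbb{B}\Delta_\alpha$ this latter 2-category is identified with $\mathbf{Mnd}(\mathcal{B})$, so that $PDist(\mathcal{D},\mathcal{B})\simeq\mathbf{2Cat}[(\mathcal{D}\otimes_l\mathbb{B}\Delta_\alpha)\otimes_l\mathbb{B}\Delta_\alpha,\mathcal{B}]$.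 The writer monad $\mathbf{Writer}_{\mathbf{M}}$ is $A\mapsto M\times A$, $f\mapsto M\times f$, with unit $A\simeq *\times A\xrightarrow{u\times A}M\times A$ and multiplication $M\times(M\times A)\simeq(M\times M)\times A\xrightarrow{m\times A}M\times A$, where here $*$ is the terminal object of $\mathcal{C}$. It is canonically a $\mathcal{C}$-enriched monad, hence an object of $\mathbf{Mnd}(\mathcal{B})$.
   Formalization: "Constantly the writer monad" means constant on objects: as the second underlying monad is the identity, 1-cells keep their underlying endofunctor (for Set, A↦A×A is not sent to an identity). PDist is taken as strict 2-functors into Dist(B); the equivalent Gray tensor form is not stated. *)

theory Defs
  imports "HOL-Library.FuncSet"
begin

section \<open>Cartesian closed categories and monoid objects\<close>

record ('o, 'a) category =
  Obj :: "'o set"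
  Arr :: "'a set"
  Dom :: "'a \<Rightarrow> 'o"
  Cod :: "'a \<Rightarrow> 'o"
  Idn :: "'o \<Rightarrow> 'a"
  Cmp :: "'a \<Rightarrow> 'a \<Rightarrow> 'a"  (infixr "\<bullet>\<index>" 70)

definition hom :: "('o, 'a, 'z) category_scheme \<Rightarrow> 'o \<Rightarrow> 'o \<Rightarrow> 'a set" where
  "hom C A B = {f \<in> Arr C. Dom C f = A \<and> Cod C f = B}"

locale category =
  fixes C :: "('o, 'a, 'z) category_scheme" (structure)
  assumes Dom_Obj: "f \<in> Arr C \<Longrightarrow> Dom C f \<in> Obj C"
    and Cod_Obj: "f \<in> Arr C \<Longrightarrow> Cod C f \<in> Obj C"
    and Idn_hom: "A \<in> Obj C \<Longrightarrow> Idn C A \<in> hom C A A"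
    and Cmp_hom: "f \<in> hom C A B \<Longrightarrow> g \<in> hom C B D \<Longrightarrow> g \<bullet> f \<in> hom C A D"
    and Cmp_assoc: "f \<in> hom C A B \<Longrightarrow> g \<in> hom C B D \<Longrightarrow> h \<in> hom C D E \<Longrightarrow>
      (h \<bullet> g) \<bullet> f = h \<bullet> (g \<bullet> f)"
    and Cmp_Idn_left: "f \<in> hom C A B \<Longrightarrow> Idn C B \<bullet> f = f"
    and Cmp_Idn_right: "f \<in> hom C A B \<Longrightarrow> f \<bullet> Idn C A = f"

text \<open>\<open>Exp C A B\<close> is the internal hom \<open>[A, B] = B\<^sup>A\<close>, with evaluation
  \<open>Ev C A B : [A, B] \<times> A \<rightarrow> B\<close>.\<close>

record ('o, 'a) ccc = "('o, 'a) category" +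
  One :: "'o"
  Prod :: "'o \<Rightarrow> 'o \<Rightarrow> 'o"
  Prj1 :: "'o \<Rightarrow> 'o \<Rightarrow> 'a"
  Prj2 :: "'o \<Rightarrow> 'o \<Rightarrow> 'a"
  Exp :: "'o \<Rightarrow> 'o \<Rightarrow> 'o"
  Ev :: "'o \<Rightarrow> 'o \<Rightarrow> 'a"

definition bang :: "('o, 'a, 'z) ccc_scheme \<Rightarrow> 'o \<Rightarrow> 'a" where
  "bang C A = (THE f. f \<in> hom C A (One C))"

definition tup :: "('o, 'a, 'z) ccc_scheme \<Rightarrow> 'a \<Rightarrow> 'a \<Rightarrow> 'a" where
  "tup C f g = (THE h. h \<in> hom C (Dom C f) (Prod C (Cod C f) (Cod C g)) \<and>
     Prj1 C (Cod C f) (Cod C g) \<bullet>\<^bsub>C\<^esub> h = f \<and> Prj2 C (Cod C f) (Cod C g) \<bullet>\<^bsub>C\<^esub> h = g)"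

definition pmap :: "('o, 'a, 'z) ccc_scheme \<Rightarrow> 'a \<Rightarrow> 'a \<Rightarrow> 'a" where
  "pmap C f g = tup C (f \<bullet>\<^bsub>C\<^esub> Prj1 C (Dom C f) (Dom C g)) (g \<bullet>\<^bsub>C\<^esub> Prj2 C (Dom C f) (Dom C g))"

definition passoc :: "('o, 'a, 'z) ccc_scheme \<Rightarrow> 'o \<Rightarrow> 'o \<Rightarrow> 'o \<Rightarrow> 'a" where
  "passoc C X Y Z =
     tup C (tup C (Prj1 C X (Prod C Y Z)) (Prj1 C Y Z \<bullet>\<^bsub>C\<^esub> Prj2 C X (Prod C Y Z)))
           (Prj2 C Y Z \<bullet>\<^bsub>C\<^esub> Prj2 C X (Prod C Y Z))"

text \<open>The transpose \<open>X \<rightarrow> [A, B]\<close> of \<open>f : X \<times> A \<rightarrow> B\<close>.\<close>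

definition cur :: "('o, 'a, 'z) ccc_scheme \<Rightarrow> 'o \<Rightarrow> 'o \<Rightarrow> 'a \<Rightarrow> 'a" where
  "cur C X A f = (THE h. h \<in> hom C X (Exp C A (Cod C f)) \<and>
     Ev C A (Cod C f) \<bullet>\<^bsub>C\<^esub> pmap C h (Idn C A) = f)"

locale cartesian_closed_category = category C
  for C :: "('o, 'a, 'z) ccc_scheme" (structure) +
  assumes One_Obj: "One C \<in> Obj C"
    and One_univ: "A \<in> Obj C \<Longrightarrow> \<exists>!f. f \<in> hom C A (One C)"
    and Prod_Obj: "A \<in> Obj C \<Longrightarrow> B \<in> Obj C \<Longrightarrow> Prod C A B \<in> Obj C"
    and Prj1_hom: "A \<in> Obj C \<Longrightarrow> B \<in> Obj C \<Longrightarrow> Prj1 C A B \<in> hom C (Prod C A B) A"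
    and Prj2_hom: "A \<in> Obj C \<Longrightarrow> B \<in> Obj C \<Longrightarrow> Prj2 C A B \<in> hom C (Prod C A B) B"
    and Prod_univ: "f \<in> hom C X A \<Longrightarrow> g \<in> hom C X B \<Longrightarrow>
      \<exists>!h. h \<in> hom C X (Prod C A B) \<and> Prj1 C A B \<bullet> h = f \<and> Prj2 C A B \<bullet> h = g"
    and Exp_Obj: "A \<in> Obj C \<Longrightarrow> B \<in> Obj C \<Longrightarrow> Exp C A B \<in> Obj C"
    and Ev_hom: "A \<in> Obj C \<Longrightarrow> B \<in> Obj C \<Longrightarrow> Ev C A B \<in> hom C (Prod C (Exp C A B) A) B"
    and Exp_univ: "X \<in> Obj C \<Longrightarrow> A \<in> Obj C \<Longrightarrow> f \<in> hom C (Prod C X A) B \<Longrightarrow>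
      \<exists>!h. h \<in> hom C X (Exp C A B) \<and> Ev C A B \<bullet> pmap C h (Idn C A) = f"

definition monoid_object :: "('o, 'a, 'z) ccc_scheme \<Rightarrow> 'o \<Rightarrow> 'a \<Rightarrow> 'a \<Rightarrow> bool" where
  "monoid_object C M u m \<longleftrightarrow>
     M \<in> Obj C \<and> u \<in> hom C (One C) M \<and> m \<in> hom C (Prod C M M) M \<and>
     m \<bullet>\<^bsub>C\<^esub> tup C (u \<bullet>\<^bsub>C\<^esub> bang C M) (Idn C M) = Idn C M \<and>
     m \<bullet>\<^bsub>C\<^esub> tup C (Idn C M) (u \<bullet>\<^bsub>C\<^esub> bang C M) = Idn C M \<and>
     m \<bullet>\<^bsub>C\<^esub> pmap C (Idn C M) m = m \<bullet>\<^bsub>C\<^esub> pmap C m (Idn C M) \<bullet>\<^bsub>C\<^esub> passoc C M M M"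


section \<open>Enriched functors and enriched natural transformations\<close>

text \<open>The data of a category enriched over a category \<open>V\<close> with its cartesian monoidal structure:
  identities \<open>1 \<rightarrow> A(X, X)\<close> and compositions \<open>A(Y, Z) \<times> A(X, Y) \<rightarrow> A(X, Z)\<close>, the latter being
  \<open>ECmp A X Y Z\<close>.\<close>

record ('x, 'o, 'a) enriched =
  EObj :: "'x set"
  EHom :: "'x \<Rightarrow> 'x \<Rightarrow> 'o"
  EIdn :: "'x \<Rightarrow> 'a"
  ECmp :: "'x \<Rightarrow> 'x \<Rightarrow> 'x \<Rightarrow> 'a"

text \<open>A cartesian closed category enriched over itself. Identity and composition are the transposes
  of \<open>1 \<times> A \<rightarrow> A\<close> and of \<open>([B, D] \<times> [A, B]) \<times> A \<rightarrow> D\<close>, \<open>((g, f), a) \<mapsto> g (f a)\<close>.\<close>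

definition self_enriched :: "('o, 'a, 'z) ccc_scheme \<Rightarrow> ('o, 'o, 'a) enriched" where
  "self_enriched C = \<lparr>
     EObj = Obj C,
     EHom = Exp C,
     EIdn = (\<lambda>A. cur C (One C) A (Prj2 C (One C) A)),
     ECmp = (\<lambda>A B D. let P = Prod C (Exp C B D) (Exp C A B) in
       cur C P A (Ev C B D \<bullet>\<^bsub>C\<^esub>
         tup C (Prj1 C (Exp C B D) (Exp C A B) \<bullet>\<^bsub>C\<^esub> Prj1 C P A)
               (Ev C A B \<bullet>\<^bsub>C\<^esub> tup C (Prj2 C (Exp C B D) (Exp C A B) \<bullet>\<^bsub>C\<^esub> Prj1 C P A)
                                   (Prj2 C P A)))) \<rparr>"

text \<open>An enriched functor is its action on objects together with the arrows
  \<open>A(X, Y) \<rightarrow> B(F X, F Y)\<close>. Both maps are required to be \<open>undefined\<close> off their domain, so that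
  equality of enriched functors is equality in HOL; likewise for transformations below.\<close>

type_synonym ('x, 'y, 'a) efunctor = "('x \<Rightarrow> 'y) \<times> ('x \<times> 'x \<Rightarrow> 'a)"

definition efunctors ::
  "('o, 'a, 'z) ccc_scheme \<Rightarrow> ('x, 'o, 'a) enriched \<Rightarrow> ('y, 'o, 'a) enriched \<Rightarrow>
   ('x, 'y, 'a) efunctor set" where
  "efunctors V A B = {(F, Fh).
     F \<in> EObj A \<rightarrow>\<^sub>E EObj B \<and>
     Fh \<in> extensional (EObj A \<times> EObj A) \<and>
     (\<forall>X\<in>EObj A. \<forall>Y\<in>EObj A. Fh (X, Y) \<in> hom V (EHom A X Y) (EHom B (F X) (F Y))) \<and>
     (\<forall>X\<in>EObj A. Fh (X, X) \<bullet>\<^bsub>V\<^esub> EIdn A X = EIdn B (F X)) \<and>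
     (\<forall>X\<in>EObj A. \<forall>Y\<in>EObj A. \<forall>Z\<in>EObj A.
        Fh (X, Z) \<bullet>\<^bsub>V\<^esub> ECmp A X Y Z =
        ECmp B (F X) (F Y) (F Z) \<bullet>\<^bsub>V\<^esub> pmap V (Fh (Y, Z)) (Fh (X, Y)))}"

definition efunctor_id ::
  "('o, 'a, 'z) ccc_scheme \<Rightarrow> ('x, 'o, 'a) enriched \<Rightarrow> ('x, 'x, 'a) efunctor" where
  "efunctor_id V A = (restrict (\<lambda>X. X) (EObj A),
     restrict (\<lambda>(X, Y). Idn V (EHom A X Y)) (EObj A \<times> EObj A))"

definition efunctor_comp ::
  "('o, 'a, 'z) ccc_scheme \<Rightarrow> ('x, 'o, 'a) enriched \<Rightarrow>
   ('y, 'w, 'a) efunctor \<Rightarrow> ('x, 'y, 'a) efunctor \<Rightarrow> ('x, 'w, 'a) efunctor" where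
  "efunctor_comp V A G F = (restrict (\<lambda>X. fst G (fst F X)) (EObj A),
     restrict (\<lambda>(X, Y). snd G (fst F X, fst F Y) \<bullet>\<^bsub>V\<^esub> snd F (X, Y)) (EObj A \<times> EObj A))"

text \<open>The components of an enriched natural transformation \<open>F \<rightarrow> G\<close> are arrows
  \<open>1 \<rightarrow> B(F X, G X)\<close>, and naturality is the equality of the two composites
  \<open>A(X, Y) \<rightarrow> B(F X, G Y)\<close>.\<close>

definition enat ::
  "('o, 'a, 'z) ccc_scheme \<Rightarrow> ('x, 'o, 'a) enriched \<Rightarrow> ('y, 'o, 'a) enriched \<Rightarrow>
   ('x, 'y, 'a) efunctor \<Rightarrow> ('x, 'y, 'a) efunctor \<Rightarrow> ('x \<Rightarrow> 'a) set" where
  "enat V A B F G = {\<alpha>.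
     \<alpha> \<in> extensional (EObj A) \<and>
     (\<forall>X\<in>EObj A. \<alpha> X \<in> hom V (One V) (EHom B (fst F X) (fst G X))) \<and>
     (\<forall>X\<in>EObj A. \<forall>Y\<in>EObj A.
        ECmp B (fst F X) (fst F Y) (fst G Y) \<bullet>\<^bsub>V\<^esub>
          tup V (\<alpha> Y \<bullet>\<^bsub>V\<^esub> bang V (EHom A X Y)) (snd F (X, Y)) =
        ECmp B (fst F X) (fst G X) (fst G Y) \<bullet>\<^bsub>V\<^esub>
          tup V (snd G (X, Y)) (\<alpha> X \<bullet>\<^bsub>V\<^esub> bang V (EHom A X Y)))}"


section \<open>Strict monoidal categories, strict 2-categories and delooping\<close>

record ('o, 'a) monoidal_category = "('o, 'a) category" +
  TUnit :: "'o"
  TObj :: "'o \<Rightarrow> 'o \<Rightarrow> 'o"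
  TArr :: "'a \<Rightarrow> 'a \<Rightarrow> 'a"

text \<open>The category of enriched endofunctors, with composition as tensor product. Its arrows carry
  their source and target functor. The tensor product of \<open>\<beta> : G \<rightarrow> G'\<close> and \<open>\<alpha> : F \<rightarrow> F'\<close> is
  the horizontal composite \<open>G F \<rightarrow> G' F'\<close> with components \<open>\<beta> (F' X) \<circ> G (\<alpha> X)\<close>.\<close>

definition endofunctors ::
  "('o, 'a, 'z) ccc_scheme \<Rightarrow> ('x, 'o, 'a) enriched \<Rightarrow>
   (('x, 'x, 'a) efunctor,
    ('x, 'x, 'a) efunctor \<times> ('x \<Rightarrow> 'a) \<times> ('x, 'x, 'a) efunctor) monoidal_category" where
  "endofunctors V A = \<lparr>
     Obj = efunctors V A A,
     Arr = {(F, \<alpha>, G). F \<in> efunctors V A A \<and> G \<in> efunctors V A A \<and> \<alpha> \<in> enat V A A F G},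
     Dom = (\<lambda>(F, \<alpha>, G). F),
     Cod = (\<lambda>(F, \<alpha>, G). G),
     Idn = (\<lambda>F. (F, restrict (\<lambda>X. EIdn A (fst F X)) (EObj A), F)),
     Cmp = (\<lambda>(G', \<beta>, H) (F, \<alpha>, G).
       (F, restrict (\<lambda>X. ECmp A (fst F X) (fst G X) (fst H X) \<bullet>\<^bsub>V\<^esub> tup V (\<beta> X) (\<alpha> X)) (EObj A), H)),
     TUnit = efunctor_id V A,
     TObj = efunctor_comp V A,
     TArr = (\<lambda>(G, \<beta>, G') (F, \<alpha>, F').
       (efunctor_comp V A G F,
        restrict (\<lambda>X.
          ECmp A (fst G (fst F X)) (fst G (fst F' X)) (fst G' (fst F' X)) \<bullet>\<^bsub>V\<^esub>
            tup V (\<beta> (fst F' X)) (snd G (fst F X, fst F' X) \<bullet>\<^bsub>V\<^esub> \<alpha> X)) (EObj A),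
        efunctor_comp V A G' F')) \<rparr>"

text \<open>\<open>Cell1 B X Y\<close> are the 1-cells \<open>X \<rightarrow> Y\<close>, and \<open>Cell2 B X Y f g\<close> the 2-cells \<open>f \<rightarrow> g\<close> between
  1-cells \<open>X \<rightarrow> Y\<close>. Different homs are not required to be disjoint: in \<open>Mnd\<close> below a 1-cell is
  just a pair \<open>(f, \<phi>)\<close>, which may be a 1-cell between several pairs of monads. Therefore a
  2-functor acts on a cell together with its sources and targets.\<close>

record ('o, 'm, 'c) two_category =
  Obj0 :: "'o set"
  Cell1 :: "'o \<Rightarrow> 'o \<Rightarrow> 'm set"
  Cell2 :: "'o \<Rightarrow> 'o \<Rightarrow> 'm \<Rightarrow> 'm \<Rightarrow> 'c set"
  Id1 :: "'o \<Rightarrow> 'm"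
  Comp1 :: "'m \<Rightarrow> 'm \<Rightarrow> 'm"  (infixr "\<cdot>\<index>" 75)
  Id2 :: "'m \<Rightarrow> 'c"
  VComp :: "'c \<Rightarrow> 'c \<Rightarrow> 'c"  (infixr "\<odot>\<index>" 65)
  HComp :: "'c \<Rightarrow> 'c \<Rightarrow> 'c"  (infixr "\<star>\<index>" 75)

locale strict_two_category =
  fixes B :: "('o, 'm, 'c, 'z) two_category_scheme" (structure)
  assumes Id1_cell: "X \<in> Obj0 B \<Longrightarrow> Id1 B X \<in> Cell1 B X X"
    and Comp1_cell: "\<lbrakk>X \<in> Obj0 B; Y \<in> Obj0 B; Z \<in> Obj0 B; f \<in> Cell1 B X Y; g \<in> Cell1 B Y Z\<rbrakk> \<Longrightarrow>
      g \<cdot> f \<in> Cell1 B X Z"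
    and Comp1_assoc: "\<lbrakk>W \<in> Obj0 B; X \<in> Obj0 B; Y \<in> Obj0 B; Z \<in> Obj0 B;
      f \<in> Cell1 B W X; g \<in> Cell1 B X Y; h \<in> Cell1 B Y Z\<rbrakk> \<Longrightarrow> (h \<cdot> g) \<cdot> f = h \<cdot> (g \<cdot> f)"
    and Comp1_Id_left: "\<lbrakk>X \<in> Obj0 B; Y \<in> Obj0 B; f \<in> Cell1 B X Y\<rbrakk> \<Longrightarrow> Id1 B Y \<cdot> f = f"
    and Comp1_Id_right: "\<lbrakk>X \<in> Obj0 B; Y \<in> Obj0 B; f \<in> Cell1 B X Y\<rbrakk> \<Longrightarrow> f \<cdot> Id1 B X = f"
    and Cell2_ends: "\<lbrakk>X \<in> Obj0 B; Y \<in> Obj0 B; \<alpha> \<in> Cell2 B X Y f g\<rbrakk> \<Longrightarrow>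
      f \<in> Cell1 B X Y \<and> g \<in> Cell1 B X Y"
    and Id2_cell: "\<lbrakk>X \<in> Obj0 B; Y \<in> Obj0 B; f \<in> Cell1 B X Y\<rbrakk> \<Longrightarrow> Id2 B f \<in> Cell2 B X Y f f"
    and VComp_cell: "\<lbrakk>X \<in> Obj0 B; Y \<in> Obj0 B; \<alpha> \<in> Cell2 B X Y f g; \<beta> \<in> Cell2 B X Y g h\<rbrakk> \<Longrightarrow>
      \<beta> \<odot> \<alpha> \<in> Cell2 B X Y f h"
    and VComp_assoc: "\<lbrakk>X \<in> Obj0 B; Y \<in> Obj0 B; \<alpha> \<in> Cell2 B X Y f g; \<beta> \<in> Cell2 B X Y g h;
      \<gamma> \<in> Cell2 B X Y h k\<rbrakk> \<Longrightarrow> (\<gamma> \<odot> \<beta>) \<odot> \<alpha> = \<gamma> \<odot> (\<beta> \<odot> \<alpha>)"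
    and VComp_Id_left: "\<lbrakk>X \<in> Obj0 B; Y \<in> Obj0 B; \<alpha> \<in> Cell2 B X Y f g\<rbrakk> \<Longrightarrow> Id2 B g \<odot> \<alpha> = \<alpha>"
    and VComp_Id_right: "\<lbrakk>X \<in> Obj0 B; Y \<in> Obj0 B; \<alpha> \<in> Cell2 B X Y f g\<rbrakk> \<Longrightarrow> \<alpha> \<odot> Id2 B f = \<alpha>"
    and HComp_cell: "\<lbrakk>X \<in> Obj0 B; Y \<in> Obj0 B; Z \<in> Obj0 B;
      \<alpha> \<in> Cell2 B X Y f f'; \<beta> \<in> Cell2 B Y Z g g'\<rbrakk> \<Longrightarrow> \<beta> \<star> \<alpha> \<in> Cell2 B X Z (g \<cdot> f) (g' \<cdot> f')"
    and HComp_assoc: "\<lbrakk>W \<in> Obj0 B; X \<in> Obj0 B; Y \<in> Obj0 B; Z \<in> Obj0 B;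
      \<alpha> \<in> Cell2 B W X f f'; \<beta> \<in> Cell2 B X Y g g'; \<gamma> \<in> Cell2 B Y Z h h'\<rbrakk> \<Longrightarrow>
      (\<gamma> \<star> \<beta>) \<star> \<alpha> = \<gamma> \<star> (\<beta> \<star> \<alpha>)"
    and HComp_Id_left: "\<lbrakk>X \<in> Obj0 B; Y \<in> Obj0 B; \<alpha> \<in> Cell2 B X Y f f'\<rbrakk> \<Longrightarrow>
      Id2 B (Id1 B Y) \<star> \<alpha> = \<alpha>"
    and HComp_Id_right: "\<lbrakk>X \<in> Obj0 B; Y \<in> Obj0 B; \<alpha> \<in> Cell2 B X Y f f'\<rbrakk> \<Longrightarrow>
      \<alpha> \<star> Id2 B (Id1 B X) = \<alpha>"
    and HComp_Id2: "\<lbrakk>X \<in> Obj0 B; Y \<in> Obj0 B; Z \<in> Obj0 B; f \<in> Cell1 B X Y; g \<in> Cell1 B Y Z\<rbrakk> \<Longrightarrow>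
      Id2 B g \<star> Id2 B f = Id2 B (g \<cdot> f)"
    and interchange: "\<lbrakk>X \<in> Obj0 B; Y \<in> Obj0 B; Z \<in> Obj0 B;
      \<alpha> \<in> Cell2 B X Y f f'; \<alpha>' \<in> Cell2 B X Y f' f'';
      \<beta> \<in> Cell2 B Y Z g g'; \<beta>' \<in> Cell2 B Y Z g' g''\<rbrakk> \<Longrightarrow>
      (\<beta>' \<odot> \<beta>) \<star> (\<alpha>' \<odot> \<alpha>) = (\<beta>' \<star> \<alpha>') \<odot> (\<beta> \<star> \<alpha>)"

definition deloop ::
  "('o, 'a, 'z) monoidal_category_scheme \<Rightarrow> (unit, 'o, 'a) two_category" where
  "deloop V = \<lparr>
     Obj0 = UNIV,
     Cell1 = (\<lambda>_ _. Obj V),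
     Cell2 = (\<lambda>_ _. hom V),
     Id1 = (\<lambda>_. TUnit V),
     Comp1 = TObj V,
     Id2 = Idn V,
     VComp = Cmp V,
     HComp = TArr V \<rparr>"

record ('o, 'm, 'c, 'p, 'n, 'd) two_functor =
  Map0 :: "'o \<Rightarrow> 'p"
  Map1 :: "'o \<Rightarrow> 'o \<Rightarrow> 'm \<Rightarrow> 'n"
  Map2 :: "'o \<Rightarrow> 'o \<Rightarrow> 'm \<Rightarrow> 'm \<Rightarrow> 'c \<Rightarrow> 'd"

locale strict_two_functor = D: strict_two_category D + E: strict_two_category E
  for D :: "('o, 'm, 'c) two_category" and E :: "('p, 'n, 'd) two_category"
    and F :: "('o, 'm, 'c, 'p, 'n, 'd) two_functor" +
  assumes Map0_Obj0: "X \<in> Obj0 D \<Longrightarrow> Map0 F X \<in> Obj0 E"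
    and Map1_cell: "\<lbrakk>X \<in> Obj0 D; Y \<in> Obj0 D; f \<in> Cell1 D X Y\<rbrakk> \<Longrightarrow>
      Map1 F X Y f \<in> Cell1 E (Map0 F X) (Map0 F Y)"
    and Map2_cell: "\<lbrakk>X \<in> Obj0 D; Y \<in> Obj0 D; \<alpha> \<in> Cell2 D X Y f g\<rbrakk> \<Longrightarrow>
      Map2 F X Y f g \<alpha> \<in> Cell2 E (Map0 F X) (Map0 F Y) (Map1 F X Y f) (Map1 F X Y g)"
    and Map1_Id1: "X \<in> Obj0 D \<Longrightarrow> Map1 F X X (Id1 D X) = Id1 E (Map0 F X)"
    and Map1_Comp1: "\<lbrakk>X \<in> Obj0 D; Y \<in> Obj0 D; Z \<in> Obj0 D; f \<in> Cell1 D X Y; g \<in> Cell1 D Y Z\<rbrakk> \<Longrightarrow>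
      Map1 F X Z (g \<cdot>\<^bsub>D\<^esub> f) = Map1 F Y Z g \<cdot>\<^bsub>E\<^esub> Map1 F X Y f"
    and Map2_Id2: "\<lbrakk>X \<in> Obj0 D; Y \<in> Obj0 D; f \<in> Cell1 D X Y\<rbrakk> \<Longrightarrow>
      Map2 F X Y f f (Id2 D f) = Id2 E (Map1 F X Y f)"
    and Map2_VComp: "\<lbrakk>X \<in> Obj0 D; Y \<in> Obj0 D; \<alpha> \<in> Cell2 D X Y f g; \<beta> \<in> Cell2 D X Y g h\<rbrakk> \<Longrightarrow>
      Map2 F X Y f h (\<beta> \<odot>\<^bsub>D\<^esub> \<alpha>) = Map2 F X Y g h \<beta> \<odot>\<^bsub>E\<^esub> Map2 F X Y f g \<alpha>"
    and Map2_HComp: "\<lbrakk>X \<in> Obj0 D; Y \<in> Obj0 D; Z \<in> Obj0 D;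
      \<alpha> \<in> Cell2 D X Y f f'; \<beta> \<in> Cell2 D Y Z g g'\<rbrakk> \<Longrightarrow>
      Map2 F X Z (g \<cdot>\<^bsub>D\<^esub> f) (g' \<cdot>\<^bsub>D\<^esub> f') (\<beta> \<star>\<^bsub>D\<^esub> \<alpha>) =
      Map2 F Y Z g g' \<beta> \<star>\<^bsub>E\<^esub> Map2 F X Y f f' \<alpha>"

definition two_functor_id :: "('o, 'm, 'c, 'o, 'm, 'c) two_functor" where
  "two_functor_id = \<lparr>Map0 = (\<lambda>X. X), Map1 = (\<lambda>X Y f. f), Map2 = (\<lambda>X Y f g \<alpha>. \<alpha>)\<rparr>"

definition two_functor_comp ::
  "('p, 'n, 'd, 'q, 'k, 'e) two_functor \<Rightarrow> ('o, 'm, 'c, 'p, 'n, 'd) two_functor \<Rightarrow>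
   ('o, 'm, 'c, 'q, 'k, 'e) two_functor" where
  "two_functor_comp G F = \<lparr>
     Map0 = (\<lambda>X. Map0 G (Map0 F X)),
     Map1 = (\<lambda>X Y f. Map1 G (Map0 F X) (Map0 F Y) (Map1 F X Y f)),
     Map2 = (\<lambda>X Y f g \<alpha>.
       Map2 G (Map0 F X) (Map0 F Y) (Map1 F X Y f) (Map1 F X Y g) (Map2 F X Y f g \<alpha>))\<rparr>"

text \<open>Equality of 2-functors out of \<open>D\<close>: equality on the cells of \<open>D\<close>.\<close>

definition two_functor_eq ::
  "('o, 'm, 'c) two_category \<Rightarrow> ('o, 'm, 'c, 'p, 'n, 'd) two_functor \<Rightarrow>
   ('o, 'm, 'c, 'p, 'n, 'd) two_functor \<Rightarrow> bool" where
  "two_functor_eq D F G \<longleftrightarrow>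
     (\<forall>X\<in>Obj0 D. Map0 F X = Map0 G X) \<and>
     (\<forall>X\<in>Obj0 D. \<forall>Y\<in>Obj0 D. \<forall>f\<in>Cell1 D X Y. Map1 F X Y f = Map1 G X Y f) \<and>
     (\<forall>X\<in>Obj0 D. \<forall>Y\<in>Obj0 D. \<forall>f\<in>Cell1 D X Y. \<forall>g\<in>Cell1 D X Y. \<forall>\<alpha>\<in>Cell2 D X Y f g.
        Map2 F X Y f g \<alpha> = Map2 G X Y f g \<alpha>)"


section \<open>Monads and distributive laws in a strict 2-category\<close>

type_synonym ('o, 'm, 'c) monad = "'o \<times> 'm \<times> 'c \<times> 'c"

definition monads :: "('o, 'm, 'c, 'z) two_category_scheme \<Rightarrow> ('o, 'm, 'c) monad set" where
  "monads B = {(X, t, \<eta>, \<mu>).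
     X \<in> Obj0 B \<and> t \<in> Cell1 B X X \<and>
     \<eta> \<in> Cell2 B X X (Id1 B X) t \<and> \<mu> \<in> Cell2 B X X (t \<cdot>\<^bsub>B\<^esub> t) t \<and>
     \<mu> \<odot>\<^bsub>B\<^esub> (\<eta> \<star>\<^bsub>B\<^esub> Id2 B t) = Id2 B t \<and>
     \<mu> \<odot>\<^bsub>B\<^esub> (Id2 B t \<star>\<^bsub>B\<^esub> \<eta>) = Id2 B t \<and>
     \<mu> \<odot>\<^bsub>B\<^esub> (\<mu> \<star>\<^bsub>B\<^esub> Id2 B t) = \<mu> \<odot>\<^bsub>B\<^esub> (Id2 B t \<star>\<^bsub>B\<^esub> \<mu>)}"

definition monad_cells1 ::
  "('o, 'm, 'c, 'z) two_category_scheme \<Rightarrow> ('o, 'm, 'c) monad \<Rightarrow> ('o, 'm, 'c) monad \<Rightarrow>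
   ('m \<times> 'c) set" where
  "monad_cells1 B = (\<lambda>(X, t\<^sub>X, \<eta>\<^sub>X, \<mu>\<^sub>X) (Y, t\<^sub>Y, \<eta>\<^sub>Y, \<mu>\<^sub>Y). {(f, \<phi>).
     f \<in> Cell1 B X Y \<and> \<phi> \<in> Cell2 B X Y (t\<^sub>Y \<cdot>\<^bsub>B\<^esub> f) (f \<cdot>\<^bsub>B\<^esub> t\<^sub>X) \<and>
     \<phi> \<odot>\<^bsub>B\<^esub> (\<eta>\<^sub>Y \<star>\<^bsub>B\<^esub> Id2 B f) = Id2 B f \<star>\<^bsub>B\<^esub> \<eta>\<^sub>X \<and>
     \<phi> \<odot>\<^bsub>B\<^esub> (\<mu>\<^sub>Y \<star>\<^bsub>B\<^esub> Id2 B f) =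
       (Id2 B f \<star>\<^bsub>B\<^esub> \<mu>\<^sub>X) \<odot>\<^bsub>B\<^esub> (\<phi> \<star>\<^bsub>B\<^esub> Id2 B t\<^sub>X) \<odot>\<^bsub>B\<^esub> (Id2 B t\<^sub>Y \<star>\<^bsub>B\<^esub> \<phi>)})"

definition monad_cells2 ::
  "('o, 'm, 'c, 'z) two_category_scheme \<Rightarrow> ('o, 'm, 'c) monad \<Rightarrow> ('o, 'm, 'c) monad \<Rightarrow>
   'm \<times> 'c \<Rightarrow> 'm \<times> 'c \<Rightarrow> 'c set" where
  "monad_cells2 B = (\<lambda>(X, t\<^sub>X, \<eta>\<^sub>X, \<mu>\<^sub>X) (Y, t\<^sub>Y, \<eta>\<^sub>Y, \<mu>\<^sub>Y) (f, \<phi>) (g, \<psi>). {\<gamma>.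
     (f, \<phi>) \<in> monad_cells1 B (X, t\<^sub>X, \<eta>\<^sub>X, \<mu>\<^sub>X) (Y, t\<^sub>Y, \<eta>\<^sub>Y, \<mu>\<^sub>Y) \<and>
     (g, \<psi>) \<in> monad_cells1 B (X, t\<^sub>X, \<eta>\<^sub>X, \<mu>\<^sub>X) (Y, t\<^sub>Y, \<eta>\<^sub>Y, \<mu>\<^sub>Y) \<and>
     \<gamma> \<in> Cell2 B X Y f g \<and>
     (\<gamma> \<star>\<^bsub>B\<^esub> Id2 B t\<^sub>X) \<odot>\<^bsub>B\<^esub> \<phi> = \<psi> \<odot>\<^bsub>B\<^esub> (Id2 B t\<^sub>Y \<star>\<^bsub>B\<^esub> \<gamma>)})"

text \<open>The composite of \<open>(f, \<phi>)\<close> and \<open>(g, \<psi>)\<close> carries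
  \<open>(g \<cdot> \<phi>) \<circ> (\<psi> \<cdot> f) : t\<^sub>Z \<cdot> g \<cdot> f \<rightarrow> g \<cdot> t\<^sub>Y \<cdot> f \<rightarrow> g \<cdot> f \<cdot> t\<^sub>X\<close>; 2-cells compose as in \<open>B\<close>.\<close>

definition Mnd ::
  "('o, 'm, 'c, 'z) two_category_scheme \<Rightarrow> (('o, 'm, 'c) monad, 'm \<times> 'c, 'c) two_category" where
  "Mnd B = \<lparr>
     Obj0 = monads B,
     Cell1 = monad_cells1 B,
     Cell2 = monad_cells2 B,
     Id1 = (\<lambda>(X, t, \<eta>, \<mu>). (Id1 B X, Id2 B t)),
     Comp1 = (\<lambda>(g, \<psi>) (f, \<phi>).
       (g \<cdot>\<^bsub>B\<^esub> f, (Id2 B g \<star>\<^bsub>B\<^esub> \<phi>) \<odot>\<^bsub>B\<^esub> (\<psi> \<star>\<^bsub>B\<^esub> Id2 B f))),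
     Id2 = (\<lambda>(f, \<phi>). Id2 B f),
     VComp = VComp B,
     HComp = HComp B \<rparr>"

text \<open>In an object \<open>((X, t, \<eta>, \<mu>), (s, \<sigma>), \<eta>', \<mu>')\<close> of \<open>Dist B\<close> the distributive law is a 2-cell
  \<open>\<sigma> : t \<cdot> s \<rightarrow> s \<cdot> t\<close>, by the direction of the 2-cells \<open>\<phi>\<close> in \<^const>\<open>monad_cells1\<close>.\<close>

abbreviation Dist where "Dist B \<equiv> Mnd (Mnd B)"

definition U1 ::
  "(('o, 'm, 'c) monad \<times> ('m \<times> 'c) \<times> 'c \<times> 'c, ('m \<times> 'c) \<times> 'c, 'c,
    ('o, 'm, 'c) monad, 'm \<times> 'c, 'c) two_functor" where
  "U1 = \<lparr>
     Map0 = (\<lambda>((X, t, \<eta>\<^sub>t, \<mu>\<^sub>t), (s, \<sigma>), \<eta>\<^sub>s, \<mu>\<^sub>s). (X, t, \<eta>\<^sub>t, \<mu>\<^sub>t)),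
     Map1 = (\<lambda>_ _ ((f, \<phi>), \<psi>). (f, \<phi>)),
     Map2 = (\<lambda>_ _ _ _ \<gamma>. \<gamma>) \<rparr>"

definition U2 ::
  "(('o, 'm, 'c) monad \<times> ('m \<times> 'c) \<times> 'c \<times> 'c, ('m \<times> 'c) \<times> 'c, 'c,
    ('o, 'm, 'c) monad, 'm \<times> 'c, 'c) two_functor" where
  "U2 = \<lparr>
     Map0 = (\<lambda>((X, t, \<eta>\<^sub>t, \<mu>\<^sub>t), (s, \<sigma>), \<eta>\<^sub>s, \<mu>\<^sub>s). (X, s, \<eta>\<^sub>s, \<mu>\<^sub>s)),
     Map1 = (\<lambda>_ _ ((f, \<phi>), \<psi>). (f, \<psi>)),
     Map2 = (\<lambda>_ _ _ _ \<gamma>. \<gamma>) \<rparr>"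

definition PDist ::
  "('p, 'n, 'd) two_category \<Rightarrow> ('o, 'm, 'c) two_category \<Rightarrow>
   ('p, 'n, 'd, ('o, 'm, 'c) monad \<times> ('m \<times> 'c) \<times> 'c \<times> 'c, ('m \<times> 'c) \<times> 'c, 'c) two_functor set"
  where "PDist D B = {H. strict_two_functor D (Dist B) H}"

text \<open>A parametric monad \<open>F : D \<rightarrow> Mnd B\<close> is constantly \<open>W\<close> if its value at every object of \<open>D\<close> is
  the monad \<open>W\<close>. This does not ask that \<open>F\<close> sends 1-cells to identities. For \<open>F = U1 \<circ> H\<close> it could
  not: \<open>U1\<close> and \<open>U2\<close> agree on the underlying 1-cell \<open>f\<close> of \<open>((f, \<phi>), \<psi>)\<close>, so if \<open>U2 \<circ> H\<close> is the
  identity then \<open>U1 \<circ> H\<close> sends \<open>(f, \<psi>)\<close> to some \<open>(f, \<phi>)\<close>; see the lemma below.\<close>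

definition constantly ::
  "('p, 'n, 'd) two_category \<Rightarrow> ('o, 'm, 'c) two_category \<Rightarrow>
   ('p, 'n, 'd, ('o, 'm, 'c) monad, 'm \<times> 'c, 'c) two_functor \<Rightarrow> ('o, 'm, 'c) monad \<Rightarrow> bool" where
  "constantly D B F W \<longleftrightarrow> strict_two_functor D (Mnd B) F \<and> (\<forall>X\<in>Obj0 D. Map0 F X = W)"

lemma identities_on_1_cells_too_strong:
  assumes "two_functor_eq (Mnd B) (two_functor_comp U2 H) two_functor_id"
    and "\<And>X Y c. X \<in> monads B \<Longrightarrow> Y \<in> monads B \<Longrightarrow> c \<in> monad_cells1 B X Y \<Longrightarrow>
      Map1 (two_functor_comp U1 H) X Y c = Id1 (Mnd B) W"
    and "X \<in> monads B" "Y \<in> monads B" "(f, \<phi>) \<in> monad_cells1 B X Y"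
  shows "f = Id1 B (fst W)"
proof -
  obtain f' \<phi>' \<psi>' where H: "Map1 H X Y (f, \<phi>) = ((f', \<phi>'), \<psi>')"
    by (metis prod.exhaust)
  have "f' = f"
    using assms(1,3-5) H
    by (fastforce simp: two_functor_eq_def two_functor_comp_def two_functor_id_def U2_def Mnd_def)
  moreover have "f' = Id1 B (fst W)"
    using assms(2)[OF assms(3-5)] H
    by (auto simp: two_functor_comp_def U1_def Mnd_def split: prod.splits)
  ultimately show ?thesis by simp
qed


section \<open>The writer monad\<close>

text \<open>The enriched functor \<open>M \<times> -\<close> acts on homs by the transpose \<open>[A, B] \<rightarrow> [M \<times> A, M \<times> B]\<close> of
  \<open>(f, (x, a)) \<mapsto> (x, f a)\<close>; unit and multiplication have as components the names
  \<open>1 \<rightarrow> [A, B]\<close> of the arrows \<open>A \<rightarrow> B\<close> in question.\<close>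

definition name_of :: "('o, 'a, 'z) ccc_scheme \<Rightarrow> 'a \<Rightarrow> 'a" where
  "name_of C f = cur C (One C) (Dom C f) (f \<bullet>\<^bsub>C\<^esub> Prj2 C (One C) (Dom C f))"

definition writer_functor :: "('o, 'a, 'z) ccc_scheme \<Rightarrow> 'o \<Rightarrow> ('o, 'o, 'a) efunctor" where
  "writer_functor C M =
     (restrict (\<lambda>A. Prod C M A) (Obj C),
      restrict (\<lambda>(A, B). let E = Exp C A B; P = Prod C M A in
        cur C E P (tup C (Prj1 C M A \<bullet>\<^bsub>C\<^esub> Prj2 C E P)
          (Ev C A B \<bullet>\<^bsub>C\<^esub> tup C (Prj1 C E P) (Prj2 C M A \<bullet>\<^bsub>C\<^esub> Prj2 C E P)))) (Obj C \<times> Obj C))"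

definition writer_unit :: "('o, 'a, 'z) ccc_scheme \<Rightarrow> 'a \<Rightarrow> 'o \<Rightarrow> 'a" where
  "writer_unit C u A = pmap C u (Idn C A) \<bullet>\<^bsub>C\<^esub> tup C (bang C A) (Idn C A)"

definition writer_mult :: "('o, 'a, 'z) ccc_scheme \<Rightarrow> 'o \<Rightarrow> 'a \<Rightarrow> 'o \<Rightarrow> 'a" where
  "writer_mult C M m A = pmap C m (Idn C A) \<bullet>\<^bsub>C\<^esub> passoc C M M A"

definition Writer ::
  "('o, 'a, 'z) ccc_scheme \<Rightarrow> 'o \<Rightarrow> 'a \<Rightarrow> 'a \<Rightarrow>
   (unit, ('o, 'o, 'a) efunctor,
    ('o, 'o, 'a) efunctor \<times> ('o \<Rightarrow> 'a) \<times> ('o, 'o, 'a) efunctor) monad" where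
  "Writer C M u m = (let W = writer_functor C M; S = self_enriched C in
     ((), W,
      (efunctor_id C S, restrict (\<lambda>A. name_of C (writer_unit C u A)) (Obj C), W),
      (efunctor_comp C S W W, restrict (\<lambda>A. name_of C (writer_mult C M m A)) (Obj C), W)))"

definition B_End ::
  "('o, 'a, 'z) ccc_scheme \<Rightarrow>
   (unit, ('o, 'o, 'a) efunctor,
    ('o, 'o, 'a) efunctor \<times> ('o \<Rightarrow> 'a) \<times> ('o, 'o, 'a) efunctor) two_category" where
  "B_End C = deloop (endofunctors C (self_enriched C))"

end

theory Submission
  imports Defs
begin

text \<open>Every enriched endofunctor \<open>F\<close> of \<open>C\<close> has a canonical strength \<open>M \<times> F A \<rightarrow> F (M \<times> A)\<close>, which
  sends \<open>(x, y)\<close> to \<open>F (a \<mapsto> (x, a)) y\<close>; the inner arrow \<open>a \<mapsto> (x, a)\<close> is a generalised element of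
  \<open>[A, M \<times> A]\<close>, on which \<open>F\<close> acts because it is enriched. With \<open>W\<close> the writer functor, the
  strength is a 2-cell \<open>W \<cdot> F \<rightarrow> F \<cdot> W\<close>; it is compatible with the unit and multiplication of the
  writer monad (lemmas \<open>strength_unit\<close> and \<open>strength_mult\<close>), with identities and composition of
  endofunctors (\<open>strength_id\<close>, \<open>strength_comp\<close>), and with every enriched natural transformation
  (\<open>strength_natural\<close>).

  Together these laws say that \<open>* \<mapsto> Writer\<close>, \<open>F \<mapsto> (F, strength F)\<close>, \<open>\<gamma> \<mapsto> \<gamma>\<close> is a strict 2-functor
  \<open>S : B \<rightarrow> Mnd B\<close>, and it is a section of the 2-functor \<open>Mnd B \<rightarrow> B\<close> which forgets monads. The
  rest is formal. \<open>Mnd\<close> is functorial (\<open>Mnd_map_strict_two_functor\<close>), so \<open>Mnd S\<close> is a strict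
  2-functor \<open>Mnd B \<rightarrow> Mnd (Mnd B) = Dist B\<close>. The projection \<open>U1\<close> forgets the outer monad, so
  \<open>U1 \<circ> Mnd S\<close> sends a monad on \<open>X\<close> to \<open>S X\<close>, the writer monad; the projection \<open>U2\<close> applies the
  forgetful 2-functor to the carrier of the outer monad, so \<open>U2 \<circ> Mnd S\<close> is the identity because
  \<open>S\<close> is a section (\<open>section_PDist\<close>).

  All identities between arrows of \<open>C\<close> are proved on generalised elements. Arrows \<open>P \<rightarrow> A(X, Y)\<close> at
  a fixed stage \<open>P\<close> are the arrows \<open>X \<rightarrow> Y\<close> of an ordinary category, on which enriched functors
  act as ordinary functors and enriched transformations as natural ones, compatibly with change
  of stage. In \<open>C\<close> itself such arrows can moreover be applied to elements, and two of them agree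
  if they agree on all elements at all later stages (\<open>Exp_ext\<close>); each law of the strength then
  becomes the equation one would write down in the category of sets.\<close>

section \<open>The 2-category of monads\<close>

context strict_two_category
begin

text \<open>Hom-sets are indexed by 0-cells and need not be disjoint, so a cell does not determine its
  ends. The two typing judgements carry the ends, including the fact that they are 0-cells, in one
  premise; the axioms are restated in this form.\<close>

definition cell1 where "cell1 X Y f \<longleftrightarrow> X \<in> Obj0 B \<and> Y \<in> Obj0 B \<and> f \<in> Cell1 B X Y"
definition cell2 where "cell2 X Y f g \<alpha> \<longleftrightarrow> X \<in> Obj0 B \<and> Y \<in> Obj0 B \<and> \<alpha> \<in> Cell2 B X Y f g"

lemma cell2_ends: "cell2 X Y f g \<alpha> \<Longrightarrow> cell1 X Y f" "cell2 X Y f g \<alpha> \<Longrightarrow> cell1 X Y g"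
  using Cell2_ends by (auto simp: cell1_def cell2_def)

lemma cell1_Comp1: "\<lbrakk>cell1 X Y f; cell1 Y Z g\<rbrakk> \<Longrightarrow> cell1 X Z (g \<cdot> f)"
  by (auto simp: cell1_def Comp1_cell)

lemma cell1_assoc: "\<lbrakk>cell1 W X f; cell1 X Y g; cell1 Y Z h\<rbrakk> \<Longrightarrow> (h \<cdot> g) \<cdot> f = h \<cdot> g \<cdot> f"
  by (auto simp: cell1_def Comp1_assoc)

lemma cell1_Id: "cell1 X Y f \<Longrightarrow> Id1 B Y \<cdot> f = f" "cell1 X Y f \<Longrightarrow> f \<cdot> Id1 B X = f"
  by (auto simp: cell1_def Comp1_Id_left Comp1_Id_right)

lemma cell2_Id2: "cell1 X Y f \<Longrightarrow> cell2 X Y f f (Id2 B f)"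
  by (auto simp: cell1_def cell2_def Id2_cell)

lemma cell2_VComp: "\<lbrakk>cell2 X Y f g \<alpha>; cell2 X Y g h \<beta>\<rbrakk> \<Longrightarrow> cell2 X Y f h (\<beta> \<odot> \<alpha>)"
  by (auto simp: cell2_def VComp_cell)

lemma cell2_HComp: "\<lbrakk>cell2 X Y f f' \<alpha>; cell2 Y Z g g' \<beta>\<rbrakk> \<Longrightarrow> cell2 X Z (g \<cdot> f) (g' \<cdot> f') (\<beta> \<star> \<alpha>)"
  by (auto simp: cell2_def HComp_cell)

lemma cell2_VComp_assoc:
  "\<lbrakk>cell2 X Y f g \<alpha>; cell2 X Y g h \<beta>; cell2 X Y h k \<gamma>\<rbrakk> \<Longrightarrow> (\<gamma> \<odot> \<beta>) \<odot> \<alpha> = \<gamma> \<odot> \<beta> \<odot> \<alpha>"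
  by (auto simp: cell2_def VComp_assoc)

lemma cell2_VComp_Id: "cell2 X Y f g \<alpha> \<Longrightarrow> Id2 B g \<odot> \<alpha> = \<alpha>" "cell2 X Y f g \<alpha> \<Longrightarrow> \<alpha> \<odot> Id2 B f = \<alpha>"
  by (auto simp: cell2_def VComp_Id_left VComp_Id_right)

lemma cell2_HComp_assoc:
  "\<lbrakk>cell2 W X f f' \<alpha>; cell2 X Y g g' \<beta>; cell2 Y Z h h' \<gamma>\<rbrakk> \<Longrightarrow> (\<gamma> \<star> \<beta>) \<star> \<alpha> = \<gamma> \<star> \<beta> \<star> \<alpha>"
  by (auto simp: cell2_def HComp_assoc)

lemma cell2_interchange:
  "\<lbrakk>cell2 X Y f f' \<alpha>; cell2 X Y f' f'' \<alpha>'; cell2 Y Z g g' \<beta>; cell2 Y Z g' g'' \<beta>'\<rbrakk> \<Longrightarrow>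
    (\<beta>' \<odot> \<beta>) \<star> (\<alpha>' \<odot> \<alpha>) = (\<beta>' \<star> \<alpha>') \<odot> (\<beta> \<star> \<alpha>)"
  by (auto simp: cell2_def interchange)

lemma cell2_HComp_Id2: "\<lbrakk>cell1 X Y f; cell1 Y Z g\<rbrakk> \<Longrightarrow> Id2 B g \<star> Id2 B f = Id2 B (g \<cdot> f)"
  by (auto simp: cell1_def HComp_Id2)

text \<open>Whiskering by a 1-cell on either side. The laws of monads and of their 1-cells and 2-cells
  are equations between vertical composites of whiskered cells.\<close>

definition lw :: "'m \<Rightarrow> 'c \<Rightarrow> 'c"  where "lw g \<alpha> = Id2 B g \<star> \<alpha>"
definition rw :: "'c \<Rightarrow> 'm \<Rightarrow> 'c"  where "rw \<alpha> g = \<alpha> \<star> Id2 B g"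

lemma cell2_lw: "\<lbrakk>cell2 X Y f f' \<alpha>; cell1 Y Z g\<rbrakk> \<Longrightarrow> cell2 X Z (g \<cdot> f) (g \<cdot> f') (lw g \<alpha>)"
  by (simp add: lw_def cell2_HComp cell2_Id2)

lemma cell2_rw: "\<lbrakk>cell2 Y Z g g' \<beta>; cell1 X Y f\<rbrakk> \<Longrightarrow> cell2 X Z (g \<cdot> f) (g' \<cdot> f) (rw \<beta> f)"
  by (simp add: rw_def cell2_HComp[OF cell2_Id2])

lemma lw_VComp:
  "\<lbrakk>cell2 X Y f f' \<alpha>; cell2 X Y f' f'' \<alpha>'; cell1 Y Z g\<rbrakk> \<Longrightarrow> lw g (\<alpha>' \<odot> \<alpha>) = lw g \<alpha>' \<odot> lw g \<alpha>"
  unfolding lw_def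
  using cell2_interchange[of X Y f f' \<alpha> f'' \<alpha>' Z g g "Id2 B g" g "Id2 B g"]
  by (simp add: cell2_Id2 cell2_VComp_Id(1)[OF cell2_Id2])

lemma rw_VComp:
  "\<lbrakk>cell2 Y Z g g' \<beta>; cell2 Y Z g' g'' \<beta>'; cell1 X Y f\<rbrakk> \<Longrightarrow> rw (\<beta>' \<odot> \<beta>) f = rw \<beta>' f \<odot> rw \<beta> f"
  unfolding rw_def
  using cell2_interchange[of X Y f f "Id2 B f" f "Id2 B f" Z g g' \<beta> g'' \<beta>']
  by (simp add: cell2_Id2 cell2_VComp_Id(1)[OF cell2_Id2])

lemma lw_lw: "\<lbrakk>cell2 W X f f' \<alpha>; cell1 X Y g; cell1 Y Z h\<rbrakk> \<Longrightarrow> lw h (lw g \<alpha>) = lw (h \<cdot> g) \<alpha>"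
  unfolding lw_def by (simp add: cell2_HComp_Id2[symmetric]
    cell2_HComp_assoc[OF _ cell2_Id2 cell2_Id2])

lemma rw_rw: "\<lbrakk>cell2 Y Z h h' \<alpha>; cell1 X Y g; cell1 W X f\<rbrakk> \<Longrightarrow> rw (rw \<alpha> g) f = rw \<alpha> (g \<cdot> f)"
  unfolding rw_def by (simp add: cell2_HComp_Id2[symmetric]
    cell2_HComp_assoc[OF cell2_Id2 cell2_Id2])

lemma rw_lw: "\<lbrakk>cell2 X Y g g' \<alpha>; cell1 Y Z h; cell1 W X f\<rbrakk> \<Longrightarrow> rw (lw h \<alpha>) f = lw h (rw \<alpha> f)"
  unfolding rw_def lw_def by (simp add: cell2_HComp_assoc[OF cell2_Id2 _ cell2_Id2])

text \<open>Interchange with identities. Since both factorisations give the same horizontal composite,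
  cells that act on different factors may slide past each other.\<close>

lemma HComp_split:
  assumes a: "cell2 X Y f f' \<alpha>" and b: "cell2 Y Z g g' \<beta>"
  shows "lw g' \<alpha> \<odot> rw \<beta> f = \<beta> \<star> \<alpha>" "rw \<beta> f' \<odot> lw g \<alpha> = \<beta> \<star> \<alpha>"
  unfolding rw_def lw_def
  using cell2_interchange[OF cell2_Id2[OF cell2_ends(1)[OF a]] a b cell2_Id2[OF cell2_ends(2)[OF
    b]]]
    cell2_interchange[OF a cell2_Id2[OF cell2_ends(2)[OF a]] cell2_Id2[OF cell2_ends(1)[OF b]] b]
  by (simp_all add: cell2_VComp_Id[OF a] cell2_VComp_Id[OF b])

lemma lw_Id2: "\<lbrakk>cell1 X Y f; cell1 Y Z g\<rbrakk> \<Longrightarrow> lw g (Id2 B f) = Id2 B (g \<cdot> f)"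
  and rw_Id2: "\<lbrakk>cell1 X Y f; cell1 Y Z g\<rbrakk> \<Longrightarrow> rw (Id2 B g) f = Id2 B (g \<cdot> f)"
  by (simp_all add: lw_def rw_def cell2_HComp_Id2)

lemma lw_Id1: "cell2 X Y f f' \<alpha> \<Longrightarrow> lw (Id1 B Y) \<alpha> = \<alpha>"
  and rw_Id1: "cell2 X Y f f' \<alpha> \<Longrightarrow> rw \<alpha> (Id1 B X) = \<alpha>"
  by (auto simp: lw_def rw_def cell2_def HComp_Id_left HComp_Id_right)

lemma Id1_cell1: "X \<in> Obj0 B \<Longrightarrow> cell1 X X (Id1 B X)"
  by (auto simp: cell1_def Id1_cell)

lemma monads_iff: "(X, t, \<eta>, \<mu>) \<in> monads B \<longleftrightarrow>
   X \<in> Obj0 B \<and> cell1 X X t \<and> cell2 X X (Id1 B X) t \<eta> \<and> cell2 X X (t \<cdot> t) t \<mu> \<and>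
     \<mu> \<odot> rw \<eta> t = Id2 B t \<and> \<mu> \<odot> lw t \<eta> = Id2 B t \<and> \<mu> \<odot> rw \<mu> t = \<mu> \<odot> lw t \<mu>"
  by (auto simp: monads_def cell1_def cell2_def lw_def rw_def)

lemma monad_cells1_iff:
  assumes "X \<in> Obj0 B" "Y \<in> Obj0 B"
  shows "(f, \<phi>) \<in> monad_cells1 B (X, t, \<eta>, \<mu>) (Y, s, \<eta>', \<mu>') \<longleftrightarrow>
     cell1 X Y f \<and> cell2 X Y (s \<cdot> f) (f \<cdot> t) \<phi> \<and> \<phi> \<odot> rw \<eta>' f = lw f \<eta> \<and>
     \<phi> \<odot> rw \<mu>' f = lw f \<mu> \<odot> rw \<phi> t \<odot> lw s \<phi>"
  using assms by (auto simp: monad_cells1_def cell1_def cell2_def lw_def rw_def)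

lemma monad_cells2_iff:
  assumes "X \<in> Obj0 B" "Y \<in> Obj0 B"
  shows "\<gamma> \<in> monad_cells2 B (X, t, \<eta>, \<mu>) (Y, s, \<eta>', \<mu>') (f, \<phi>) (g, \<psi>) \<longleftrightarrow>
     (f, \<phi>) \<in> monad_cells1 B (X, t, \<eta>, \<mu>) (Y, s, \<eta>', \<mu>') \<and>
     (g, \<psi>) \<in> monad_cells1 B (X, t, \<eta>, \<mu>) (Y, s, \<eta>', \<mu>') \<and>
     cell2 X Y f g \<gamma> \<and> rw \<gamma> t \<odot> \<phi> = \<psi> \<odot> lw s \<gamma>"
  using assms by (auto simp: monad_cells2_def cell2_def lw_def rw_def)

lemma monad_cell1_Id1:
  assumes "(X, t, \<eta>, \<mu>) \<in> monads B"
  shows "(Id1 B X, Id2 B t) \<in> monad_cells1 B (X, t, \<eta>, \<mu>) (X, t, \<eta>, \<mu>)"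
proof -
  have X: "X \<in> Obj0 B" and t: "cell1 X X t" and e: "cell2 X X (Id1 B X) t \<eta>"
    and m: "cell2 X X (t \<cdot> t) t \<mu>"
    using assms by (auto simp: monads_iff)
  note i = Id1_cell1[OF X]
  show ?thesis
    using X i t cell2_Id2[OF t] rw_Id1[OF e] lw_Id1[OF e] rw_Id1[OF m] lw_Id1[OF m]
      cell2_VComp_Id[OF e] cell2_VComp_Id[OF m]
    by (simp add: monad_cells1_iff cell1_Id[OF t] lw_Id2[OF t t] rw_Id2[OF t t]
      cell2_VComp_Id[OF cell2_Id2[OF cell1_Comp1[OF t t]]])
qed

text \<open>Both laws follow by pasting: \<open>\<psi>\<close> carries the monad past \<open>g\<close>, turning \<open>r\<close> into \<open>s\<close>, and \<open>\<phi>\<close>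
  then carries \<open>s\<close> past \<open>f\<close>, and the laws of \<open>\<psi>\<close> and \<open>\<phi>\<close> apply one after the other. For the
  multiplication, one \<open>\<phi>\<close> and one \<open>\<psi>\<close> act on different factors and have to be exchanged in
  between.\<close>

lemma monad_cell1_Comp1:
  assumes T: "(X, t, \<eta>, \<mu>) \<in> monads B" and S: "(Y, s, \<eta>', \<mu>') \<in> monads B"
    and R: "(Z, r, \<eta>'', \<mu>'') \<in> monads B"
    and fc: "(f, \<phi>) \<in> monad_cells1 B (X, t, \<eta>, \<mu>) (Y, s, \<eta>', \<mu>')"
    and gc: "(g, \<psi>) \<in> monad_cells1 B (Y, s, \<eta>', \<mu>') (Z, r, \<eta>'', \<mu>'')"
  shows "(g \<cdot> f, lw g \<phi> \<odot> rw \<psi> f) \<in> monad_cells1 B (X, t, \<eta>, \<mu>) (Z, r, \<eta>'', \<mu>'')"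
proof -
  have o: "X \<in> Obj0 B" "Y \<in> Obj0 B" "Z \<in> Obj0 B"
    and t: "cell1 X X t" and s: "cell1 Y Y s" and r: "cell1 Z Z r"
    and e: "cell2 X X (Id1 B X) t \<eta>" and m: "cell2 X X (t \<cdot> t) t \<mu>"
    and e': "cell2 Y Y (Id1 B Y) s \<eta>'" and m': "cell2 Y Y (s \<cdot> s) s \<mu>'"
    and e'': "cell2 Z Z (Id1 B Z) r \<eta>''" and m'': "cell2 Z Z (r \<cdot> r) r \<mu>''"
    using T S R by (auto simp: monads_iff)
  have f: "cell1 X Y f" and p: "cell2 X Y (s \<cdot> f) (f \<cdot> t) \<phi>" and p_unit: "\<phi> \<odot> rw \<eta>' f = lw f \<eta>"
    and p_mult: "\<phi> \<odot> rw \<mu>' f = lw f \<mu> \<odot> rw \<phi> t \<odot> lw s \<phi>"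
    using fc o by (simp_all add: monad_cells1_iff)
  have g: "cell1 Y Z g" and q: "cell2 Y Z (r \<cdot> g) (g \<cdot> s) \<psi>" and q_unit: "\<psi> \<odot> rw \<eta>'' g = lw g \<eta>'"
    and q_mult: "\<psi> \<odot> rw \<mu>'' g = lw g \<mu>' \<odot> rw \<psi> s \<odot> lw r \<psi>"
    using gc o by (simp_all add: monad_cells1_iff)
  note gf = cell1_Comp1[OF f g]
  note assoc = cell1_assoc[OF f g r] cell1_assoc[OF f s g] cell1_assoc[OF t f g]
    cell1_assoc[OF g r r]
    cell1_assoc[OF f s s] cell1_assoc[OF s g r] cell1_assoc[OF s s g] cell1_assoc[OF t t f]
      cell1_assoc[OF t f s]
    cell1_assoc[OF cell1_Comp1[OF f g] r r] cell1_assoc[OF t cell1_Comp1[OF f g] r]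
      cell1_assoc[OF cell1_Comp1[OF f s] g r]
    cell1_assoc[OF cell1_Comp1[OF t f] g r] cell1_assoc[OF cell1_Comp1[OF f s] s g]
    cell1_assoc[OF f cell1_Comp1[OF g r] r] cell1_assoc[OF f cell1_Comp1[OF s g] r]
      cell1_assoc[OF f cell1_Comp1[OF s s] g]
    cell1_assoc[OF t cell1_Comp1[OF f s] g] cell1_assoc[OF cell1_Comp1[OF t f] s g]
      cell1_assoc[OF t cell1_Comp1[OF t f] g]
    cell1_assoc[OF cell1_Comp1[OF t t] f g]
    cell1_Id[OF f] cell1_Id[OF g] cell1_Id[OF gf]
  have ps: "cell2 X Z (g \<cdot> s \<cdot> f) (g \<cdot> f \<cdot> t) (lw g \<phi>)"
    and qs: "cell2 X Z (r \<cdot> g \<cdot> f) (g \<cdot> s \<cdot> f) (rw \<psi> f)"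
    using cell2_lw[OF p g] cell2_rw[OF q f] by (simp_all add: assoc)
  have es: "cell2 X Z (g \<cdot> f) (r \<cdot> g \<cdot> f) (rw \<eta>'' (g \<cdot> f))"
    using cell2_rw[OF e'' gf] by (simp add: assoc)
  have ms: "cell2 X Z (r \<cdot> r \<cdot> g \<cdot> f) (r \<cdot> g \<cdot> f) (rw \<mu>'' (g \<cdot> f))"
    using cell2_rw[OF m'' gf] by (simp add: assoc)
  have eg: "cell2 Y Z g (r \<cdot> g) (rw \<eta>'' g)" and ef: "cell2 X Y f (s \<cdot> f) (rw \<eta>' f)"
    using cell2_rw[OF e'' g] cell2_rw[OF e' f] by (simp_all add: assoc)
  have mg: "cell2 Y Z (r \<cdot> r \<cdot> g) (r \<cdot> g) (rw \<mu>'' g)"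
    and mf: "cell2 X Y (s \<cdot> s \<cdot> f) (s \<cdot> f) (rw \<mu>' f)"
    using cell2_rw[OF m'' g] cell2_rw[OF m' f] by (simp_all add: assoc)
  have "(lw g \<phi> \<odot> rw \<psi> f) \<odot> rw \<eta>'' (g \<cdot> f) = lw g \<phi> \<odot> rw \<psi> f \<odot> rw (rw \<eta>'' g) f"
    by (simp add: cell2_VComp_assoc[OF es qs ps] rw_rw[OF e'' g f])
  also have "\<dots> = lw g \<phi> \<odot> lw g (rw \<eta>' f)"
    by (simp add: rw_VComp[OF eg q f, symmetric] q_unit rw_lw[OF e' g f])
  also have "\<dots> = lw (g \<cdot> f) \<eta>"
    by (simp add: lw_VComp[OF ef p g, symmetric] p_unit lw_lw[OF e f g])
  finally have unit: "(lw g \<phi> \<odot> rw \<psi> f) \<odot> rw \<eta>'' (g \<cdot> f) = lw (g \<cdot> f) \<eta>" .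

  have ty:
    "cell2 Y Z (r \<cdot> r \<cdot> g) (r \<cdot> g \<cdot> s) (lw r \<psi>)"
    "cell2 Y Z (r \<cdot> g \<cdot> s) (g \<cdot> s \<cdot> s) (rw \<psi> s)"
    "cell2 Y Z (g \<cdot> s \<cdot> s) (g \<cdot> s) (lw g \<mu>')"
    "cell2 X Y (s \<cdot> s \<cdot> f) (s \<cdot> f \<cdot> t) (lw s \<phi>)"
    "cell2 X Y (s \<cdot> f \<cdot> t) (f \<cdot> t \<cdot> t) (rw \<phi> t)"
    "cell2 X Y (f \<cdot> t \<cdot> t) (f \<cdot> t) (lw f \<mu>)"
    using cell2_lw[OF q r] cell2_rw[OF q s] cell2_lw[OF m' g] cell2_lw[OF p s] cell2_rw[OF p t]
      cell2_lw[OF m f]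
    by (simp_all add: assoc)
  have ty2:
    "cell2 X Z (r \<cdot> r \<cdot> g \<cdot> f) (r \<cdot> g \<cdot> s \<cdot> f) (lw r (rw \<psi> f))"
    "cell2 X Z (r \<cdot> g \<cdot> s \<cdot> f) (g \<cdot> s \<cdot> s \<cdot> f) (rw \<psi> (s \<cdot> f))"
    "cell2 X Z (g \<cdot> s \<cdot> s \<cdot> f) (g \<cdot> s \<cdot> f) (lw g (rw \<mu>' f))"
    "cell2 X Z (g \<cdot> s \<cdot> s \<cdot> f) (g \<cdot> s \<cdot> f \<cdot> t) (lw (g \<cdot> s) \<phi>)"
    "cell2 X Z (g \<cdot> s \<cdot> f \<cdot> t) (g \<cdot> f \<cdot> t \<cdot> t) (lw g (rw \<phi> t))"
    "cell2 X Z (g \<cdot> f \<cdot> t \<cdot> t) (g \<cdot> f \<cdot> t) (lw (g \<cdot> f) \<mu>)"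
    "cell2 X Z (r \<cdot> g \<cdot> s \<cdot> f) (r \<cdot> g \<cdot> f \<cdot> t) (lw r (lw g \<phi>))"
    "cell2 X Z (r \<cdot> g \<cdot> f \<cdot> t) (g \<cdot> s \<cdot> f \<cdot> t) (rw (rw \<psi> f) t)"
    using cell2_lw[OF qs r] cell2_rw[OF q cell1_Comp1[OF f s]] cell2_lw[OF mf g]
      cell2_lw[OF p cell1_Comp1[OF s g]]
      cell2_lw[OF ty(5) g] cell2_lw[OF m gf] cell2_lw[OF ps r] cell2_rw[OF qs t]
    by (simp_all add: assoc)
  have 1: "rw \<psi> f \<odot> rw \<mu>'' (g \<cdot> f) = lw g (rw \<mu>' f) \<odot> rw \<psi> (s \<cdot> f) \<odot> lw r (rw \<psi> f)"
    by (simp add: rw_rw[OF m'' g f, symmetric] rw_VComp[OF mg q f, symmetric] q_mult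
      rw_VComp[OF cell2_VComp[OF ty(1,2)] ty(3) f] rw_VComp[OF ty(1,2) f]
      rw_lw[OF m' g f] rw_rw[OF q s f] rw_lw[OF q r f])
  have 2: "lw g \<phi> \<odot> lw g (rw \<mu>' f) = lw (g \<cdot> f) \<mu> \<odot> lw g (rw \<phi> t) \<odot> lw (g \<cdot> s) \<phi>"
    by (simp add: lw_VComp[OF mf p g, symmetric] p_mult lw_VComp[OF cell2_VComp[OF ty(4,5)] ty(6) g]
      lw_VComp[OF ty(4,5) g] lw_lw[OF m f g] lw_lw[OF p s g])
  \<comment> \<open>the exchange of \<open>\<phi>\<close> and \<open>\<psi>\<close>: both sides are \<open>\<psi> \<star> \<phi>\<close>\<close>
  have 3: "lw (g \<cdot> s) \<phi> \<odot> rw \<psi> (s \<cdot> f) = rw (rw \<psi> f) t \<odot> lw r (lw g \<phi>)"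
    by (simp add: HComp_split[OF p q] lw_lw[OF p g r] rw_rw[OF q f t])
  have "(lw g \<phi> \<odot> rw \<psi> f) \<odot> rw \<mu>'' (g \<cdot> f) =
      lw g \<phi> \<odot> lw g (rw \<mu>' f) \<odot> rw \<psi> (s \<cdot> f) \<odot> lw r (rw \<psi> f)"
    by (simp add: cell2_VComp_assoc[OF ms qs ps] 1)
  also have "\<dots> = (lw g \<phi> \<odot> lw g (rw \<mu>' f)) \<odot> rw \<psi> (s \<cdot> f) \<odot> lw r (rw \<psi> f)"
    by (simp add: cell2_VComp_assoc[OF cell2_VComp[OF ty2(1,2)] ty2(3) ps])
  also have "\<dots> = (lw (g \<cdot> f) \<mu> \<odot> lw g (rw \<phi> t)) \<odot> (lw (g \<cdot> s) \<phi> \<odot> rw \<psi> (s \<cdot> f)) \<odot> lw r (rw \<psi> f)"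
    by (simp only: 2 cell2_VComp_assoc[OF cell2_VComp[OF ty2(1,2)] ty2(4) cell2_VComp[OF ty2(5,6)]]
      cell2_VComp_assoc[OF ty2(4-6)] cell2_VComp_assoc[OF ty2(1,2,4)]
      cell2_VComp_assoc[OF cell2_VComp[OF cell2_VComp[OF ty2(1,2)] ty2(4)] ty2(5,6)]
      cell2_VComp_assoc[OF cell2_VComp[OF ty2(1,2)] cell2_VComp[OF ty2(4,5)] ty2(6)]
      cell2_VComp_assoc[OF cell2_VComp[OF ty2(1,2)] ty2(4,5)])
  also have "\<dots> = lw (g \<cdot> f) \<mu> \<odot> (lw g (rw \<phi> t) \<odot> rw (rw \<psi> f) t) \<odot> (lw r (lw g \<phi>) \<odot> lw r (rw \<psi> f))"
    by (simp only: 3 cell2_VComp_assoc[OF ty2(1,7,8)]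
      cell2_VComp_assoc[OF cell2_VComp[OF cell2_VComp[OF ty2(1,7)] ty2(8)] ty2(5,6)]
      cell2_VComp_assoc[OF cell2_VComp[OF ty2(1,7)] ty2(8,5)])
  also have "lw g (rw \<phi> t) \<odot> rw (rw \<psi> f) t = rw (lw g \<phi> \<odot> rw \<psi> f) t"
    by (simp add: rw_VComp[OF qs ps t] rw_lw[OF p g t])
  also have "lw r (lw g \<phi>) \<odot> lw r (rw \<psi> f) = lw r (lw g \<phi> \<odot> rw \<psi> f)"
    by (simp add: lw_VComp[OF qs ps r])
  finally show ?thesis
    using gf cell2_VComp[OF qs ps] o unit by (simp add: monad_cells1_iff assoc)
qed

lemma monad_cell2_VComp:
  assumes T: "(X, t, \<eta>, \<mu>) \<in> monads B" and S: "(Y, s, \<eta>', \<mu>') \<in> monads B"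
    and a: "\<alpha> \<in> monad_cells2 B (X, t, \<eta>, \<mu>) (Y, s, \<eta>', \<mu>') (f, \<phi>) (g, \<psi>)"
    and b: "\<beta> \<in> monad_cells2 B (X, t, \<eta>, \<mu>) (Y, s, \<eta>', \<mu>') (g, \<psi>) (h, \<chi>)"
  shows "\<beta> \<odot> \<alpha> \<in> monad_cells2 B (X, t, \<eta>, \<mu>) (Y, s, \<eta>', \<mu>') (f, \<phi>) (h, \<chi>)"
proof -
  have o: "X \<in> Obj0 B" "Y \<in> Obj0 B" and t: "cell1 X X t" and s: "cell1 Y Y s"
    using T S by (auto simp: monads_iff)
  have a1: "cell2 X Y f g \<alpha>" and b1: "cell2 X Y g h \<beta>"
    and p: "cell2 X Y (s \<cdot> f) (f \<cdot> t) \<phi>" and q: "cell2 X Y (s \<cdot> g) (g \<cdot> t) \<psi>"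
      and x: "cell2 X Y (s \<cdot> h) (h \<cdot> t) \<chi>"
    and a2: "rw \<alpha> t \<odot> \<phi> = \<psi> \<odot> lw s \<alpha>" and b2: "rw \<beta> t \<odot> \<psi> = \<chi> \<odot> lw s \<beta>"
    using a b o by (auto simp: monad_cells2_iff monad_cells1_iff)
  have "rw (\<beta> \<odot> \<alpha>) t \<odot> \<phi> = rw \<beta> t \<odot> \<psi> \<odot> lw s \<alpha>"
    by (simp add: rw_VComp[OF a1 b1 t] cell2_VComp_assoc[OF p cell2_rw[OF a1 t] cell2_rw[OF b1 t]]
      a2)
  also have "\<dots> = \<chi> \<odot> lw s (\<beta> \<odot> \<alpha>)"
    by (simp add: lw_VComp[OF a1 b1 s] b2
      cell2_VComp_assoc[OF cell2_lw[OF a1 s] cell2_lw[OF b1 s] x]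
      cell2_VComp_assoc[OF cell2_lw[OF a1 s] q cell2_rw[OF b1 t], symmetric])
  finally show ?thesis
    using a b o cell2_VComp[OF a1 b1] by (simp add: monad_cells2_iff)
qed

text \<open>Interchange lets \<open>\<delta> \<star> \<gamma>\<close> pass \<open>\<phi>\<close> using only the law of \<open>\<gamma>\<close>, and then pass \<open>\<psi>\<close> using only
  the law of \<open>\<delta>\<close>; after the first step it has become \<open>\<delta> \<star> (s \<cdot> \<gamma>)\<close>.\<close>

lemma monad_cell2_HComp:
  assumes T: "(X, t, \<eta>, \<mu>) \<in> monads B" and S: "(Y, s, \<eta>', \<mu>') \<in> monads B"
    and R: "(Z, r, \<eta>'', \<mu>'') \<in> monads B"
    and a: "\<gamma> \<in> monad_cells2 B (X, t, \<eta>, \<mu>) (Y, s, \<eta>', \<mu>') (f, \<phi>) (f', \<phi>')"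
    and b: "\<delta> \<in> monad_cells2 B (Y, s, \<eta>', \<mu>') (Z, r, \<eta>'', \<mu>'') (g, \<psi>) (g', \<psi>')"
  shows "\<delta> \<star> \<gamma> \<in> monad_cells2 B (X, t, \<eta>, \<mu>) (Z, r, \<eta>'', \<mu>'')
    (g \<cdot> f, lw g \<phi> \<odot> rw \<psi> f) (g' \<cdot> f', lw g' \<phi>' \<odot> rw \<psi>' f')"
proof -
  have o: "X \<in> Obj0 B" "Y \<in> Obj0 B" "Z \<in> Obj0 B" and t: "cell1 X X t" and s: "cell1 Y Y s"
    and r: "cell1 Z Z r"
    using T S R by (auto simp: monads_iff)
  have fg: "(f, \<phi>) \<in> monad_cells1 B (X, t, \<eta>, \<mu>) (Y, s, \<eta>', \<mu>')"
    "(f', \<phi>') \<in> monad_cells1 B (X, t, \<eta>, \<mu>) (Y, s, \<eta>', \<mu>')"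
    "(g, \<psi>) \<in> monad_cells1 B (Y, s, \<eta>', \<mu>') (Z, r, \<eta>'', \<mu>'')"
      "(g', \<psi>') \<in> monad_cells1 B (Y, s, \<eta>', \<mu>') (Z, r, \<eta>'', \<mu>'')"
    using a b o by (simp_all add: monad_cells2_iff)
  have a1: "cell2 X Y f f' \<gamma>" and b1: "cell2 Y Z g g' \<delta>"
    and a2: "rw \<gamma> t \<odot> \<phi> = \<phi>' \<odot> lw s \<gamma>" and b2: "rw \<delta> s \<odot> \<psi> = \<psi>' \<odot> lw r \<delta>"
    using a b o by (simp_all add: monad_cells2_iff)
  have p: "cell2 X Y (s \<cdot> f) (f \<cdot> t) \<phi>" and p': "cell2 X Y (s \<cdot> f') (f' \<cdot> t) \<phi>'"
    and q: "cell2 Y Z (r \<cdot> g) (g \<cdot> s) \<psi>" and q': "cell2 Y Z (r \<cdot> g') (g' \<cdot> s) \<psi>'"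
    using fg o by (simp_all add: monad_cells1_iff)
  note f = cell2_ends[OF a1] and g = cell2_ends[OF b1]
  note assoc = cell1_assoc[OF f(1) g(1) r] cell1_assoc[OF f(2) g(2) r] cell1_assoc[OF f(1) s g(1)]
    cell1_assoc[OF f(2) s g(2)]
    cell1_assoc[OF t f(1) g(1)] cell1_assoc[OF t f(2) g(2)] cell1_assoc[OF f(2) s g(1)]
      cell1_assoc[OF f(1) s g(2)]
  have ps: "cell2 X Z (g \<cdot> s \<cdot> f) (g \<cdot> f \<cdot> t) (lw g \<phi>)"
    and qs: "cell2 X Z (r \<cdot> g \<cdot> f) (g \<cdot> s \<cdot> f) (rw \<psi> f)"
    and ps': "cell2 X Z (g' \<cdot> s \<cdot> f') (g' \<cdot> f' \<cdot> t) (lw g' \<phi>')"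
      and qs': "cell2 X Z (r \<cdot> g' \<cdot> f') (g' \<cdot> s \<cdot> f') (rw \<psi>' f')"
    using cell2_lw[OF p g(1)] cell2_rw[OF q f(1)] cell2_lw[OF p' g(2)] cell2_rw[OF q' f(2)]
      by (simp_all add: assoc)
  have d: "cell2 X Z (g \<cdot> f) (g' \<cdot> f') (\<delta> \<star> \<gamma>)"
    using cell2_HComp[OF a1 b1] .
  have dt: "cell2 X Z (g \<cdot> f \<cdot> t) (g' \<cdot> f' \<cdot> t) (rw (\<delta> \<star> \<gamma>) t)"
    and dr: "cell2 X Z (r \<cdot> g \<cdot> f) (r \<cdot> g' \<cdot> f') (lw r (\<delta> \<star> \<gamma>))"
    using cell2_rw[OF d t] cell2_lw[OF d r] by (simp_all add: assoc)
  have ds: "cell2 X Z (g \<cdot> s \<cdot> f) (g' \<cdot> s \<cdot> f') (\<delta> \<star> lw s \<gamma>)"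
    using cell2_HComp[OF cell2_lw[OF a1 s] b1] .
  have 1: "rw (\<delta> \<star> \<gamma>) t \<odot> lw g \<phi> = lw g' \<phi>' \<odot> (\<delta> \<star> lw s \<gamma>)"
  proof -
    have "rw (\<delta> \<star> \<gamma>) t \<odot> lw g \<phi> = (\<delta> \<odot> Id2 B g) \<star> (rw \<gamma> t \<odot> \<phi>)"
      using cell2_interchange[OF p cell2_rw[OF a1 t] cell2_Id2[OF g(1)] b1]
      by (simp add: rw_def lw_def cell2_HComp_assoc[OF cell2_Id2[OF t] a1 b1])
    also have "\<dots> = (Id2 B g' \<odot> \<delta>) \<star> (\<phi>' \<odot> lw s \<gamma>)"
      by (simp add: a2 cell2_VComp_Id[OF b1])
    also have "\<dots> = lw g' \<phi>' \<odot> (\<delta> \<star> lw s \<gamma>)"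
      using cell2_interchange[OF cell2_lw[OF a1 s] p' b1 cell2_Id2[OF g(2)]]
      by (simp add: lw_def)
    finally show ?thesis .
  qed
  have 2: "(\<delta> \<star> lw s \<gamma>) \<odot> rw \<psi> f = rw \<psi>' f' \<odot> lw r (\<delta> \<star> \<gamma>)"
  proof -
    have "(\<delta> \<star> lw s \<gamma>) \<odot> rw \<psi> f = (rw \<delta> s \<odot> \<psi>) \<star> (\<gamma> \<odot> Id2 B f)"
      using cell2_interchange[OF cell2_Id2[OF f(1)] a1 q cell2_rw[OF b1 s]]
      by (simp add: rw_def lw_def cell2_HComp_assoc[OF a1 cell2_Id2[OF s] b1])
    also have "\<dots> = (\<psi>' \<odot> lw r \<delta>) \<star> (Id2 B f' \<odot> \<gamma>)"
      by (simp add: b2 cell2_VComp_Id[OF a1])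
    also have "\<dots> = rw \<psi>' f' \<odot> lw r (\<delta> \<star> \<gamma>)"
      using cell2_interchange[OF a1 cell2_Id2[OF f(2)] cell2_lw[OF b1 r] q']
      by (simp add: rw_def lw_def cell2_HComp_assoc[OF a1 b1 cell2_Id2[OF r]])
    finally show ?thesis .
  qed
  have "rw (\<delta> \<star> \<gamma>) t \<odot> lw g \<phi> \<odot> rw \<psi> f = (lw g' \<phi>' \<odot> rw \<psi>' f') \<odot> lw r (\<delta> \<star> \<gamma>)"
    by (simp add: cell2_VComp_assoc[OF qs ps dt, symmetric] 1 cell2_VComp_assoc[OF qs ds ps'] 2
      cell2_VComp_assoc[OF dr qs' ps'])
  then show ?thesis
    using monad_cell1_Comp1[OF T S R fg(1,3)] monad_cell1_Comp1[OF T S R fg(2,4)] d o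
    by (simp add: monad_cells2_iff)
qed

lemma monad_cell2_Id2:
  assumes T: "(X, t, \<eta>, \<mu>) \<in> monads B" and S: "(Y, s, \<eta>', \<mu>') \<in> monads B"
    and fc: "(f, \<phi>) \<in> monad_cells1 B (X, t, \<eta>, \<mu>) (Y, s, \<eta>', \<mu>')"
  shows "Id2 B f \<in> monad_cells2 B (X, t, \<eta>, \<mu>) (Y, s, \<eta>', \<mu>') (f, \<phi>) (f, \<phi>)"
proof -
  have o: "X \<in> Obj0 B" "Y \<in> Obj0 B" and t: "cell1 X X t" and s: "cell1 Y Y s"
    using T S by (auto simp: monads_iff)
  have f: "cell1 X Y f" and p: "cell2 X Y (s \<cdot> f) (f \<cdot> t) \<phi>"
    using fc o by (simp_all add: monad_cells1_iff)
  show ?thesis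
    using fc o cell2_Id2[OF f] by (simp add: monad_cells2_iff rw_Id2[OF t f] lw_Id2[OF f s]
      cell2_VComp_Id[OF p])
qed

text \<open>Both sides carry the monad past \<open>h\<close>, \<open>g\<close> and \<open>f\<close> in this order, so they differ only by the
  functoriality of whiskering.\<close>

lemma Mnd_Comp1_assoc:
  assumes f: "cell1 W X f" and g: "cell1 X Y g" and h: "cell1 Y Z h"
    and t: "cell1 W W t" and s: "cell1 X X s" and r: "cell1 Y Y r" and k: "cell1 Z Z k"
    and p: "cell2 W X (s \<cdot> f) (f \<cdot> t) \<phi>" and q: "cell2 X Y (r \<cdot> g) (g \<cdot> s) \<psi>"
      and x: "cell2 Y Z (k \<cdot> h) (h \<cdot> r) \<chi>"
  shows "lw (h \<cdot> g) \<phi> \<odot> rw (lw h \<psi> \<odot> rw \<chi> g) f = lw h (lw g \<phi> \<odot> rw \<psi> f) \<odot> rw \<chi> (g \<cdot> f)"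
proof -
  note assoc = cell1_assoc[OF f s g] cell1_assoc[OF g r h] cell1_assoc[OF f g r]
    cell1_assoc[OF g h k] cell1_assoc[OF s g h]
    cell1_assoc[OF f cell1_Comp1[OF s g] h] cell1_assoc[OF f cell1_Comp1[OF g r] h]
  have p1: "cell2 W Y (g \<cdot> s \<cdot> f) (g \<cdot> f \<cdot> t) (lw g \<phi>)"
    and q1: "cell2 W Y (r \<cdot> g \<cdot> f) (g \<cdot> s \<cdot> f) (rw \<psi> f)"
    and q2: "cell2 X Z (h \<cdot> r \<cdot> g) (h \<cdot> g \<cdot> s) (lw h \<psi>)"
      and x2: "cell2 X Z ((k \<cdot> h) \<cdot> g) (h \<cdot> r \<cdot> g) (rw \<chi> g)"
    using cell2_lw[OF p g] cell2_rw[OF q f] cell2_lw[OF q h] cell2_rw[OF x g]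
      by (simp_all add: assoc)
  have x3: "cell2 W Z ((k \<cdot> h) \<cdot> (g \<cdot> f)) (h \<cdot> r \<cdot> g \<cdot> f) (rw \<chi> (g \<cdot> f))"
    using cell2_rw[OF x cell1_Comp1[OF f g]] by (simp add: assoc
      cell1_assoc[OF cell1_Comp1[OF f g] r h])
  show ?thesis
    by (simp add: lw_VComp[OF q1 p1 h] rw_VComp[OF x2 q2 f] lw_lw[OF p g h] rw_lw[OF q h f]
      rw_rw[OF x g f]
      cell2_VComp_assoc[OF x3 cell2_lw[OF q1 h] cell2_lw[OF p1 h, unfolded lw_lw[OF p g h]]])
qed

lemma Mnd_simps:
  "Obj0 (Mnd B) = monads B" "Cell1 (Mnd B) = monad_cells1 B" "Cell2 (Mnd B) = monad_cells2 B"
  "Id1 (Mnd B) (X, t, \<eta>, \<mu>) = (Id1 B X, Id2 B t)"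
  "(g, \<psi>) \<cdot>\<^bsub>Mnd B\<^esub> (f, \<phi>) = (g \<cdot> f, lw g \<phi> \<odot> rw \<psi> f)"
  "Id2 (Mnd B) (f, \<phi>) = Id2 B f" "VComp (Mnd B) = VComp B" "HComp (Mnd B) = HComp B"
  by (simp_all add: Mnd_def lw_def rw_def)

theorem Mnd_strict_two_category: "strict_two_category (Mnd B)"
proof (unfold_locales, goal_cases)
  case (1 T)
  then show ?case by (cases T) (auto simp: Mnd_simps monad_cell1_Id1)
next
  case (2 T S R f g)
  then show ?case
    by (cases T; cases S; cases R; cases f; cases g) (auto simp: Mnd_simps monad_cell1_Comp1)
next
  case (3 K T S R f g h)
  obtain W t0 e0 m0 X t1 e1 m1 Y t2 e2 m2 Z t3 e3 m3 f' p g' q h' x where e: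
    "K = (W, t0, e0, m0)" "T = (X, t1, e1, m1)" "S = (Y, t2, e2, m2)" "R = (Z, t3, e3, m3)"
    "f = (f', p)" "g = (g', q)" "h = (h', x)"
    by (metis surj_pair)
  then have "cell1 W X f'" "cell1 X Y g'" "cell1 Y Z h'" "cell1 W W t0" "cell1 X X t1"
    "cell1 Y Y t2" "cell1 Z Z t3"
    "cell2 W X (t1 \<cdot> f') (f' \<cdot> t0) p" "cell2 X Y (t2 \<cdot> g') (g' \<cdot> t1) q"
      "cell2 Y Z (t3 \<cdot> h') (h' \<cdot> t2) x"
    using 3 by (auto simp: Mnd_simps monads_iff monad_cells1_iff)
  then show ?case
    using Mnd_Comp1_assoc[of W X f' Y g' Z h' t0 t1 t2 t3 p q x] cell1_assoc[of W X f' Y g' Z h']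
    by (simp add: e Mnd_simps)
next
  case (4 T S f)
  obtain X t1 e1 m1 Y t2 e2 m2 f' p where e:
    "T = (X, t1, e1, m1)" "S = (Y, t2, e2, m2)" "f = (f', p)"
    by (metis surj_pair)
  then have "cell1 X Y f'" "cell1 Y Y t2" "cell2 X Y (t2 \<cdot> f') (f' \<cdot> t1) p"
    using 4 by (auto simp: Mnd_simps monads_iff monad_cells1_iff)
  then show ?case
    using e by (simp add: Mnd_simps cell1_Id lw_Id1 rw_Id2 cell2_VComp_Id)
next
  case (5 T S f)
  obtain X t1 e1 m1 Y t2 e2 m2 f' p where e:
    "T = (X, t1, e1, m1)" "S = (Y, t2, e2, m2)" "f = (f', p)"
    by (metis surj_pair)
  then have "cell1 X Y f'" "cell1 X X t1" "cell2 X Y (t2 \<cdot> f') (f' \<cdot> t1) p"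
    using 5 by (auto simp: Mnd_simps monads_iff monad_cells1_iff)
  then show ?case
    using e by (simp add: Mnd_simps cell1_Id rw_Id1 lw_Id2 cell2_VComp_Id)
next
  case (6 T S \<alpha> f g)
  then show ?case
    by (cases T; cases S; cases f; cases g) (auto simp: Mnd_simps monads_iff monad_cells2_iff)
next
  case (7 T S f)
  then show ?case
    by (cases T; cases S; cases f) (auto simp: Mnd_simps monad_cell2_Id2)
next
  case (8 T S \<alpha> f g \<beta> h)
  then show ?case
    by (cases T; cases S; cases f; cases g; cases h) (auto simp: Mnd_simps intro: monad_cell2_VComp)
next
  case (9 T S \<alpha> f g \<beta> h \<gamma> k)
  then show ?case
    by (cases T; cases S; cases f; cases g; cases h; cases k)
      (auto simp: Mnd_simps monads_iff monad_cells2_iff intro: cell2_VComp_assoc)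
next
  case (10 T S \<alpha> f g)
  then show ?case
    by (cases T; cases S; cases f; cases g) (auto simp:
      Mnd_simps monads_iff monad_cells2_iff intro: cell2_VComp_Id)
next
  case (11 T S \<alpha> f g)
  then show ?case
    by (cases T; cases S; cases f; cases g) (auto simp:
      Mnd_simps monads_iff monad_cells2_iff intro: cell2_VComp_Id)
next
  case (12 T S R \<alpha> f f' \<beta> g g')
  then show ?case
    by (cases T; cases S; cases R; cases f; cases f'; cases g; cases g')
      (auto simp: Mnd_simps monad_cell2_HComp)
next
  case (13 K T S R \<alpha> f f' \<beta> g g' \<gamma> h h')
  then show ?case
    by (cases K; cases T; cases S; cases R; cases f; cases f'; cases g; cases g'; cases h; cases h')
      (auto simp: Mnd_simps monads_iff monad_cells2_iff intro: cell2_HComp_assoc)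
next
  case (14 T S \<alpha> f f')
  then show ?case
    by (cases T; cases S; cases f; cases f')
      (auto simp: Mnd_simps monads_iff monad_cells2_iff simp flip: lw_def intro: lw_Id1)
next
  case (15 T S \<alpha> f f')
  then show ?case
    by (cases T; cases S; cases f; cases f')
      (auto simp: Mnd_simps monads_iff monad_cells2_iff simp flip: rw_def intro: rw_Id1)
next
  case (16 T S R f g)
  then show ?case
    by (cases T; cases S; cases R; cases f; cases g)
      (auto simp: Mnd_simps monads_iff monad_cells1_iff intro: cell2_HComp_Id2)
next
  case (17 T S R \<alpha> f f' \<alpha>' f'' \<beta> g g' \<beta>' g'')
  then show ?case
    by (cases T; cases S; cases R; cases f; cases f'; cases f''; cases g; cases g'; cases g'')
      (auto simp: Mnd_simps monads_iff monad_cells2_iff intro: cell2_interchange)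
qed

end

section \<open>Monads under 2-functors\<close>

lemma strict_two_functor_comp:
  assumes "strict_two_functor D E F" "strict_two_functor E K G"
  shows "strict_two_functor D K (two_functor_comp G F)"
proof -
  interpret F: strict_two_functor D E F by fact
  interpret G: strict_two_functor E K G by fact
  show ?thesis
  proof (unfold_locales, goal_cases)
    case (8 X Y Z \<alpha> f f' \<beta> g g')
    then have "f \<in> Cell1 D X Y" "f' \<in> Cell1 D X Y" "g \<in> Cell1 D Y Z" "g' \<in> Cell1 D Y Z"
      using F.D.Cell2_ends by blast+
    then show ?case
      using 8 G.Map2_HComp[OF _ _ _ F.Map2_cell[OF 8(1,2,4)] F.Map2_cell[OF 8(2,3,5)]]
      by (simp add: two_functor_comp_def F.Map0_Obj0 F.Map1_Comp1 F.Map2_HComp)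
  qed (auto simp: two_functor_comp_def F.Map0_Obj0 F.Map1_cell F.Map2_cell G.Map0_Obj0 G.Map1_cell
        G.Map2_cell F.Map1_Id1 G.Map1_Id1 F.Map1_Comp1 G.Map1_Comp1 F.Map2_Id2 G.Map2_Id2
        F.Map2_VComp G.Map2_VComp[OF _ _ F.Map2_cell F.Map2_cell])
qed

text \<open>The 2-functor \<open>Mnd K \<rightarrow> K\<close> that keeps the underlying cells. For \<open>K = Mnd B\<close> it is \<^const>\<open>U1\<close>.\<close>

definition forget ::
  "('o \<times> 'm \<times> 'c \<times> 'c, 'm \<times> 'c, 'c, 'o, 'm, 'c) two_functor" where
  "forget = \<lparr>Map0 = fst, Map1 = (\<lambda>_ _. fst), Map2 = (\<lambda>_ _ _ _ \<gamma>. \<gamma>)\<rparr>"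

lemma U1_eq_forget: "U1 = forget"
  by (auto simp: U1_def forget_def fun_eq_iff)

lemma forget_strict_two_functor:
  fixes B :: "('o, 'm, 'c) two_category"
  assumes "strict_two_category B"
  shows "strict_two_functor (Mnd B) B forget"
proof -
  interpret B: strict_two_category B by fact
  interpret M: strict_two_category "Mnd B" by (rule B.Mnd_strict_two_category)
  show ?thesis
    by unfold_locales
      (auto simp: forget_def Mnd_def monads_def monad_cells1_def monad_cells2_def)
qed

text \<open>The action of \<open>Mnd\<close> on 2-functors. A 2-functor needs to be told the ends of each 2-cell, so
  the source 2-category \<open>D\<close>, in which these ends are composed, is an argument.\<close>

definition Mnd_map ::
  "('o, 'm, 'c) two_category \<Rightarrow> ('o, 'm, 'c, 'p, 'n, 'd) two_functor \<Rightarrow>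
   (('o, 'm, 'c) monad, 'm \<times> 'c, 'c, ('p, 'n, 'd) monad, 'n \<times> 'd, 'd) two_functor" where
  "Mnd_map D F = \<lparr>
     Map0 = (\<lambda>(X, t, \<eta>, \<mu>).
       (Map0 F X, Map1 F X X t, Map2 F X X (Id1 D X) t \<eta>, Map2 F X X (t \<cdot>\<^bsub>D\<^esub> t) t \<mu>)),
     Map1 = (\<lambda>(X, t, _) (Y, s, _) (f, \<phi>).
       (Map1 F X Y f, Map2 F X Y (s \<cdot>\<^bsub>D\<^esub> f) (f \<cdot>\<^bsub>D\<^esub> t) \<phi>)),
     Map2 = (\<lambda>(X, _) (Y, _) (f, _) (g, _) \<gamma>. Map2 F X Y f g \<gamma>)\<rparr>"

context strict_two_functor
begin

lemma F_cell1: "D.cell1 X Y f \<Longrightarrow> E.cell1 (Map0 F X) (Map0 F Y) (Map1 F X Y f)"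
  by (simp add: D.cell1_def E.cell1_def Map0_Obj0 Map1_cell)

lemma F_cell2: "D.cell2 X Y f g \<alpha> \<Longrightarrow>
    E.cell2 (Map0 F X) (Map0 F Y) (Map1 F X Y f) (Map1 F X Y g) (Map2 F X Y f g \<alpha>)"
  by (simp add: D.cell2_def E.cell2_def Map0_Obj0 Map2_cell)

lemma F_Comp1: "\<lbrakk>D.cell1 X Y f; D.cell1 Y Z g\<rbrakk> \<Longrightarrow>
  Map1 F X Z (g \<cdot>\<^bsub>D\<^esub> f) = Map1 F Y Z g \<cdot>\<^bsub>E\<^esub> Map1 F X Y f"
  by (simp add: D.cell1_def Map1_Comp1)

lemma F_Id2: "D.cell1 X Y f \<Longrightarrow> Map2 F X Y f f (Id2 D f) = Id2 E (Map1 F X Y f)"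
  by (simp add: D.cell1_def Map2_Id2)

lemma F_VComp: "\<lbrakk>D.cell2 X Y f g \<alpha>; D.cell2 X Y g h \<beta>\<rbrakk> \<Longrightarrow>
    Map2 F X Y f h (\<beta> \<odot>\<^bsub>D\<^esub> \<alpha>) = Map2 F X Y g h \<beta> \<odot>\<^bsub>E\<^esub> Map2 F X Y f g \<alpha>"
  by (simp add: D.cell2_def Map2_VComp)

lemma F_lw: "\<lbrakk>D.cell2 X Y f f' \<alpha>; D.cell1 Y Z g; k = g \<cdot>\<^bsub>D\<^esub> f; k' = g \<cdot>\<^bsub>D\<^esub> f'\<rbrakk> \<Longrightarrow>
    Map2 F X Z k k' (D.lw g \<alpha>) = E.lw (Map1 F Y Z g) (Map2 F X Y f f' \<alpha>)"
  unfolding D.lw_def E.lw_def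
  using Map2_HComp[of X Y Z \<alpha> f f' "Id2 D g" g g] D.cell2_Id2[of Y Z g]
  by (simp add: D.cell2_def D.cell1_def Map2_Id2)

lemma F_rw: "\<lbrakk>D.cell2 Y Z g g' \<beta>; D.cell1 X Y f; k = g \<cdot>\<^bsub>D\<^esub> f; k' = g' \<cdot>\<^bsub>D\<^esub> f\<rbrakk> \<Longrightarrow>
    Map2 F X Z k k' (D.rw \<beta> f) = E.rw (Map2 F Y Z g g' \<beta>) (Map1 F X Y f)"
  unfolding D.rw_def E.rw_def
  using Map2_HComp[of X Y Z "Id2 D f" f f \<beta> g g'] D.cell2_Id2[of X Y f]
  by (simp add: D.cell2_def D.cell1_def Map2_Id2)

text \<open>All data and laws of monads are built from vertical composition and whiskering, which a
  strict 2-functor preserves. The same reason gives the next three lemmas.\<close>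

lemma Mnd_map_monad:
  assumes T: "(X, t, \<eta>, \<mu>) \<in> monads D"
  shows "Map0 (Mnd_map D F) (X, t, \<eta>, \<mu>) \<in> monads E"
proof -
  have X: "X \<in> Obj0 D" and t: "D.cell1 X X t" and e: "D.cell2 X X (Id1 D X) t \<eta>"
    and m: "D.cell2 X X (t \<cdot>\<^bsub>D\<^esub> t) t \<mu>"
    and eqs: "\<mu> \<odot>\<^bsub>D\<^esub> D.rw \<eta> t = Id2 D t" "\<mu> \<odot>\<^bsub>D\<^esub> D.lw t \<eta> = Id2 D t"
      "\<mu> \<odot>\<^bsub>D\<^esub> D.rw \<mu> t = \<mu> \<odot>\<^bsub>D\<^esub> D.lw t \<mu>"
    using T by (auto simp: D.monads_iff)
  note tt = D.cell1_Comp1[OF t t]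
  have ty: "D.cell2 X X t (t \<cdot>\<^bsub>D\<^esub> t) (D.rw \<eta> t)" "D.cell2 X X t (t \<cdot>\<^bsub>D\<^esub> t) (D.lw t \<eta>)"
    "D.cell2 X X (t \<cdot>\<^bsub>D\<^esub> t \<cdot>\<^bsub>D\<^esub> t) (t \<cdot>\<^bsub>D\<^esub> t) (D.rw \<mu> t)"
      "D.cell2 X X (t \<cdot>\<^bsub>D\<^esub> t \<cdot>\<^bsub>D\<^esub> t) (t \<cdot>\<^bsub>D\<^esub> t) (D.lw t \<mu>)"
    using D.cell2_rw[OF e t] D.cell2_lw[OF e t] D.cell2_rw[OF m t] D.cell2_lw[OF m t]
    by (simp_all add: D.cell1_Id[OF t] D.cell1_assoc[OF t t t])
  have "Map2 F X X t t (\<mu> \<odot>\<^bsub>D\<^esub> D.rw \<eta> t) = Id2 E (Map1 F X X t)"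
    "Map2 F X X t t (\<mu> \<odot>\<^bsub>D\<^esub> D.lw t \<eta>) = Id2 E (Map1 F X X t)"
    "Map2 F X X (t \<cdot>\<^bsub>D\<^esub> t \<cdot>\<^bsub>D\<^esub> t) t (\<mu> \<odot>\<^bsub>D\<^esub> D.rw \<mu> t) =
      Map2 F X X (t \<cdot>\<^bsub>D\<^esub> t \<cdot>\<^bsub>D\<^esub> t) t (\<mu> \<odot>\<^bsub>D\<^esub> D.lw t \<mu>)"
    by (simp_all add: eqs F_Id2[OF t])
  then show ?thesis
    using F_cell1[OF t] F_cell2[OF e] F_cell2[OF m] Map0_Obj0[OF X]
    by (simp add: Mnd_map_def E.monads_iff F_VComp[OF ty(1) m] F_VComp[OF ty(2) m]
      F_VComp[OF ty(3) m]
      F_VComp[OF ty(4) m] F_rw[OF e t] F_lw[OF e t] F_rw[OF m t] F_lw[OF m t] D.cell1_Id[OF t]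
      D.cell1_assoc[OF t t t] Map1_Id1[OF X] F_Comp1[OF t t])
qed

lemma Mnd_map_cell1:
  assumes T: "(X, t, \<eta>, \<mu>) \<in> monads D" and S: "(Y, s, \<eta>', \<mu>') \<in> monads D"
    and fc: "(f, \<phi>) \<in> monad_cells1 D (X, t, \<eta>, \<mu>) (Y, s, \<eta>', \<mu>')"
  shows "Map1 (Mnd_map D F) (X, t, \<eta>, \<mu>) (Y, s, \<eta>', \<mu>') (f, \<phi>) \<in>
    monad_cells1 E (Map0 (Mnd_map D F) (X, t, \<eta>, \<mu>)) (Map0 (Mnd_map D F) (Y, s, \<eta>', \<mu>'))"
proof -
  have o: "X \<in> Obj0 D" "Y \<in> Obj0 D" and t: "D.cell1 X X t" and s: "D.cell1 Y Y s"
    and e: "D.cell2 X X (Id1 D X) t \<eta>" and m: "D.cell2 X X (t \<cdot>\<^bsub>D\<^esub> t) t \<mu>"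
    and e': "D.cell2 Y Y (Id1 D Y) s \<eta>'" and m': "D.cell2 Y Y (s \<cdot>\<^bsub>D\<^esub> s) s \<mu>'"
    using T S by (auto simp: D.monads_iff)
  have f: "D.cell1 X Y f" and p: "D.cell2 X Y (s \<cdot>\<^bsub>D\<^esub> f) (f \<cdot>\<^bsub>D\<^esub> t) \<phi>"
    and eqs: "\<phi> \<odot>\<^bsub>D\<^esub> D.rw \<eta>' f = D.lw f \<eta>" "\<phi> \<odot>\<^bsub>D\<^esub> D.rw \<mu>' f = D.lw f \<mu> \<odot>\<^bsub>D\<^esub> D.rw \<phi> t \<odot>\<^bsub>D\<^esub> D.lw s \<phi>"
    using fc o by (simp_all add: D.monad_cells1_iff)
  note assoc = D.cell1_Id[OF f] D.cell1_assoc[OF f s s] D.cell1_assoc[OF t f s]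
    D.cell1_assoc[OF t t f]
  have ty: "D.cell2 X Y f (s \<cdot>\<^bsub>D\<^esub> f) (D.rw \<eta>' f)"
    "D.cell2 X Y (s \<cdot>\<^bsub>D\<^esub> s \<cdot>\<^bsub>D\<^esub> f) (s \<cdot>\<^bsub>D\<^esub> f) (D.rw \<mu>' f)"
    "D.cell2 X Y (s \<cdot>\<^bsub>D\<^esub> s \<cdot>\<^bsub>D\<^esub> f) (s \<cdot>\<^bsub>D\<^esub> f \<cdot>\<^bsub>D\<^esub> t) (D.lw s \<phi>)"
    "D.cell2 X Y (s \<cdot>\<^bsub>D\<^esub> f \<cdot>\<^bsub>D\<^esub> t) (f \<cdot>\<^bsub>D\<^esub> t \<cdot>\<^bsub>D\<^esub> t) (D.rw \<phi> t)"
    "D.cell2 X Y (f \<cdot>\<^bsub>D\<^esub> t \<cdot>\<^bsub>D\<^esub> t) (f \<cdot>\<^bsub>D\<^esub> t) (D.lw f \<mu>)"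
    using D.cell2_rw[OF e' f] D.cell2_rw[OF m' f] D.cell2_lw[OF p s] D.cell2_rw[OF p t]
      D.cell2_lw[OF m f]
    by (simp_all add: assoc)
  have "Map2 F X Y f (f \<cdot>\<^bsub>D\<^esub> t) (\<phi> \<odot>\<^bsub>D\<^esub> D.rw \<eta>' f) = Map2 F X Y f (f \<cdot>\<^bsub>D\<^esub> t) (D.lw f \<eta>)"
    "Map2 F X Y (s \<cdot>\<^bsub>D\<^esub> s \<cdot>\<^bsub>D\<^esub> f) (f \<cdot>\<^bsub>D\<^esub> t) (\<phi> \<odot>\<^bsub>D\<^esub> D.rw \<mu>' f) =
      Map2 F X Y (s \<cdot>\<^bsub>D\<^esub> s \<cdot>\<^bsub>D\<^esub> f) (f \<cdot>\<^bsub>D\<^esub> t) (D.lw f \<mu> \<odot>\<^bsub>D\<^esub> D.rw \<phi> t \<odot>\<^bsub>D\<^esub> D.lw s \<phi>)"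
    by (simp_all add: eqs)
  then show ?thesis
    using F_cell1[OF f] F_cell2[OF p] Map0_Obj0[OF o(1)] Map0_Obj0[OF o(2)]
    by (simp add: Mnd_map_def E.monad_cells1_iff F_VComp[OF ty(1) p] F_VComp[OF ty(2) p]
      F_VComp[OF D.cell2_VComp[OF ty(3,4)] ty(5)] F_VComp[OF ty(3,4)]
      F_rw[OF e' f] F_lw[OF e f] F_rw[OF m' f] F_lw[OF p s] F_rw[OF p t] F_lw[OF m f] assoc
      F_Comp1[OF f s] F_Comp1[OF t f])
qed

lemma Mnd_map_cell2:
  assumes T: "(X, t, \<eta>, \<mu>) \<in> monads D" and S: "(Y, s, \<eta>', \<mu>') \<in> monads D"
    and a: "\<gamma> \<in> monad_cells2 D (X, t, \<eta>, \<mu>) (Y, s, \<eta>', \<mu>') (f, \<phi>) (g, \<psi>)"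
  shows "Map2 F X Y f g \<gamma> \<in> monad_cells2 E
    (Map0 (Mnd_map D F) (X, t, \<eta>, \<mu>)) (Map0 (Mnd_map D F) (Y, s, \<eta>', \<mu>'))
    (Map1 (Mnd_map D F) (X, t, \<eta>, \<mu>) (Y, s, \<eta>', \<mu>') (f, \<phi>))
    (Map1 (Mnd_map D F) (X, t, \<eta>, \<mu>) (Y, s, \<eta>', \<mu>') (g, \<psi>))"
proof -
  have o: "X \<in> Obj0 D" "Y \<in> Obj0 D" and t: "D.cell1 X X t" and s: "D.cell1 Y Y s"
    using T S by (auto simp: D.monads_iff)
  have fg: "(f, \<phi>) \<in> monad_cells1 D (X, t, \<eta>, \<mu>) (Y, s, \<eta>', \<mu>')"
    "(g, \<psi>) \<in> monad_cells1 D (X, t, \<eta>, \<mu>) (Y, s, \<eta>', \<mu>')"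
    and c: "D.cell2 X Y f g \<gamma>" and eq: "D.rw \<gamma> t \<odot>\<^bsub>D\<^esub> \<phi> = \<psi> \<odot>\<^bsub>D\<^esub> D.lw s \<gamma>"
    using a o by (simp_all add: D.monad_cells2_iff)
  then have p: "D.cell2 X Y (s \<cdot>\<^bsub>D\<^esub> f) (f \<cdot>\<^bsub>D\<^esub> t) \<phi>" and q: "D.cell2 X Y (s \<cdot>\<^bsub>D\<^esub> g) (g \<cdot>\<^bsub>D\<^esub> t) \<psi>"
    using o by (simp_all add: D.monad_cells1_iff)
  have "Map2 F X Y (s \<cdot>\<^bsub>D\<^esub> f) (g \<cdot>\<^bsub>D\<^esub> t) (D.rw \<gamma> t \<odot>\<^bsub>D\<^esub> \<phi>) =
    Map2 F X Y (s \<cdot>\<^bsub>D\<^esub> f) (g \<cdot>\<^bsub>D\<^esub> t) (\<psi> \<odot>\<^bsub>D\<^esub> D.lw s \<gamma>)"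
    by (simp add: eq)
  then show ?thesis
    using Mnd_map_cell1[OF T S fg(1)] Mnd_map_cell1[OF T S fg(2)] F_cell2[OF c] Map0_Obj0[OF o(1)]
      Map0_Obj0[OF o(2)]
    by (simp add: Mnd_map_def E.monad_cells2_iff F_VComp[OF p D.cell2_rw[OF c t]]
      F_VComp[OF D.cell2_lw[OF c s] q]
      F_rw[OF c t] F_lw[OF c s])
qed

lemma Mnd_map_Comp1:
  assumes T: "(X, t, \<eta>, \<mu>) \<in> monads D" and S: "(Y, s, \<eta>', \<mu>') \<in> monads D"
    and R: "(Z, r, \<eta>'', \<mu>'') \<in> monads D"
    and fc: "(f, \<phi>) \<in> monad_cells1 D (X, t, \<eta>, \<mu>) (Y, s, \<eta>', \<mu>')"
    and gc: "(g, \<psi>) \<in> monad_cells1 D (Y, s, \<eta>', \<mu>') (Z, r, \<eta>'', \<mu>'')"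
  shows "Map2 F X Z (r \<cdot>\<^bsub>D\<^esub> g \<cdot>\<^bsub>D\<^esub> f) ((g \<cdot>\<^bsub>D\<^esub> f) \<cdot>\<^bsub>D\<^esub> t) (D.lw g \<phi> \<odot>\<^bsub>D\<^esub> D.rw \<psi> f) =
    E.lw (Map1 F Y Z g) (Map2 F X Y (s \<cdot>\<^bsub>D\<^esub> f) (f \<cdot>\<^bsub>D\<^esub> t) \<phi>) \<odot>\<^bsub>E\<^esub>
    E.rw (Map2 F Y Z (r \<cdot>\<^bsub>D\<^esub> g) (g \<cdot>\<^bsub>D\<^esub> s) \<psi>) (Map1 F X Y f)"
proof -
  have o: "X \<in> Obj0 D" "Y \<in> Obj0 D" "Z \<in> Obj0 D" and t: "D.cell1 X X t" and s: "D.cell1 Y Y s"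
    and r: "D.cell1 Z Z r"
    using T S R by (auto simp: D.monads_iff)
  then have f: "D.cell1 X Y f" and p: "D.cell2 X Y (s \<cdot>\<^bsub>D\<^esub> f) (f \<cdot>\<^bsub>D\<^esub> t) \<phi>"
    and g: "D.cell1 Y Z g" and q: "D.cell2 Y Z (r \<cdot>\<^bsub>D\<^esub> g) (g \<cdot>\<^bsub>D\<^esub> s) \<psi>"
    using fc gc by (simp_all add: D.monad_cells1_iff)
  note assoc = D.cell1_assoc[OF f g r] D.cell1_assoc[OF f s g] D.cell1_assoc[OF t f g]
  have "D.cell2 X Z (r \<cdot>\<^bsub>D\<^esub> g \<cdot>\<^bsub>D\<^esub> f) (g \<cdot>\<^bsub>D\<^esub> s \<cdot>\<^bsub>D\<^esub> f) (D.rw \<psi> f)"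
    "D.cell2 X Z (g \<cdot>\<^bsub>D\<^esub> s \<cdot>\<^bsub>D\<^esub> f) (g \<cdot>\<^bsub>D\<^esub> f \<cdot>\<^bsub>D\<^esub> t) (D.lw g \<phi>)"
    using D.cell2_rw[OF q f] D.cell2_lw[OF p g] by (simp_all add: assoc)
  then show ?thesis
    by (simp add: assoc F_VComp F_rw[OF q f] F_lw[OF p g])
qed

theorem Mnd_map_strict_two_functor: "strict_two_functor (Mnd D) (Mnd E) (Mnd_map D F)"
proof -
  interpret MD: strict_two_category "Mnd D" by (rule D.Mnd_strict_two_category)
  interpret ME: strict_two_category "Mnd E" by (rule E.Mnd_strict_two_category)
  note Ms = D.Mnd_simps E.Mnd_simps
  show ?thesis
  proof (unfold_locales, goal_cases)
    case (1 T)
    then show ?case by (cases T) (simp add: Ms Mnd_map_monad)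
  next
    case (2 T S f)
    then show ?case by (cases T; cases S; cases f) (simp add: Ms Mnd_map_cell1)
  next
    case (3 T S \<alpha> f g)
    obtain X t e m Y s e' m' f' p g' q where
      "T = (X, t, e, m)" "S = (Y, s, e', m')" "f = (f', p)" "g = (g', q)"
      by (metis surj_pair)
    then show ?case
      using 3 Mnd_map_cell2[of X t e m Y s e' m' \<alpha> f' p g' q]
        by (simp add: Ms) (simp add: Mnd_map_def)
  next
    case (4 T)
    obtain X t e m where "T = (X, t, e, m)" by (metis surj_pair)
    then show ?case
      using 4 D.cell1_Id[of X X t] by (simp add: Ms Mnd_map_def D.monads_iff Map1_Id1 F_Id2)
  next
    case (5 T S R f g)
    then show ?case
      by (cases T; cases S; cases R; cases f; cases g)
        (use Mnd_map_Comp1 in \<open>auto simp: Ms Mnd_map_def D.monads_iff D.monad_cells1_iff F_Comp1\<close>)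
  next
    case (6 T S f)
    then show ?case
      by (cases T; cases S; cases f)
        (auto simp: Ms Mnd_map_def D.monads_iff D.monad_cells1_iff F_Id2)
  next
    case (7 T S \<alpha> f g \<beta> h)
    then show ?case
      by (cases T; cases S; cases f; cases g; cases h)
        (auto simp: Ms Mnd_map_def D.monads_iff D.monad_cells2_iff F_VComp)
  next
    case (8 T S R \<alpha> f f' \<beta> g g')
    then show ?case
      by (cases T; cases S; cases R; cases f; cases f'; cases g; cases g')
        (auto simp: Ms Mnd_map_def monads_def monad_cells2_def Map2_HComp)
  qed
qed

end

text \<open>A section \<open>S\<close> of the forgetful 2-functor chooses a monad on every 0-cell and lets every
  1-cell distribute over the chosen monads. In particular every monad distributes over the chosen
  monad on its 0-cell: the values of \<open>Mnd S\<close> are distributive laws whose first monad is the chosen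
  one and whose second monad is the given one.\<close>

lemma section_PDist:
  fixes B :: "('o, 'm, 'c) two_category"
  assumes S: "strict_two_functor B (Mnd B) S"
    and sec: "two_functor_eq B (two_functor_comp forget S) two_functor_id"
  shows "Mnd_map B S \<in> PDist (Mnd B) B"
    and "strict_two_functor (Mnd B) (Mnd B) (two_functor_comp U1 (Mnd_map B S))"
    and "Map0 (two_functor_comp U1 (Mnd_map B S)) (X, t, \<eta>, \<mu>) = Map0 S X"
    and "two_functor_eq (Mnd B) (two_functor_comp U2 (Mnd_map B S)) two_functor_id"
proof -
  interpret S: strict_two_functor B "Mnd B" S by fact
  show 1: "Mnd_map B S \<in> PDist (Mnd B) B"
    using S.Mnd_map_strict_two_functor by (simp add: PDist_def)
  show "strict_two_functor (Mnd B) (Mnd B) (two_functor_comp U1 (Mnd_map B S))"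
    unfolding U1_eq_forget
    by (rule strict_two_functor_comp[OF S.Mnd_map_strict_two_functor
        forget_strict_two_functor[OF S.E.strict_two_category_axioms]])
  show "Map0 (two_functor_comp U1 (Mnd_map B S)) (X, t, \<eta>, \<mu>) = Map0 S X"
    by (simp add: two_functor_comp_def Mnd_map_def U1_eq_forget forget_def)
  have s0: "fst (Map0 S X) = X" if "X \<in> Obj0 B" for X
    using sec that
      by (simp add: two_functor_eq_def two_functor_comp_def two_functor_id_def forget_def)
  have s1: "fst (Map1 S X Y f) = f" if "X \<in> Obj0 B" "Y \<in> Obj0 B" "f \<in> Cell1 B X Y" for X Y f
    using sec that
      by (simp add: two_functor_eq_def two_functor_comp_def two_functor_id_def forget_def)
  have s2: "Map2 S X Y f g \<alpha> = \<alpha>" if "X \<in> Obj0 B" "Y \<in> Obj0 B" "\<alpha> \<in> Cell2 B X Y f g" for X Y f g \<alpha>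
    using sec that S.D.Cell2_ends[OF that]
    by (simp add: two_functor_eq_def two_functor_comp_def two_functor_id_def forget_def)
  show "two_functor_eq (Mnd B) (two_functor_comp U2 (Mnd_map B S)) two_functor_id"
    unfolding two_functor_eq_def
  proof (intro conjI ballI, goal_cases)
    case (1 T)
    obtain X t e m where T: "T = (X, t, e, m)" by (metis surj_pair)
    obtain X' r where X': "Map0 S X = (X', r)" by (metis surj_pair)
    obtain t' q where t': "Map1 S X X t = (t', q)" by (metis surj_pair)
    show ?case
      using 1 T X' t' s0[of X] s1[of X X t]
      by (cases r) (auto simp: Mnd_def monads_def two_functor_comp_def two_functor_id_def U2_def
        Mnd_map_def s2)
  next
    case (2 T R f)
    obtain X t e m where T: "T = (X, t, e, m)" by (metis surj_pair)
    obtain Y t' e' m' where R: "R = (Y, t', e', m')" by (metis surj_pair)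
    obtain g p where f: "f = (g, p)" by (metis surj_pair)
    obtain g' q where g': "Map1 S X Y g = (g', q)" by (metis surj_pair)
    show ?case
      using 2 T R f g' s1[of X Y g]
      by (auto simp: Mnd_def monads_def monad_cells1_def two_functor_comp_def two_functor_id_def
        U2_def Mnd_map_def s2)
  next
    case (3 T R f g \<alpha>)
    then show ?case
      by (cases T; cases R; cases f; cases g) (auto simp:
        Mnd_def monads_def monad_cells2_def two_functor_comp_def two_functor_id_def U2_def
          Mnd_map_def s2)
  qed
qed

section \<open>Generalised elements in a cartesian closed category\<close>

text \<open>A generalised element of an object at a stage is an arrow into it from the stage. The
  rewrite rules of this section push every composition with an arrow on the right into tuples and
  applications and find the ends of arrows, so that rewriting settles most equations between
  generalised elements.\<close>

context category
begin

lemma hom_iff: "f \<in> hom C A B \<longleftrightarrow> f \<in> Arr C \<and> Dom C f = A \<and> Cod C f = B"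
  by (simp add: hom_def)

lemma Cmp_typ [simp]:
  assumes "f \<in> Arr C" "g \<in> Arr C" "Dom C g = Cod C f"
  shows "g \<bullet> f \<in> Arr C" "Dom C (g \<bullet> f) = Dom C f" "Cod C (g \<bullet> f) = Cod C g"
  using Cmp_hom[of f "Dom C f" "Cod C f" g "Cod C g"] assms by (auto simp: hom_def)

lemma Idn_typ [simp]:
  assumes "A \<in> Obj C"
  shows "Idn C A \<in> Arr C" "Dom C (Idn C A) = A" "Cod C (Idn C A) = A"
  using Idn_hom[OF assms] by (auto simp: hom_def)

lemma Cmp_assoc' [simp]:
  "\<lbrakk>f \<in> Arr C; g \<in> Arr C; h \<in> Arr C; Dom C g = Cod C f; Dom C h = Cod C g\<rbrakk> \<Longrightarrow>
    (h \<bullet> g) \<bullet> f = h \<bullet> (g \<bullet> f)"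
  using Cmp_assoc[of f "Dom C f" "Cod C f" g "Cod C g" h "Cod C h"] by (auto simp: hom_def)

lemma Idn_left [simp]: "\<lbrakk>f \<in> Arr C; Cod C f = A\<rbrakk> \<Longrightarrow> Idn C A \<bullet> f = f"
  using Cmp_Idn_left[of f "Dom C f"] by (auto simp: hom_def)

lemma Idn_right [simp]: "\<lbrakk>f \<in> Arr C; Dom C f = A\<rbrakk> \<Longrightarrow> f \<bullet> Idn C A = f"
  using Cmp_Idn_right[of f A "Cod C f"] by (auto simp: hom_def)

declare Dom_Obj [simp] Cod_Obj [simp]

end

context cartesian_closed_category
begin

declare One_Obj [simp] Prod_Obj [simp] Exp_Obj [simp]

lemma bang_typ [simp]:
  assumes "A \<in> Obj C"
  shows "bang C A \<in> Arr C" "Dom C (bang C A) = A" "Cod C (bang C A) = One C"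
  using theI'[OF One_univ[OF assms]] by (auto simp: bang_def hom_def)

lemma into_One_eq: "\<lbrakk>f \<in> Arr C; Cod C f = One C\<rbrakk> \<Longrightarrow> f = bang C (Dom C f)"
  using One_univ[of "Dom C f"] bang_typ[of "Dom C f"] by (auto simp: hom_def)

lemma bang_Cmp [simp]: "\<lbrakk>h \<in> Arr C; Cod C h = A\<rbrakk> \<Longrightarrow> bang C A \<bullet> h = bang C (Dom C h)"
  by (rule trans[OF into_One_eq]) auto

lemma bang_One [simp]: "bang C (One C) = Idn C (One C)"
  by (metis Idn_typ One_Obj into_One_eq)

lemma Prj_typ [simp]:
  assumes "A \<in> Obj C" "B \<in> Obj C"
  shows "Prj1 C A B \<in> Arr C" "Dom C (Prj1 C A B) = Prod C A B" "Cod C (Prj1 C A B) = A"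
    "Prj2 C A B \<in> Arr C" "Dom C (Prj2 C A B) = Prod C A B" "Cod C (Prj2 C A B) = B"
  using Prj1_hom[OF assms] Prj2_hom[OF assms] by (auto simp: hom_def)

lemma Ev_typ [simp]:
  assumes "A \<in> Obj C" "B \<in> Obj C"
  shows "Ev C A B \<in> Arr C" "Dom C (Ev C A B) = Prod C (Exp C A B) A" "Cod C (Ev C A B) = B"
  using Ev_hom[OF assms] by (auto simp: hom_def)

lemma tup_props:
  assumes "f \<in> Arr C" "g \<in> Arr C" "Dom C f = Dom C g"
  shows "tup C f g \<in> hom C (Dom C f) (Prod C (Cod C f) (Cod C g)) \<and>
    Prj1 C (Cod C f) (Cod C g) \<bullet> tup C f g = f \<and> Prj2 C (Cod C f) (Cod C g) \<bullet> tup C f g = g"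
  unfolding tup_def
  by (rule theI', rule Prod_univ) (use assms in \<open>auto simp: hom_def\<close>)

lemma tup_typ [simp]:
  assumes "f \<in> Arr C" "g \<in> Arr C" "Dom C f = Dom C g"
  shows "tup C f g \<in> Arr C" "Dom C (tup C f g) = Dom C g"
    "Cod C (tup C f g) = Prod C (Cod C f) (Cod C g)"
  using tup_props[OF assms] assms(3) by (auto simp: hom_def)

lemma Prj_tup [simp]:
  assumes "f \<in> Arr C" "g \<in> Arr C" "Dom C f = Dom C g" "Cod C f = A" "Cod C g = B"
  shows "Prj1 C A B \<bullet> tup C f g = f" "Prj2 C A B \<bullet> tup C f g = g"
  using tup_props[OF assms(1-3)] assms(4-) by auto

lemma tup_eqI:
  assumes "h \<in> Arr C" "Cod C h = Prod C A B" "A \<in> Obj C" "B \<in> Obj C"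
    "Prj1 C A B \<bullet> h = f" "Prj2 C A B \<bullet> h = g"
  shows "tup C f g = h"
proof -
  have fg: "f \<in> hom C (Dom C h) A" "g \<in> hom C (Dom C h) B"
    using assms by (auto simp: hom_def)
  then have "tup C f g \<in> hom C (Dom C h) (Prod C A B) \<and>
      Prj1 C A B \<bullet> tup C f g = f \<and> Prj2 C A B \<bullet> tup C f g = g"
    using tup_props[of f g] by (simp add: hom_def)
  moreover have "h \<in> hom C (Dom C h) (Prod C A B)"
    using assms(1,2) by (simp add: hom_def)
  ultimately show ?thesis
    using ex1E[OF Prod_univ[OF fg]] assms(5,6) by metis
qed

lemma tup_eta [simp]:
  "\<lbrakk>h \<in> Arr C; Cod C h = Prod C A B; A \<in> Obj C; B \<in> Obj C\<rbrakk> \<Longrightarrow>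
    tup C (Prj1 C A B \<bullet> h) (Prj2 C A B \<bullet> h) = h"
  by (rule tup_eqI) auto

lemma tup_Prj [simp]:
  "\<lbrakk>A \<in> Obj C; B \<in> Obj C\<rbrakk> \<Longrightarrow> tup C (Prj1 C A B) (Prj2 C A B) = Idn C (Prod C A B)"
  by (rule tup_eqI[of _ A B]) auto

lemma tup_Cmp [simp]:
  assumes "f \<in> Arr C" "g \<in> Arr C" "Dom C f = Dom C g" "h \<in> Arr C" "Cod C h = Dom C g"
  shows "tup C f g \<bullet> h = tup C (f \<bullet> h) (g \<bullet> h)"
proof -
  have "Prj1 C (Cod C f) (Cod C g) \<bullet> tup C f g \<bullet> h = f \<bullet> h"
    "Prj2 C (Cod C f) (Cod C g) \<bullet> tup C f g \<bullet> h = g \<bullet> h"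
    using assms by (simp_all flip: Cmp_assoc')
  then show ?thesis
    using assms by (intro tup_eqI[symmetric]) auto
qed

lemma pmap_typ [simp]:
  assumes "f \<in> Arr C" "g \<in> Arr C"
  shows "pmap C f g \<in> Arr C" "Dom C (pmap C f g) = Prod C (Dom C f) (Dom C g)"
    "Cod C (pmap C f g) = Prod C (Cod C f) (Cod C g)"
  using assms by (auto simp: pmap_def)

lemma pmap_Cmp [simp]:
  "\<lbrakk>f \<in> Arr C; g \<in> Arr C; h \<in> Arr C; Cod C h = Prod C (Dom C f) (Dom C g)\<rbrakk> \<Longrightarrow>
    pmap C f g \<bullet> h =
      tup C (f \<bullet> Prj1 C (Dom C f) (Dom C g) \<bullet> h) (g \<bullet> Prj2 C (Dom C f) (Dom C g) \<bullet> h)"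
  by (simp add: pmap_def)

lemma passoc_typ [simp]:
  assumes "X \<in> Obj C" "Y \<in> Obj C" "Z \<in> Obj C"
  shows "passoc C X Y Z \<in> Arr C" "Dom C (passoc C X Y Z) = Prod C X (Prod C Y Z)"
    "Cod C (passoc C X Y Z) = Prod C (Prod C X Y) Z"
  using assms by (auto simp: passoc_def)

lemma passoc_Cmp [simp]:
  "\<lbrakk>X \<in> Obj C; Y \<in> Obj C; Z \<in> Obj C; h \<in> Arr C; Cod C h = Prod C X (Prod C Y Z)\<rbrakk> \<Longrightarrow>
    passoc C X Y Z \<bullet> h = 
     tup C (tup C (Prj1 C X (Prod C Y Z) \<bullet> h) (Prj1 C Y Z \<bullet> Prj2 C X (Prod C Y Z) \<bullet> h))
           (Prj2 C Y Z \<bullet> Prj2 C X (Prod C Y Z) \<bullet> h)"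
  by (simp add: passoc_def)

text \<open>The value in \<open>B\<close> of a generalised element \<open>f\<close> of \<open>[A, B]\<close> at a generalised element \<open>a\<close> of
  \<open>A\<close>, both at the same stage. The objects are arguments because \<open>Exp C A B\<close> need not determine
  \<open>A\<close> and \<open>B\<close>.\<close>

definition app :: "'o \<Rightarrow> 'o \<Rightarrow> 'a \<Rightarrow> 'a \<Rightarrow> 'a" where
  "app A B f a = Ev C A B \<bullet> tup C f a"

lemma app_typ [simp]:
  assumes "A \<in> Obj C" "B \<in> Obj C" "f \<in> Arr C" "a \<in> Arr C" "Dom C f = Dom C a"
    "Cod C f = Exp C A B" "Cod C a = A"
  shows "app A B f a \<in> Arr C" "Dom C (app A B f a) = Dom C a" "Cod C (app A B f a) = B"
  using assms by (auto simp: app_def)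

lemma app_Cmp [simp]:
  "\<lbrakk>A \<in> Obj C; B \<in> Obj C; f \<in> Arr C; a \<in> Arr C; Dom C f = Dom C a;
    Cod C f = Exp C A B; Cod C a = A; h \<in> Arr C; Cod C h = Dom C a\<rbrakk> \<Longrightarrow>
    app A B f a \<bullet> h = app A B (f \<bullet> h) (a \<bullet> h)"
  by (simp add: app_def)

lemma cur_props:
  assumes "X \<in> Obj C" "A \<in> Obj C" "f \<in> Arr C" "Dom C f = Prod C X A"
  shows "cur C X A f \<in> hom C X (Exp C A (Cod C f)) \<and>
    Ev C A (Cod C f) \<bullet> pmap C (cur C X A f) (Idn C A) = f"
  unfolding cur_def
  by (rule theI', rule Exp_univ) (use assms in \<open>auto simp: hom_def\<close>)

lemma cur_typ [simp]:
  assumes "X \<in> Obj C" "A \<in> Obj C" "f \<in> Arr C" "Dom C f = Prod C X A"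
  shows "cur C X A f \<in> Arr C" "Dom C (cur C X A f) = X" "Cod C (cur C X A f) = Exp C A (Cod C f)"
  using cur_props[OF assms] by (auto simp: hom_def)

lemma app_cur_Cmp [simp]:
  assumes "X \<in> Obj C" "A \<in> Obj C" "f \<in> Arr C" "Dom C f = Prod C X A" "Cod C f = B"
    and "h \<in> Arr C" "a \<in> Arr C" "Dom C h = Dom C a" "Cod C h = X" "Cod C a = A"
  shows "app A B (cur C X A f \<bullet> h) a = f \<bullet> tup C h a"
proof -
  have B: "B \<in> Obj C" using assms by auto
  have "f \<bullet> tup C h a = (Ev C A B \<bullet> pmap C (cur C X A f) (Idn C A)) \<bullet> tup C h a"
    using cur_props[OF assms(1-4)] assms(5) by simp
  also have "\<dots> = app A B (cur C X A f \<bullet> h) a"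
    using assms B by (simp add: app_def)
  finally show ?thesis by simp
qed

text \<open>An arrow into \<open>[A, B]\<close> is determined by its transpose, which is its value at the generic
  element: the second projection at the stage \<open>X \<times> A\<close>.\<close>

lemma Exp_ext:
  assumes "f \<in> Arr C" "g \<in> Arr C" "Dom C f = X" "Dom C g = X"
    and "Cod C f = Exp C A B" "Cod C g = Exp C A B" "A \<in> Obj C" "B \<in> Obj C"
    and eq: "\<And>Y h a. \<lbrakk>Y \<in> Obj C; h \<in> Arr C; a \<in> Arr C; Dom C h = Y; Dom C a = Y; Cod C h =
      X; Cod C a = A\<rbrakk>
      \<Longrightarrow> app A B (f \<bullet> h) a = app A B (g \<bullet> h) a"
  shows "f = g"
proof -
  have X: "X \<in> Obj C" using assms by auto
  have "Ev C A B \<bullet> pmap C f (Idn C A) = Ev C A B \<bullet> pmap C g (Idn C A)"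
    using eq[of "Prod C X A" "Prj1 C X A" "Prj2 C X A"] assms X
    by (simp add: app_def pmap_def)
  moreover have "Ev C A B \<bullet> pmap C g (Idn C A) \<in> hom C (Prod C X A) B"
    using assms X by (simp add: hom_def)
  ultimately show ?thesis
    using ex1E[OF Exp_univ[of X A _ B]] X assms by (metis hom_iff)
qed

lemma name_of_typ [simp]:
  assumes "f \<in> Arr C"
  shows "name_of C f \<in> Arr C" "Dom C (name_of C f) = One C"
    "Cod C (name_of C f) = Exp C (Dom C f) (Cod C f)"
  using assms by (auto simp: name_of_def)

lemma app_name_of [simp]:
  assumes "f \<in> Arr C" "Dom C f = A" "Cod C f = B"
    and "h \<in> Arr C" "a \<in> Arr C" "Dom C h = Dom C a" "Cod C h = One C" "Cod C a = A"
  shows "app A B (name_of C f \<bullet> h) a = f \<bullet> a"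
  using assms by (auto simp: name_of_def)

end

section \<open>Enriched endofunctors and their natural transformations\<close>

text \<open>Composition of generalised elements of hom-objects at a common stage. For a fixed stage
  these elements form an ordinary category, and by the Yoneda lemma the associativity and unit
  diagrams of an enriched category amount to the category laws at all stages; the following locale
  uses them in this form.\<close>

definition ecomp ::
  "('o, 'a, 'z) ccc_scheme \<Rightarrow> ('x, 'o, 'a) enriched \<Rightarrow> 'x \<Rightarrow> 'x \<Rightarrow> 'x \<Rightarrow> 'a \<Rightarrow> 'a \<Rightarrow> 'a" where
  "ecomp V A X Y Z g f = ECmp A X Y Z \<bullet>\<^bsub>V\<^esub> tup V g f"

locale enriched_category = cartesian_closed_category V
  for V :: "('o, 'a, 'z) ccc_scheme" (structure) +
  fixes A :: "('x, 'o, 'a) enriched"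
  assumes EHom_Obj [simp]: "\<lbrakk>X \<in> EObj A; Y \<in> EObj A\<rbrakk> \<Longrightarrow> EHom A X Y \<in> Obj V"
    and EIdn_hom: "X \<in> EObj A \<Longrightarrow> EIdn A X \<in> hom V (One V) (EHom A X X)"
    and ECmp_hom: "\<lbrakk>X \<in> EObj A; Y \<in> EObj A; Z \<in> EObj A\<rbrakk> \<Longrightarrow>
      ECmp A X Y Z \<in> hom V (Prod V (EHom A Y Z) (EHom A X Y)) (EHom A X Z)"
    and ecomp_assoc:
      "\<lbrakk>W \<in> EObj A; X \<in> EObj A; Y \<in> EObj A; Z \<in> EObj A; P \<in> Obj V;
        f \<in> hom V P (EHom A W X); g \<in> hom V P (EHom A X Y); h \<in> hom V P (EHom A Y Z)\<rbrakk> \<Longrightarrow>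
       ecomp V A W X Z (ecomp V A X Y Z h g) f = ecomp V A W Y Z h (ecomp V A W X Y g f)"
    and ecomp_EIdn_left:
      "\<lbrakk>X \<in> EObj A; Y \<in> EObj A; P \<in> Obj V; f \<in> hom V P (EHom A X Y)\<rbrakk> \<Longrightarrow>
       ecomp V A X Y Y (EIdn A Y \<bullet> bang V P) f = f"
    and ecomp_EIdn_right:
      "\<lbrakk>X \<in> EObj A; Y \<in> EObj A; P \<in> Obj V; f \<in> hom V P (EHom A X Y)\<rbrakk> \<Longrightarrow>
       ecomp V A X X Y f (EIdn A X \<bullet> bang V P) = f"

context cartesian_closed_category
begin

abbreviation scomp :: "'o \<Rightarrow> 'o \<Rightarrow> 'o \<Rightarrow> 'a \<Rightarrow> 'a \<Rightarrow> 'a" where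
  "scomp \<equiv> ecomp C (self_enriched C)"

lemma self_enriched_simps [simp]:
  "EObj (self_enriched C) = Obj C" "EHom (self_enriched C) = Exp C"
  by (simp_all add: self_enriched_def)

lemma app_EIdn [simp]:
  "\<lbrakk>h \<in> Arr C; a \<in> Arr C; Dom C h = Dom C a; Cod C h = One C; Cod C a = A; A \<in> Obj C\<rbrakk> \<Longrightarrow>
    app A A (EIdn (self_enriched C) A \<bullet> h) a = a"
  by (simp add: self_enriched_def)

lemma EIdn_typ' [simp]:
  assumes "A \<in> Obj C"
  shows "EIdn (self_enriched C) A \<in> Arr C" "Dom C (EIdn (self_enriched C) A) = One C"
    "Cod C (EIdn (self_enriched C) A) = Exp C A A"
  using assms by (auto simp: self_enriched_def)

lemma ECmp_typ' [simp]:
  assumes "A \<in> Obj C" "B \<in> Obj C" "D \<in> Obj C"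
  shows "ECmp (self_enriched C) A B D \<in> Arr C"
    "Dom C (ECmp (self_enriched C) A B D) = Prod C (Exp C B D) (Exp C A B)"
    "Cod C (ECmp (self_enriched C) A B D) = Exp C A D"
  using assms by (auto simp: self_enriched_def Let_def simp flip: app_def)

lemma app_scomp [simp]:
  assumes "A \<in> Obj C" "B \<in> Obj C" "D \<in> Obj C"
    "g \<in> Arr C" "f \<in> Arr C" "a \<in> Arr C" "Dom C g = Dom C a" "Dom C f = Dom C a"
    "Cod C g = Exp C B D" "Cod C f = Exp C A B" "Cod C a = A"
  shows "app A D (scomp A B D g f) a = app B D g (app A B f a)"
  using assms by (simp add: ecomp_def self_enriched_def Let_def flip: app_def)

lemma scomp_typ [simp]:
  assumes "A \<in> Obj C" "B \<in> Obj C" "D \<in> Obj C"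
    "g \<in> Arr C" "f \<in> Arr C" "Dom C g = Dom C f" "Cod C g = Exp C B D" "Cod C f = Exp C A B"
  shows "scomp A B D g f \<in> Arr C" "Dom C (scomp A B D g f) = Dom C f"
    "Cod C (scomp A B D g f) = Exp C A D"
  using assms by (auto simp: ecomp_def)

lemma scomp_Cmp [simp]:
  assumes "A \<in> Obj C" "B \<in> Obj C" "D \<in> Obj C"
    "g \<in> Arr C" "f \<in> Arr C" "Dom C g = Dom C f" "Cod C g = Exp C B D" "Cod C f = Exp C A B"
    "h \<in> Arr C" "Cod C h = Dom C f"
  shows "scomp A B D g f \<bullet> h = scomp A B D (g \<bullet> h) (f \<bullet> h)"
  using assms by (auto simp: ecomp_def)

text \<open>On elements, composition in the self-enrichment is composition of maps, so that the laws
  hold by extensionality.\<close>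

lemma self_enriched_category: "enriched_category C (self_enriched C)"
proof (unfold_locales, goal_cases)
  case (4 W X Y Z P f g h)
  then show ?case
    by - (rule Exp_ext[of _ _ P W Z], auto simp: hom_iff)
next
  case (5 X Y P f)
  then show ?case
    by - (rule Exp_ext[of _ _ P X Y], auto simp: hom_iff)
next
  case (6 X Y P f)
  then show ?case
    by - (rule Exp_ext[of _ _ P X Y], auto simp: hom_iff)
qed (auto simp: hom_iff)

end

context enriched_category
begin

abbreviation ec :: "'x \<Rightarrow> 'x \<Rightarrow> 'x \<Rightarrow> 'a \<Rightarrow> 'a \<Rightarrow> 'a" where
  "ec \<equiv> ecomp V A"

abbreviation Endo :: "('x, 'x, 'a) efunctor set" where
  "Endo \<equiv> efunctors V A A"

lemma EIdn_typ [simp]: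
  assumes "X \<in> EObj A"
  shows "EIdn A X \<in> Arr V" "Dom V (EIdn A X) = One V" "Cod V (EIdn A X) = EHom A X X"
  using EIdn_hom[OF assms] by (auto simp: hom_iff)

lemma ECmp_typ [simp]:
  assumes "X \<in> EObj A" "Y \<in> EObj A" "Z \<in> EObj A"
  shows "ECmp A X Y Z \<in> Arr V" "Dom V (ECmp A X Y Z) = Prod V (EHom A Y Z) (EHom A X Y)"
    "Cod V (ECmp A X Y Z) = EHom A X Z"
  using ECmp_hom[OF assms] by (auto simp: hom_iff)

lemma ecomp_typ [simp]:
  assumes "X \<in> EObj A" "Y \<in> EObj A" "Z \<in> EObj A" "g \<in> Arr V" "f \<in> Arr V"
    "Dom V g = Dom V f" "Cod V g = EHom A Y Z" "Cod V f = EHom A X Y"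
  shows "ec X Y Z g f \<in> Arr V" "Dom V (ec X Y Z g f) = Dom V f" "Cod V (ec X Y Z g f) = EHom A X Z"
  using assms by (auto simp: ecomp_def)

lemma ecomp_Cmp [simp]:
  assumes "X \<in> EObj A" "Y \<in> EObj A" "Z \<in> EObj A" "g \<in> Arr V" "f \<in> Arr V"
    "Dom V g = Dom V f" "Cod V g = EHom A Y Z" "Cod V f = EHom A X Y"
    "h \<in> Arr V" "Cod V h = Dom V f"
  shows "ec X Y Z g f \<bullet> h = ec X Y Z (g \<bullet> h) (f \<bullet> h)"
  using assms by (auto simp: ecomp_def)

lemma ecomp_assoc' [simp]:
  assumes "W \<in> EObj A" "X \<in> EObj A" "Y \<in> EObj A" "Z \<in> EObj A" "f \<in> Arr V" "g \<in> Arr V" "h \<in> Arr V"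
    "Dom V g = Dom V f" "Dom V h = Dom V f"
    "Cod V f = EHom A W X" "Cod V g = EHom A X Y" "Cod V h = EHom A Y Z"
  shows "ec W X Z (ec X Y Z h g) f = ec W Y Z h (ec W X Y g f)"
  using assms by (intro ecomp_assoc[of W X Y Z "Dom V f"]) (auto simp: hom_iff)

lemma ecomp_EIdn [simp]:
  assumes "X \<in> EObj A" "Y \<in> EObj A" "f \<in> Arr V" "Dom V f = P" "Cod V f = EHom A X Y"
  shows "ec X Y Y (EIdn A Y \<bullet> bang V P) f = f" "ec X X Y f (EIdn A X \<bullet> bang V P) = f"
  using ecomp_EIdn_left[of X Y P f] ecomp_EIdn_right[of X Y P f] assms by (auto simp: hom_iff)

lemma ecomp_EIdn_One [simp]:
  assumes "X \<in> EObj A" "Y \<in> EObj A" "f \<in> Arr V" "Dom V f = One V" "Cod V f = EHom A X Y"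
  shows "ec X Y Y (EIdn A Y) f = f" "ec X X Y f (EIdn A X) = f"
  using ecomp_EIdn[OF assms(1-3) refl assms(5)] assms by simp_all

lemma ecomp_Prj:
  "\<lbrakk>X \<in> EObj A; Y \<in> EObj A; Z \<in> EObj A\<rbrakk> \<Longrightarrow>
    ec X Y Z (Prj1 V (EHom A Y Z) (EHom A X Y)) (Prj2 V (EHom A Y Z) (EHom A X Y)) = ECmp A X Y Z"
  by (simp add: ecomp_def)

lemma efun_obj [simp]: "\<lbrakk>F \<in> Endo; X \<in> EObj A\<rbrakk> \<Longrightarrow> fst F X \<in> EObj A"
  by (auto simp: efunctors_def)

lemma efun_typ [simp]:
  assumes "F \<in> Endo" "X \<in> EObj A" "Y \<in> EObj A"
  shows "snd F (X, Y) \<in> Arr V" "Dom V (snd F (X, Y)) = EHom A X Y"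
    "Cod V (snd F (X, Y)) = EHom A (fst F X) (fst F Y)"
  using assms by (auto simp: efunctors_def hom_iff)

lemma efun_EIdn [simp]:
  "\<lbrakk>F \<in> Endo; X \<in> EObj A\<rbrakk> \<Longrightarrow> snd F (X, X) \<bullet> EIdn A X = EIdn A (fst F X)"
  by (auto simp: efunctors_def)

text \<open>The defining diagram of an enriched functor, read at the pair of \<open>g\<close> and \<open>f\<close>: at each stage
  an enriched functor is an ordinary functor.\<close>

lemma efun_ecomp [simp]:
  assumes "F \<in> Endo" "X \<in> EObj A" "Y \<in> EObj A" "Z \<in> EObj A" "g \<in> Arr V" "f \<in> Arr V"
    "Dom V g = Dom V f" "Cod V g = EHom A Y Z" "Cod V f = EHom A X Y"
  shows "snd F (X, Z) \<bullet> ec X Y Z g f =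
    ec (fst F X) (fst F Y) (fst F Z) (snd F (Y, Z) \<bullet> g) (snd F (X, Y) \<bullet> f)"
proof -
  have "snd F (X, Z) \<bullet> ECmp A X Y Z =
      ECmp A (fst F X) (fst F Y) (fst F Z) \<bullet> pmap V (snd F (Y, Z)) (snd F (X, Y))"
    using assms by (auto simp: efunctors_def)
  then have "(snd F (X, Z) \<bullet> ECmp A X Y Z) \<bullet> tup V g f =
      (ECmp A (fst F X) (fst F Y) (fst F Z) \<bullet> pmap V (snd F (Y, Z)) (snd F (X, Y))) \<bullet> tup V g f"
    by simp
  then show ?thesis
    using assms by (simp add: ecomp_def)
qed

text \<open>Functoriality on generalised elements suffices: at the pair of projections it is the
  defining diagram of an enriched functor.\<close>

lemma efunI:
  assumes "F \<in> EObj A \<rightarrow>\<^sub>E EObj A" "Fh \<in> extensional (EObj A \<times> EObj A)"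
    and ty: "\<And>X Y. \<lbrakk>X \<in> EObj A; Y \<in> EObj A\<rbrakk> \<Longrightarrow> Fh (X, Y) \<in> hom V (EHom A X Y) (EHom A (F X) (F Y))"
    and "\<And>X. X \<in> EObj A \<Longrightarrow> Fh (X, X) \<bullet> EIdn A X = EIdn A (F X)"
    and cmp: "\<And>P X Y Z g f. \<lbrakk>X \<in> EObj A; Y \<in> EObj A; Z \<in> EObj A; g \<in> Arr V; f \<in> Arr V;
      Dom V g = P; Dom V f = P; Cod V g = EHom A Y Z; Cod V f = EHom A X Y; P \<in> Obj V\<rbrakk> \<Longrightarrow>
      Fh (X, Z) \<bullet> ec X Y Z g f = ec (F X) (F Y) (F Z) (Fh (Y, Z) \<bullet> g) (Fh (X, Y) \<bullet> f)"
  shows "(F, Fh) \<in> Endo"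
proof -
  have "Fh (X, Z) \<bullet> ECmp A X Y Z = ECmp A (F X) (F Y) (F Z) \<bullet> pmap V (Fh (Y, Z)) (Fh (X, Y))"
    if "X \<in> EObj A" "Y \<in> EObj A" "Z \<in> EObj A" for X Y Z
    \<comment> \<open>the generic composable pair: both projections at the stage \<open>A(Y, Z) \<times> A(X, Y)\<close>\<close>
    using cmp[of X Y Z "Prj1 V (EHom A Y Z) (EHom A X Y)" "Prj2 V (EHom A Y Z) (EHom A X Y)"]
      ty[of Y Z] ty[of X Y] that
    by (simp add: ecomp_Prj) (simp add: ecomp_def pmap_def hom_iff)
  then show ?thesis
    using assms by (auto simp: efunctors_def)
qed

lemma efun_eqI:
  assumes "F \<in> Endo" "G \<in> Endo"
    and "\<And>X. X \<in> EObj A \<Longrightarrow> fst F X = fst G X"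
    and "\<And>X Y. \<lbrakk>X \<in> EObj A; Y \<in> EObj A\<rbrakk> \<Longrightarrow> snd F (X, Y) = snd G (X, Y)"
  shows "F = G"
proof (rule prod_eqI)
  show "fst F = fst G"
    using assms by (intro extensionalityI[of _ "EObj A"]) (auto simp: efunctors_def PiE_def)
  show "snd F = snd G"
    using assms by (intro extensionalityI[of _ "EObj A \<times> EObj A"]) (auto simp: efunctors_def)
qed

lemma efunctor_comp_simps [simp]:
  "X \<in> EObj A \<Longrightarrow> fst (efunctor_comp V A G F) X = fst G (fst F X)"
  "\<lbrakk>X \<in> EObj A; Y \<in> EObj A\<rbrakk> \<Longrightarrow>
    snd (efunctor_comp V A G F) (X, Y) = snd G (fst F X, fst F Y) \<bullet> snd F (X, Y)"
  by (simp_all add: efunctor_comp_def)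

lemma efunctor_id_simps [simp]:
  "X \<in> EObj A \<Longrightarrow> fst (efunctor_id V A) X = X"
  "\<lbrakk>X \<in> EObj A; Y \<in> EObj A\<rbrakk> \<Longrightarrow> snd (efunctor_id V A) (X, Y) = Idn V (EHom A X Y)"
  by (simp_all add: efunctor_id_def)

lemma efunctor_comp_Endo [simp]: "\<lbrakk>F \<in> Endo; G \<in> Endo\<rbrakk> \<Longrightarrow> efunctor_comp V A G F \<in> Endo"
  unfolding efunctor_comp_def by (rule efunI) (auto simp: hom_iff)

lemma efunctor_id_Endo [simp]: "efunctor_id V A \<in> Endo"
  unfolding efunctor_id_def by (rule efunI) (auto simp: hom_iff)

lemma efunctor_comp_assoc:
  "\<lbrakk>F \<in> Endo; G \<in> Endo; H \<in> Endo\<rbrakk> \<Longrightarrow>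
    efunctor_comp V A (efunctor_comp V A H G) F = efunctor_comp V A H (efunctor_comp V A G F)"
  by (rule efun_eqI) auto

lemma efunctor_comp_id:
  assumes "F \<in> Endo"
  shows "efunctor_comp V A (efunctor_id V A) F = F" "efunctor_comp V A F (efunctor_id V A) = F"
  using assms by (auto intro!: efun_eqI)

text \<open>Components as such do not determine their source and target functor, so these are part of
  the judgement.\<close>

definition etrans :: "('x, 'x, 'a) efunctor \<Rightarrow> ('x, 'x, 'a) efunctor \<Rightarrow> ('x \<Rightarrow> 'a) \<Rightarrow> bool" where
  "etrans F G \<alpha> \<longleftrightarrow> F \<in> Endo \<and> G \<in> Endo \<and> \<alpha> \<in> enat V A A F G"

lemma etrans_Endo: "etrans F G \<alpha> \<Longrightarrow> F \<in> Endo" "etrans F G \<alpha> \<Longrightarrow> G \<in> Endo"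
  by (auto simp: etrans_def)

lemma etrans_typ:
  assumes "etrans F G \<alpha>" "X \<in> EObj A"
  shows "\<alpha> X \<in> Arr V" "Dom V (\<alpha> X) = One V" "Cod V (\<alpha> X) = EHom A (fst F X) (fst G X)"
  using assms by (auto simp: etrans_def enat_def hom_iff)

text \<open>At the stage \<open>P\<close> the component at \<open>Y\<close> is \<open>\<alpha> Y \<bullet> bang V P\<close>, and enriched naturality is the
  usual naturality square for every arrow \<open>f\<close> at that stage.\<close>

lemma etrans_natural:
  assumes "etrans F G \<alpha>" "X \<in> EObj A" "Y \<in> EObj A" "f \<in> Arr V" "Dom V f = P" "Cod V f = EHom A X Y"
  shows "ec (fst F X) (fst F Y) (fst G Y) (\<alpha> Y \<bullet> bang V P) (snd F (X, Y) \<bullet> f) =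
    ec (fst F X) (fst G X) (fst G Y) (snd G (X, Y) \<bullet> f) (\<alpha> X \<bullet> bang V P)"
proof -
  note [simp] = etrans_typ[OF assms(1)] etrans_Endo[OF assms(1)]
  have "ec (fst F X) (fst F Y) (fst G Y) (\<alpha> Y \<bullet> bang V (EHom A X Y)) (snd F (X, Y)) \<bullet> f =
    ec (fst F X) (fst G X) (fst G Y) (snd G (X, Y)) (\<alpha> X \<bullet> bang V (EHom A X Y)) \<bullet> f"
    using assms by (auto simp: etrans_def enat_def ecomp_def)
  then show ?thesis
    using assms(2-) by simp
qed

lemma etrans_natural_One:
  assumes "etrans F G \<alpha>" "X \<in> EObj A" "Y \<in> EObj A" "f \<in> Arr V" "Dom V f = One V"
    "Cod V f = EHom A X Y"
  shows "ec (fst F X) (fst F Y) (fst G Y) (\<alpha> Y) (snd F (X, Y) \<bullet> f) =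
    ec (fst F X) (fst G X) (fst G Y) (snd G (X, Y) \<bullet> f) (\<alpha> X)"
  using etrans_natural[OF assms] etrans_typ[OF assms(1)] assms(2,3) by simp

text \<open>Conversely, naturality on generalised elements suffices: at the identity, the generic
  element of \<open>A(X, Y)\<close>, it is the defining diagram.\<close>

lemma etransI:
  assumes "F \<in> Endo" "G \<in> Endo" "\<alpha> \<in> extensional (EObj A)"
    and ty: "\<And>X. X \<in> EObj A \<Longrightarrow> \<alpha> X \<in> hom V (One V) (EHom A (fst F X) (fst G X))"
    and nat: "\<And>X Y P f. \<lbrakk>X \<in> EObj A; Y \<in> EObj A; f \<in> Arr V; Dom V f = P; Cod V f = EHom A X Y; P \<in>
      Obj V\<rbrakk> \<Longrightarrow>
      ec (fst F X) (fst F Y) (fst G Y) (\<alpha> Y \<bullet> bang V P) (snd F (X, Y) \<bullet> f) =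
      ec (fst F X) (fst G X) (fst G Y) (snd G (X, Y) \<bullet> f) (\<alpha> X \<bullet> bang V P)"
  shows "etrans F G \<alpha>"
proof -
  have "ec (fst F X) (fst F Y) (fst G Y) (\<alpha> Y \<bullet> bang V (EHom A X Y)) (snd F (X, Y)) =
      ec (fst F X) (fst G X) (fst G Y) (snd G (X, Y)) (\<alpha> X \<bullet> bang V (EHom A X Y))"
    if "X \<in> EObj A" "Y \<in> EObj A" for X Y
    using nat[of X Y "Idn V (EHom A X Y)"] assms(1,2) that by simp
  then show ?thesis
    using assms(1-3) ty by (auto simp: etrans_def enat_def ecomp_def)
qed

lemma etrans_eqI:
  "\<lbrakk>etrans F G \<alpha>; etrans F' G' \<beta>; \<And>X. X \<in> EObj A \<Longrightarrow> \<alpha> X = \<beta> X\<rbrakk> \<Longrightarrow> \<alpha> = \<beta>"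
  by (rule extensionalityI[of _ "EObj A"]) (auto simp: etrans_def enat_def)

abbreviation (input) End where "End \<equiv> endofunctors V A"

lemma End_hom: "c \<in> hom End F G \<longleftrightarrow> (\<exists>\<alpha>. c = (F, \<alpha>, G) \<and> etrans F G \<alpha>)"
  by (auto simp: hom_def endofunctors_def etrans_def)

definition etrans_id where
  "etrans_id F = restrict (\<lambda>X. EIdn A (fst F X)) (EObj A)"

text \<open>The components of the vertical and horizontal composites in \<^const>\<open>endofunctors\<close>.\<close>

definition vcomp where
  "vcomp F G H \<beta> \<alpha> = restrict (\<lambda>X. ec (fst F X) (fst G X) (fst H X) (\<beta> X) (\<alpha> X)) (EObj A)"

definition hcomp where
  "hcomp F F' G G' \<beta> \<alpha> = restrict (\<lambda>X. ec (fst G (fst F X)) (fst G (fst F' X)) (fst G' (fst F' X))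
     (\<beta> (fst F' X)) (snd G (fst F X, fst F' X) \<bullet> \<alpha> X)) (EObj A)"

lemma End_simps:
  "Obj End = Endo" "TUnit End = efunctor_id V A" "TObj End = efunctor_comp V A"
  "Idn End F = (F, etrans_id F, F)"
  "Cmp End (G', \<beta>, H) (F, \<alpha>, G) = (F, vcomp F G H \<beta> \<alpha>, H)"
  "TArr End (G, \<beta>, G') (F, \<alpha>, F') =
    (efunctor_comp V A G F, hcomp F F' G G' \<beta> \<alpha>, efunctor_comp V A G' F')"
  by (simp_all add: endofunctors_def etrans_id_def vcomp_def hcomp_def ecomp_def)

lemma etrans_id_app [simp]: "X \<in> EObj A \<Longrightarrow> etrans_id F X = EIdn A (fst F X)"
  by (simp add: etrans_id_def)

lemma vcomp_app [simp]:
  "X \<in> EObj A \<Longrightarrow> vcomp F G H \<beta> \<alpha> X = ec (fst F X) (fst G X) (fst H X) (\<beta> X) (\<alpha> X)"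
  by (simp add: vcomp_def)

lemma hcomp_app [simp]:
  "X \<in> EObj A \<Longrightarrow> hcomp F F' G G' \<beta> \<alpha> X = ec (fst G (fst F X)) (fst G (fst F' X)) (fst G' (fst F' X))
     (\<beta> (fst F' X)) (snd G (fst F X, fst F' X) \<bullet> \<alpha> X)"
  by (simp add: hcomp_def)

lemma etrans_id: "F \<in> Endo \<Longrightarrow> etrans F F (etrans_id F)"
  by (rule etransI) (auto simp: hom_iff etrans_id_def)

lemma vcomp:
  assumes a: "etrans F G \<alpha>" and b: "etrans G H \<beta>"
  shows "etrans F H (vcomp F G H \<beta> \<alpha>)"
proof -
  note [simp] = etrans_typ[OF a] etrans_typ[OF b] etrans_Endo[OF a] etrans_Endo[OF b]
  show ?thesis
  proof (rule etransI, goal_cases)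
    case (5 X Y P f)
    have "ec (fst F X) (fst F Y) (fst H Y) (vcomp F G H \<beta> \<alpha> Y \<bullet> bang V P) (snd F (X, Y) \<bullet> f) =
      ec (fst F X) (fst G Y) (fst H Y) (\<beta> Y \<bullet> bang V P)
        (ec (fst F X) (fst F Y) (fst G Y) (\<alpha> Y \<bullet> bang V P) (snd F (X, Y) \<bullet> f))"
      using 5 by simp
    also have "\<dots> = ec (fst F X) (fst G X) (fst H Y)
        (ec (fst G X) (fst G Y) (fst H Y) (\<beta> Y \<bullet> bang V P) (snd G (X, Y) \<bullet> f)) (\<alpha> X \<bullet> bang V P)"
      using 5 by (subst etrans_natural[OF a]) auto
    also have "\<dots> = ec (fst F X) (fst H X) (fst H Y) (snd H (X, Y) \<bullet> f)
      (vcomp F G H \<beta> \<alpha> X \<bullet> bang V P)"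
      using 5 by (subst etrans_natural[OF b]) auto
    finally show ?case .
  qed (auto simp: vcomp_def hom_iff)
qed

lemma hcomp:
  assumes a: "etrans F F' \<alpha>" and b: "etrans G G' \<beta>"
  shows "etrans (efunctor_comp V A G F) (efunctor_comp V A G' F') (hcomp F F' G G' \<beta> \<alpha>)"
proof -
  note [simp] = etrans_typ[OF a] etrans_typ[OF b] etrans_Endo[OF a] etrans_Endo[OF b]
  show ?thesis
  proof (rule etransI, goal_cases)
    case (5 X Y P f)
    let ?GF = "efunctor_comp V A G F" and ?GF' = "efunctor_comp V A G' F'"
    have "ec (fst ?GF X) (fst ?GF Y) (fst ?GF' Y) (hcomp F F' G G' \<beta> \<alpha> Y \<bullet> bang V P)
      (snd ?GF (X, Y) \<bullet> f) =
      ec (fst G (fst F X)) (fst G (fst F' Y)) (fst G' (fst F' Y)) (\<beta> (fst F' Y) \<bullet> bang V P)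
        (snd G (fst F X, fst F' Y) \<bullet> ec (fst F X) (fst F Y) (fst F' Y) (\<alpha> Y \<bullet> bang V P) (snd F (X,
          Y) \<bullet> f))"
      using 5 by simp
    also have "\<dots> = ec (fst G (fst F X)) (fst G (fst F' X)) (fst G' (fst F' Y))
        (ec (fst G (fst F' X)) (fst G (fst F' Y)) (fst G' (fst F' Y)) (\<beta> (fst F' Y) \<bullet> bang V P)
          (snd G (fst F' X, fst F' Y) \<bullet> snd F' (X, Y) \<bullet> f)) 
        (snd G (fst F X, fst F' X) \<bullet> \<alpha> X \<bullet> bang V P)"
      using 5 by (subst etrans_natural[OF a]) auto
    also have "\<dots> = ec (fst ?GF X) (fst ?GF' X) (fst ?GF' Y) (snd ?GF' (X, Y) \<bullet> f)
      (hcomp F F' G G' \<beta> \<alpha> X \<bullet> bang V P)"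
      using 5 by (subst etrans_natural[OF b]) auto
    finally show ?case .
  qed (auto simp: hcomp_def hom_iff)
qed

lemma vcomp_assoc:
  assumes a: "etrans F G \<alpha>" and b: "etrans G H \<beta>" and c: "etrans H K \<gamma>"
  shows "vcomp F G K (vcomp G H K \<gamma> \<beta>) \<alpha> = vcomp F H K \<gamma> (vcomp F G H \<beta> \<alpha>)"
proof -
  note [simp] = etrans_typ[OF a] etrans_typ[OF b] etrans_typ[OF c]
    etrans_Endo[OF a] etrans_Endo[OF b] etrans_Endo[OF c]
  show ?thesis
    by (rule etrans_eqI[OF vcomp[OF a vcomp[OF b c]] vcomp[OF vcomp[OF a b] c]]) simp
qed

lemma vcomp_id:
  assumes a: "etrans F G \<alpha>"
  shows "vcomp F G G (etrans_id G) \<alpha> = \<alpha>" "vcomp F F G \<alpha> (etrans_id F) = \<alpha>"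
proof -
  note [simp] = etrans_typ[OF a] etrans_Endo[OF a]
  show "vcomp F G G (etrans_id G) \<alpha> = \<alpha>"
    by (rule etrans_eqI[OF vcomp[OF a etrans_id] a]) simp_all
  show "vcomp F F G \<alpha> (etrans_id F) = \<alpha>"
    by (rule etrans_eqI[OF vcomp[OF etrans_id a] a]) simp_all
qed

lemma hcomp_assoc:
  assumes a: "etrans F F' \<alpha>" and b: "etrans G G' \<beta>" and c: "etrans H H' \<gamma>"
  shows "hcomp F F' (efunctor_comp V A H G) (efunctor_comp V A H' G') (hcomp G G' H H' \<gamma> \<beta>) \<alpha> =
    hcomp (efunctor_comp V A G F) (efunctor_comp V A G' F') H H' \<gamma> (hcomp F F' G G' \<beta> \<alpha>)"
proof -
  note [simp] = etrans_typ[OF a] etrans_typ[OF b] etrans_typ[OF c]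
    etrans_Endo[OF a] etrans_Endo[OF b] etrans_Endo[OF c]
  show ?thesis
    by (rule etrans_eqI[OF hcomp[OF a hcomp[OF b c]] hcomp[OF hcomp[OF a b] c]]) simp
qed

lemma hcomp_id:
  assumes a: "etrans F F' \<alpha>"
  shows "hcomp F F' (efunctor_id V A) (efunctor_id V A) (etrans_id (efunctor_id V A)) \<alpha> = \<alpha>"
    "hcomp (efunctor_id V A) (efunctor_id V A) F F' \<alpha> (etrans_id (efunctor_id V A)) = \<alpha>"
proof -
  note [simp] = etrans_typ[OF a] etrans_Endo[OF a]
  show "hcomp F F' (efunctor_id V A) (efunctor_id V A) (etrans_id (efunctor_id V A)) \<alpha> = \<alpha>"
    by (rule etrans_eqI[OF hcomp[OF a etrans_id] a]) simp_all
  show "hcomp (efunctor_id V A) (efunctor_id V A) F F' \<alpha> (etrans_id (efunctor_id V A)) = \<alpha>"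
    by (rule etrans_eqI[OF hcomp[OF etrans_id a] a]) simp_all
qed

lemma hcomp_etrans_id:
  assumes "F \<in> Endo" "G \<in> Endo"
  shows "hcomp F F G G (etrans_id G) (etrans_id F) = etrans_id (efunctor_comp V A G F)"
  using assms
  by (intro etrans_eqI[OF hcomp[OF etrans_id etrans_id] etrans_id]) simp_all

text \<open>The interchange law: after unfolding, the two sides differ by the naturality of \<open>\<beta>\<close> at the
  component of \<open>\<alpha>'\<close>.\<close>

lemma hcomp_vcomp:
  assumes a: "etrans F F' \<alpha>" and a': "etrans F' F'' \<alpha>'" and b: "etrans G G' \<beta>"
    and b': "etrans G' G'' \<beta>'"
  shows "hcomp F F'' G G'' (vcomp G G' G'' \<beta>' \<beta>) (vcomp F F' F'' \<alpha>' \<alpha>) =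
    vcomp (efunctor_comp V A G F) (efunctor_comp V A G' F') (efunctor_comp V A G'' F'')
      (hcomp F' F'' G' G'' \<beta>' \<alpha>') (hcomp F F' G G' \<beta> \<alpha>)"
proof -
  note [simp] = etrans_typ[OF a] etrans_typ[OF b] etrans_typ[OF a'] etrans_typ[OF b']
    etrans_Endo[OF a] etrans_Endo[OF b] etrans_Endo[OF a'] etrans_Endo[OF b']
  show ?thesis
  proof (rule
    etrans_eqI[OF hcomp[OF vcomp[OF a a'] vcomp[OF b b']] vcomp[OF hcomp[OF a b] hcomp[OF a' b']]])
    fix X assume X [simp]: "X \<in> EObj A"
    let ?G = "fst G" and ?G' = "fst G'" and ?x = "fst F X" and ?x' = "fst F' X" and ?x'' =
      "fst F'' X"
    have "ec (?G ?x) (?G ?x'') (?G' ?x'') (\<beta> ?x'')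
        (ec (?G ?x) (?G ?x') (?G ?x'') (snd G (?x', ?x'') \<bullet> \<alpha>' X) (snd G (?x, ?x') \<bullet> \<alpha> X)) =
      ec (?G ?x) (?G ?x') (?G' ?x'')
        (ec (?G ?x') (?G ?x'') (?G' ?x'') (\<beta> ?x'') (snd G (?x', ?x'') \<bullet> \<alpha>' X)) (snd G (?x, ?x') \<bullet>
          \<alpha> X)"
      by simp
    also have "\<dots> = ec (?G ?x) (?G' ?x') (?G' ?x'') (snd G' (?x', ?x'') \<bullet> \<alpha>' X)
        (ec (?G ?x) (?G ?x') (?G' ?x') (\<beta> ?x') (snd G (?x, ?x') \<bullet> \<alpha> X))"
      by (subst etrans_natural_One[OF b]) simp_all
    finally show "hcomp F F'' G G'' (vcomp G G' G'' \<beta>' \<beta>) (vcomp F F' F'' \<alpha>' \<alpha>) X =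
      vcomp (efunctor_comp V A G F) (efunctor_comp V A G' F') (efunctor_comp V A G'' F'')
        (hcomp F' F'' G' G'' \<beta>' \<alpha>') (hcomp F F' G G' \<beta> \<alpha>) X"
      by simp
  qed
qed

theorem deloop_endofunctors: "strict_two_category (deloop End)"
proof (unfold_locales, goal_cases)
qed (auto simp: deloop_def End_hom End_simps efunctor_comp_assoc efunctor_comp_id etrans_Endo
    etrans_id vcomp hcomp vcomp_assoc vcomp_id hcomp_assoc hcomp_id hcomp_etrans_id hcomp_vcomp)

end

context cartesian_closed_category
begin

interpretation S: enriched_category C "self_enriched C"
  by (rule self_enriched_category)

text \<open>Components of transformations live at the terminal stage, from which each stage is reached
  by exactly one arrow.\<close>

lemma Exp_ext_One:
  assumes "f \<in> Arr C" "g \<in> Arr C" "Dom C f = One C" "Dom C g = One C"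
    and "Cod C f = Exp C A B" "Cod C g = Exp C A B" "A \<in> Obj C" "B \<in> Obj C"
    and eq: "\<And>Y a. \<lbrakk>Y \<in> Obj C; a \<in> Arr C; Dom C a = Y; Cod C a = A\<rbrakk>
      \<Longrightarrow> app A B (f \<bullet> bang C Y) a = app A B (g \<bullet> bang C Y) a"
  shows "f = g"
  using assms(1-8)
proof (rule Exp_ext)
  fix Y h a
  assume h: "Y \<in> Obj C" "h \<in> Arr C" "a \<in> Arr C" "Dom C h = Y" "Dom C a = Y" "Cod C h = One C"
    "Cod C a = A"
  then have "h = bang C Y"
    using into_One_eq[of h] by simp
  then show "app A B (f \<bullet> h) a = app A B (g \<bullet> h) a"
    using eq h by simp
qed

text \<open>Naturality of \<open>\<gamma>\<close> at \<open>f\<close>, evaluated at \<open>y\<close>, which turns the square into the rewrite rule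
  \<open>\<gamma> (F f y) = G f (\<gamma> y)\<close> for values.\<close>

lemma etrans_natural_app:
  assumes "S.etrans F G \<gamma>" "A \<in> Obj C" "B \<in> Obj C" "f \<in> Arr C" "Dom C f = P" "Cod C f = Exp C A B"
    and "y \<in> Arr C" "Dom C y = P" "Cod C y = fst F A"
  shows "app (fst F B) (fst G B) (\<gamma> B \<bullet> bang C P) (app (fst F A) (fst F B) (snd F (A, B) \<bullet> f) y) =
    app (fst G A) (fst G B) (snd G (A, B) \<bullet> f) (app (fst F A) (fst G A) (\<gamma> A \<bullet> bang C P) y)"
proof -
  note [simp] = S.etrans_typ[OF assms(1), simplified] S.etrans_Endo[OF assms(1)]
  have "fst F A \<in> Obj C" "fst F B \<in> Obj C" "fst G A \<in> Obj C" "fst G B \<in> Obj C" "P \<in> Obj C"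
    using S.efun_obj[of F A] S.efun_obj[of F B] S.efun_obj[of G A] S.efun_obj[of G B] assms by auto
  then show ?thesis
    using arg_cong[OF S.etrans_natural[OF assms(1), of A B f P], of "\<lambda>k. app (fst F A)
      (fst G B) k y"] assms
    by simp
qed

end

section \<open>The strength of an enriched endofunctor over the writer monad\<close>

locale monoid_in_ccc = cartesian_closed_category C
  for C :: "('o, 'a, 'z) ccc_scheme" (structure) +
  fixes M :: 'o and u m :: 'a
  assumes mon: "monoid_object C M u m"
begin

interpretation S: enriched_category C "self_enriched C"
  by (rule self_enriched_category)

interpretation B: strict_two_category "B_End C"
  unfolding B_End_def by (rule S.deloop_endofunctors)

lemma obj [simp]: "\<lbrakk>F \<in> S.Endo; A \<in> Obj C\<rbrakk> \<Longrightarrow> fst F A \<in> Obj C"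
  using S.efun_obj[of F A] by simp

lemma mon_typ [simp]:
  "M \<in> Obj C" "u \<in> Arr C" "Dom C u = One C" "Cod C u = M"
  "m \<in> Arr C" "Dom C m = Prod C M M" "Cod C m = M"
  using mon by (auto simp: monoid_object_def hom_iff)

lemma mon_unit [simp]:
  assumes "x \<in> Arr C" "Cod C x = M" "Dom C x = P"
  shows "m \<bullet> tup C (u \<bullet> bang C P) x = x" "m \<bullet> tup C x (u \<bullet> bang C P) = x"
proof -
  have "(m \<bullet> tup C (u \<bullet> bang C M) (Idn C M)) \<bullet> x = Idn C M \<bullet> x"
    "(m \<bullet> tup C (Idn C M) (u \<bullet> bang C M)) \<bullet> x = Idn C M \<bullet> x"
    using mon unfolding monoid_object_def by metis+
  then show "m \<bullet> tup C (u \<bullet> bang C P) x = x" "m \<bullet> tup C x (u \<bullet> bang C P) = x"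
    using assms by simp_all
qed

lemma mon_assoc [simp]:
  assumes "x \<in> Arr C" "Cod C x = M" "y \<in> Arr C" "Cod C y = M" "z \<in> Arr C" "Cod C z = M"
    "Dom C x = Dom C z" "Dom C y = Dom C z"
  shows "m \<bullet> tup C (m \<bullet> tup C x y) z = m \<bullet> tup C x (m \<bullet> tup C y z)"
proof -
  have "(m \<bullet> pmap C (Idn C M) m) \<bullet> tup C x (tup C y z) =
      (m \<bullet> pmap C m (Idn C M) \<bullet> passoc C M M M) \<bullet> tup C x (tup C y z)"
    using mon unfolding monoid_object_def by metis
  then show ?thesis
    using assms by simp
qed

abbreviation W where "W \<equiv> writer_functor C M"

lemma W_simps [simp]:
  "A \<in> Obj C \<Longrightarrow> fst W A = Prod C M A"
  by (simp add: writer_functor_def)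

lemma W_typ [simp]:
  assumes "A \<in> Obj C" "B \<in> Obj C"
  shows "snd W (A, B) \<in> Arr C" "Dom C (snd W (A, B)) = Exp C A B"
    "Cod C (snd W (A, B)) = Exp C (Prod C M A) (Prod C M B)"
  using assms by (auto simp: writer_functor_def Let_def simp flip: app_def)

text \<open>On elements, \<open>W f\<close> is \<open>(x, a) \<mapsto> (x, f a)\<close>; in this form the action of the writer functor on
  homs enters all later proofs.\<close>

lemma app_W [simp]:
  assumes "A \<in> Obj C" "B \<in> Obj C" "f \<in> Arr C" "Cod C f = Exp C A B" "p \<in> Arr C" "Dom C p = Dom C f"
    "Cod C p = Prod C M A"
  shows "app (Prod C M A) (Prod C M B) (snd W (A, B) \<bullet> f) p =
    tup C (Prj1 C M A \<bullet> p) (app A B f (Prj2 C M A \<bullet> p))"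
  using assms by (auto simp: writer_functor_def Let_def simp flip: app_def)

lemma W_Endo [simp]: "W \<in> S.Endo"
proof -
  have "(fst W, snd W) \<in> S.Endo"
  proof (rule S.efunI, goal_cases)
    case (4 X)
    then show ?case by - (rule Exp_ext_One[of _ _ "Prod C M X" "Prod C M X"], auto)
  next
    case (5 P X Y Z g f)
    then show ?case by - (rule Exp_ext[of _ _ P "Prod C M X" "Prod C M Z"], auto)
  qed (auto simp: hom_iff, auto simp: writer_functor_def)
  then show ?thesis by simp
qed

text \<open>The generalised element \<open>a \<mapsto> (x, a)\<close> of \<open>[A, M \<times> A]\<close> at the stage \<open>M\<close>: the unit of the
  adjunction between \<open>- \<times> A\<close> and \<open>[A, -]\<close>.\<close>

definition ins :: "'o \<Rightarrow> 'a" where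
  "ins A = cur C M A (Idn C (Prod C M A))"

lemma ins_typ [simp]:
  assumes "A \<in> Obj C"
  shows "ins A \<in> Arr C" "Dom C (ins A) = M" "Cod C (ins A) = Exp C A (Prod C M A)"
  using assms by (auto simp: ins_def)

lemma app_ins [simp]:
  assumes "A \<in> Obj C" "x \<in> Arr C" "Cod C x = M" "a \<in> Arr C" "Dom C x = Dom C a" "Cod C a = A"
  shows "app A (Prod C M A) (ins A \<bullet> x) a = tup C x a"
  using assms by (simp add: ins_def)

text \<open>The arrow \<open>(x, y) \<mapsto> F (a \<mapsto> (x, a)) y\<close>.\<close>

definition strength_arr :: "('o, 'o, 'a) efunctor \<Rightarrow> 'o \<Rightarrow> 'a" where
  "strength_arr F A = app (fst F A) (fst F (Prod C M A))
     (snd F (A, Prod C M A) \<bullet> ins A \<bullet> Prj1 C M (fst F A)) (Prj2 C M (fst F A))"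

lemma strength_arr_typ [simp]:
  assumes "F \<in> S.Endo" "A \<in> Obj C"
  shows "strength_arr F A \<in> Arr C" "Dom C (strength_arr F A) = Prod C M (fst F A)"
    "Cod C (strength_arr F A) = fst F (Prod C M A)"
  using assms by (auto simp: strength_arr_def)

lemma strength_arr_Cmp [simp]:
  assumes "F \<in> S.Endo" "A \<in> Obj C" "p \<in> Arr C" "Cod C p = Prod C M (fst F A)"
  shows "strength_arr F A \<bullet> p = app (fst F A) (fst F (Prod C M A))
     (snd F (A, Prod C M A) \<bullet> ins A \<bullet> Prj1 C M (fst F A) \<bullet> p) (Prj2 C M (fst F A) \<bullet> p)"
  using assms by (auto simp: strength_arr_def)

definition strength :: "('o, 'o, 'a) efunctor \<Rightarrow> 'o \<Rightarrow> 'a" where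
  "strength F = restrict (\<lambda>A. name_of C (strength_arr F A)) (Obj C)"

lemma strength_app [simp]: "A \<in> Obj C \<Longrightarrow> strength F A = name_of C (strength_arr F A)"
  by (simp add: strength_def)

text \<open>Naturality holds because inserting \<open>x\<close> commutes with every \<open>f\<close>: both \<open>(a \<mapsto> (x, a)) \<circ> f\<close> and
  \<open>W f \<circ> (a \<mapsto> (x, a))\<close> are \<open>a \<mapsto> (x, f a)\<close>. Apply \<open>F\<close> to this equation.\<close>

lemma strength_etrans:
  assumes F [simp]: "F \<in> S.Endo"
  shows "S.etrans (efunctor_comp C (self_enriched C) W F) (efunctor_comp C (self_enriched C) F W)
    (strength F)"
proof (rule S.etransI, goal_cases)
  case (5 X Y P f)
  then have [simp]: "X \<in> Obj C" "Y \<in> Obj C" "f \<in> Arr C" "Dom C f = P" "Cod C f = Exp C X Y"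
    "P \<in> Obj C"
    by simp_all
  have "scomp (Prod C M (fst F X)) (Prod C M (fst F Y)) (fst F (Prod C M Y))
      (strength F Y \<bullet> bang C P) (snd W (fst F X, fst F Y) \<bullet> snd F (X, Y) \<bullet> f) =
    scomp (Prod C M (fst F X)) (fst F (Prod C M X)) (fst F (Prod C M Y))
      (snd F (Prod C M X, Prod C M Y) \<bullet> snd W (X, Y) \<bullet> f) (strength F X \<bullet> bang C P)"
  proof (rule Exp_ext[of _ _ P "Prod C M (fst F X)" "fst F (Prod C M Y)"], goal_cases)
    case (9 Q h a)
    let ?x = "Prj1 C M (fst F X) \<bullet> a" and ?y = "Prj2 C M (fst F X) \<bullet> a"
    have "scomp X Y (Prod C M Y) (ins Y \<bullet> ?x) (f \<bullet> h) =
        scomp X (Prod C M X) (Prod C M Y) (snd W (X, Y) \<bullet> f \<bullet> h) (ins X \<bullet> ?x)"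
      using 9 by - (rule Exp_ext[of _ _ Q X "Prod C M Y"], auto)
    from arg_cong[OF this, of "\<lambda>k. app (fst F X) (fst F (Prod C M Y))
      (snd F (X, Prod C M Y) \<bullet> k) ?y"]
    show ?case
      using 9 by simp
  qed simp_all
  then show ?case by simp
qed (simp_all add: hom_iff, simp add: strength_def)

text \<open>On the element \<open>(x, y)\<close> this is the naturality of \<open>\<gamma>\<close> at \<open>a \<mapsto> (x, a)\<close>. It makes every 2-cell
  between endofunctors, in particular the unit and multiplication of a monad, compatible with
  strengths.\<close>

lemma strength_natural:
  assumes "S.etrans F G \<gamma>"
  shows "S.vcomp (efunctor_comp C (self_enriched C) W F) (efunctor_comp C (self_enriched C) F W)
      (efunctor_comp C (self_enriched C) G W) (S.hcomp W W F G \<gamma> (S.etrans_id W)) (strength F) =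
    S.vcomp (efunctor_comp C (self_enriched C) W F) (efunctor_comp C (self_enriched C) W G)
      (efunctor_comp C (self_enriched C) G W) (strength G) (S.hcomp F G W W (S.etrans_id W) \<gamma>)"
proof (rule extensionalityI[of _ "Obj C"])
  note [simp] = S.etrans_typ[OF assms(1), simplified] S.etrans_Endo[OF assms(1)]
  fix A assume "A \<in> Obj C"
  then show "S.vcomp (efunctor_comp C (self_enriched C) W F) (efunctor_comp C (self_enriched C) F W)
      (efunctor_comp C (self_enriched C) G W) (S.hcomp W W F G \<gamma> (S.etrans_id W)) (strength F) A =
    S.vcomp (efunctor_comp C (self_enriched C) W F) (efunctor_comp C (self_enriched C) W G)
      (efunctor_comp C (self_enriched C) G W) (strength G) (S.hcomp F G W W (S.etrans_id W) \<gamma>) A"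
    by - (rule Exp_ext_One[of _ _ "Prod C M (fst F A)" "fst G (Prod C M A)"], 
      auto simp: etrans_natural_app[OF assms])
qed (simp_all add: S.vcomp_def)

abbreviation efcomp where "efcomp \<equiv> efunctor_comp C (self_enriched C)"
abbreviation I where "I \<equiv> efunctor_id C (self_enriched C)"

lemma vh_ext [simp]:
  "S.vcomp F G H \<beta> \<alpha> \<in> extensional (Obj C)" "S.hcomp F F' G G' \<beta> \<alpha> \<in> extensional (Obj C)"
  "S.etrans_id F \<in> extensional (Obj C)" "strength F \<in> extensional (Obj C)"
  by (simp_all add: S.vcomp_def S.hcomp_def S.etrans_id_def strength_def)

lemma strength_id: "strength I = S.etrans_id W"
proof (rule extensionalityI[of _ "Obj C"])
  fix A assume "A \<in> Obj C"
  then show "strength I A = S.etrans_id W A"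
    by - (rule Exp_ext_One[of _ _ "Prod C M A" "Prod C M A"], auto)
qed simp_all

text \<open>Composing the strength of \<open>F\<close> with \<open>y \<mapsto> (x, y)\<close> gives \<open>F (a \<mapsto> (x, a))\<close>; apply \<open>G\<close> to this
  equation.\<close>

lemma strength_comp:
  assumes F [simp]: "F \<in> S.Endo" and G [simp]: "G \<in> S.Endo"
  shows "strength (efcomp G F) =
    S.vcomp (efcomp W (efcomp G F)) (efcomp G (efcomp W F)) (efcomp G (efcomp F W))
      (S.hcomp (efcomp W F) (efcomp F W) G G (S.etrans_id G) (strength F))
      (S.hcomp F F (efcomp W G) (efcomp G W) (strength G) (S.etrans_id F))" (is "_ = ?R")
proof (rule extensionalityI[of _ "Obj C"])
  note [simp] = S.etrans_typ[OF strength_etrans[OF F], simplified]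
  fix A assume A [simp]: "A \<in> Obj C"
  show "strength (efcomp G F) A = ?R A"
  proof (rule Exp_ext_One[of _ _ "Prod C M (fst G (fst F A))"
    "fst G (fst F (Prod C M A))"], goal_cases)
    case (9 Y a)
    let ?x = "Prj1 C M (fst G (fst F A)) \<bullet> a" and ?y = "Prj2 C M (fst G (fst F A)) \<bullet> a"
    have "scomp (fst F A) (Prod C M (fst F A)) (fst F (Prod C M A)) (strength F A \<bullet> bang C Y)
      (ins (fst F A) \<bullet> ?x) =
        snd F (A, Prod C M A) \<bullet> ins A \<bullet> ?x"
      using 9 by - (rule Exp_ext[of _ _ Y "fst F A" "fst F (Prod C M A)"], auto)
    from arg_cong[OF this, of "\<lambda>k. app (fst G (fst F A)) (fst G (fst F (Prod C M A))) 
        (snd G (fst F A, fst F (Prod C M A)) \<bullet> k) ?y"]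
    show ?case
      using 9 by simp
  qed simp_all
qed simp_all

section \<open>The writer monad and the parametric distributive law\<close>

definition writer_eta where "writer_eta = restrict (\<lambda>A. name_of C (writer_unit C u A)) (Obj C)"
definition writer_mu where "writer_mu = restrict (\<lambda>A. name_of C (writer_mult C M m A)) (Obj C)"

lemma writer_eta_app [simp]: "A \<in> Obj C \<Longrightarrow> writer_eta A = name_of C (writer_unit C u A)"
  and writer_mu_app [simp]: "A \<in> Obj C \<Longrightarrow> writer_mu A = name_of C (writer_mult C M m A)"
  and w_ext [simp]: "writer_eta \<in> extensional (Obj C)" "writer_mu \<in> extensional (Obj C)"
  by (simp_all add: writer_eta_def writer_mu_def)

lemma writer_unit_typ [simp]:
  assumes "A \<in> Obj C"
  shows "writer_unit C u A \<in> Arr C" "Dom C (writer_unit C u A) = A"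
    "Cod C (writer_unit C u A) = Prod C M A"
  using assms by (auto simp: writer_unit_def)

lemma writer_unit_Cmp [simp]:
  "\<lbrakk>A \<in> Obj C; a \<in> Arr C; Cod C a = A; Dom C a = P\<rbrakk> \<Longrightarrow>
    writer_unit C u A \<bullet> a = tup C (u \<bullet> bang C P) a"
  by (auto simp: writer_unit_def)

lemma writer_mult_typ [simp]:
  assumes "A \<in> Obj C"
  shows "writer_mult C M m A \<in> Arr C" "Dom C (writer_mult C M m A) = Prod C M (Prod C M A)"
    "Cod C (writer_mult C M m A) = Prod C M A"
  using assms by (auto simp: writer_mult_def)

lemma writer_mult_Cmp [simp]:
  "\<lbrakk>A \<in> Obj C; p \<in> Arr C; Cod C p = Prod C M (Prod C M A)\<rbrakk> \<Longrightarrow> writer_mult C M m A \<bullet> p =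
    tup C (m \<bullet> tup C (Prj1 C M (Prod C M A) \<bullet> p) (Prj1 C M A \<bullet> Prj2 C M (Prod C M A) \<bullet> p))
      (Prj2 C M A \<bullet> Prj2 C M (Prod C M A) \<bullet> p)"
  by (auto simp: writer_mult_def)

lemma writer_eta_etrans: "S.etrans I W writer_eta"
proof (rule S.etransI, goal_cases)
  case (5 X Y P f)
  then show ?case by - (rule Exp_ext[of _ _ P X "Prod C M Y"], auto)
qed (auto simp: hom_iff)

lemma writer_mu_etrans: "S.etrans (efcomp W W) W writer_mu"
proof (rule S.etransI, goal_cases)
  case (5 X Y P f)
  then show ?case by - (rule Exp_ext[of _ _ P "Prod C M (Prod C M X)" "Prod C M Y"], auto)
qed (auto simp: hom_iff)

lemma B_simps:
  "Obj0 (B_End C) = UNIV" "Cell1 (B_End C) X Y = S.Endo"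
  "Id1 (B_End C) X = I" "Comp1 (B_End C) = efcomp"
  "Id2 (B_End C) F = (F, S.etrans_id F, F)"
  "VComp (B_End C) (G', \<beta>, H) (F, \<alpha>, G) = (F, S.vcomp F G H \<beta> \<alpha>, H)"
  "HComp (B_End C) (G, \<beta>, G') (F, \<alpha>, F') = (efcomp G F, S.hcomp F F' G G' \<beta> \<alpha>, efcomp G' F')"
  by (simp_all add: B_End_def deloop_def S.End_simps)

lemma Cell2_B: "Cell2 (B_End C) X Y F G = {(F, \<gamma>, G) |\<gamma>. S.etrans F G \<gamma>}"
  by (auto simp: B_End_def deloop_def S.End_hom)

lemma cell1_B: "B.cell1 X Y F \<longleftrightarrow> F \<in> S.Endo"
  by (simp add: B.cell1_def B_simps)

lemma cell2_B: "B.cell2 X Y F G (F', \<alpha>, G') \<longleftrightarrow> F' = F \<and> G' = G \<and> S.etrans F G \<alpha>"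
  by (auto simp: B.cell2_def B_simps Cell2_B)

lemma B_whisker:
  "B.lw G (F, \<alpha>, F') = (efcomp G F, S.hcomp F F' G G (S.etrans_id G) \<alpha>, efcomp G F')"
  "B.rw (G, \<beta>, G') F = (efcomp G F, S.hcomp F F G G' \<beta> (S.etrans_id F), efcomp G' F)"
  by (simp_all add: B.lw_def B.rw_def B_simps)

lemma Writer_eq: "Writer C M u m = ((), W, (I, writer_eta, W), (efcomp W W, writer_mu, W))"
  by (simp add: Writer_def Let_def writer_eta_def writer_mu_def)

lemma efcomp_assoc: "\<lbrakk>F \<in> S.Endo; G \<in> S.Endo; H \<in> S.Endo\<rbrakk> \<Longrightarrow>
  efcomp (efcomp H G) F = efcomp H (efcomp G F)"
  by (rule S.efunctor_comp_assoc)

text \<open>On elements this is the left unit law of the monoid in the first component; the other two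
  monad laws follow likewise from the other two monoid laws.\<close>

lemma writer_left_unit:
  "S.vcomp W (efcomp W W) W writer_mu (S.hcomp W W I W writer_eta (S.etrans_id W)) =
   S.etrans_id W" (is "?L = ?R")
proof (rule extensionalityI[of _ "Obj C"])
  fix A assume "A \<in> Obj C"
  then show "?L A = ?R A"
    by - (rule Exp_ext_One[of _ _ "Prod C M A" "Prod C M A"], auto)
qed simp_all

lemma writer_right_unit:
  "S.vcomp W (efcomp W W) W writer_mu (S.hcomp I W W W (S.etrans_id W) writer_eta) =
   S.etrans_id W" (is "?L = ?R")
proof (rule extensionalityI[of _ "Obj C"])
  fix A assume "A \<in> Obj C"
  then show "?L A = ?R A"
    by - (rule Exp_ext_One[of _ _ "Prod C M A" "Prod C M A"], auto)
qed simp_all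

lemma writer_assoc:
  "S.vcomp (efcomp W (efcomp W W)) (efcomp W W) W writer_mu
     (S.hcomp W W (efcomp W W) W writer_mu (S.etrans_id W)) =
   S.vcomp (efcomp W (efcomp W W)) (efcomp W W) W writer_mu
     (S.hcomp (efcomp W W) W W W (S.etrans_id W) writer_mu)" (is "?L = ?R")
proof (rule extensionalityI[of _ "Obj C"])
  fix A assume "A \<in> Obj C"
  then show "?L A = ?R A"
    by - (rule Exp_ext_One[of _ _ "Prod C M (Prod C M (Prod C M A))" "Prod C M A"], auto)
qed simp_all

lemma Id1_Writer: "Id1 (Mnd (B_End C)) (Writer C M u m) = (I, Id2 (B_End C) W)"
  by (simp add: Writer_eq B.Mnd_simps B_simps)

lemma Writer_monad: "Writer C M u m \<in> monads (B_End C)"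
  unfolding Writer_eq B.monads_iff
  using writer_left_unit writer_right_unit writer_assoc
  by (simp add: cell1_B cell2_B B_whisker B_simps writer_eta_etrans writer_mu_etrans efcomp_assoc
    S.efunctor_comp_id)

text \<open>Insertion of the unit of the monoid is the unit of the writer monad; apply \<open>F\<close> to this
  equation.\<close>

lemma strength_unit:
  assumes F [simp]: "F \<in> S.Endo"
  shows "S.vcomp F (efcomp W F) (efcomp F W) (strength F)
      (S.hcomp F F I W writer_eta (S.etrans_id F)) =
    S.hcomp I W F F (S.etrans_id F) writer_eta" (is "?L = ?R")
proof (rule extensionalityI[of _ "Obj C"])
  fix A assume A [simp]: "A \<in> Obj C"
  show "?L A = ?R A"
  proof (rule Exp_ext_One[of _ _ "fst F A" "fst F (Prod C M A)"], goal_cases)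
    case (9 Y a)
    have "ins A \<bullet> u \<bullet> bang C Y = writer_eta A \<bullet> bang C Y"
      using 9 by - (rule Exp_ext[of _ _ Y A "Prod C M A"], auto)
    then show ?case
      using 9 by simp
  qed simp_all
qed simp_all

text \<open>Inserting \<open>x x'\<close> is inserting \<open>x'\<close>, then \<open>x\<close>, then multiplying in the writer monad; apply
  \<open>F\<close> to this equation.\<close>

lemma strength_mult:
  assumes F [simp]: "F \<in> S.Endo"
  shows "S.vcomp (efcomp W (efcomp W F)) (efcomp W F) (efcomp F W) (strength F)
      (S.hcomp F F (efcomp W W) W writer_mu (S.etrans_id F)) =
    S.vcomp (efcomp W (efcomp W F)) (efcomp F (efcomp W W)) (efcomp F W)
      (S.hcomp (efcomp W W) W F F (S.etrans_id F) writer_mu)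
      (S.vcomp (efcomp W (efcomp W F)) (efcomp W (efcomp F W)) (efcomp F (efcomp W W))
        (S.hcomp W W (efcomp W F) (efcomp F W) (strength F) (S.etrans_id W))
        (S.hcomp (efcomp W F) (efcomp F W) W W (S.etrans_id W) (strength F)))" (is "?L = ?R")
proof (rule extensionalityI[of _ "Obj C"])
  fix A assume A [simp]: "A \<in> Obj C"
  let ?MF = "Prod C M (fst F A)" and ?MA = "Prod C M A"
  show "?L A = ?R A"
  proof (rule Exp_ext_One[of _ _ "Prod C M ?MF" "fst F ?MA"], goal_cases)
    case (9 Y a)
    let ?x = "Prj1 C M ?MF \<bullet> a" and ?x' = "Prj1 C M (fst F A) \<bullet> Prj2 C M ?MF \<bullet> a"
      and ?y = "Prj2 C M (fst F A) \<bullet> Prj2 C M ?MF \<bullet> a"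
    have "ins A \<bullet> m \<bullet> tup C ?x ?x' =
        scomp A (Prod C M ?MA) ?MA (writer_mu A \<bullet> bang C Y)
          (scomp A ?MA (Prod C M ?MA) (ins ?MA \<bullet> ?x) (ins A \<bullet> ?x'))"
      using 9 by - (rule Exp_ext[of _ _ Y A ?MA], auto)
    from arg_cong[OF this, of "\<lambda>k. app (fst F A) (fst F ?MA) (snd F (A, ?MA) \<bullet> k) ?y"]
    show ?case
      using 9 by simp
  qed simp_all
qed simp_all

text \<open>The section of \<^const>\<open>forget\<close> from which the distributive laws arise: the unique 0-cell carries
  the writer monad, and every endofunctor distributes over it by its strength.\<close>

definition strengthening where
  "strengthening = \<lparr>Map0 = (\<lambda>_. Writer C M u m),
     Map1 = (\<lambda>_ _ F. (F, (efcomp W F, strength F, efcomp F W))),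
     Map2 = (\<lambda>_ _ _ _ \<alpha>. \<alpha>)\<rparr>"

lemma strength_cell1:
  assumes F [simp]: "F \<in> S.Endo"
  shows "(F, (efcomp W F, strength F, efcomp F W)) \<in>
    monad_cells1 (B_End C) (Writer C M u m) (Writer C M u m)"
  unfolding Writer_eq
  using strength_etrans[OF F] strength_unit[OF F] strength_mult[OF F]
  by (simp add: B.monad_cells1_iff B_simps cell1_B cell2_B B_whisker efcomp_assoc
    S.efunctor_comp_id)

lemma strength_cell2:
  assumes "S.etrans F G \<gamma>"
  shows "(F, \<gamma>, G) \<in> monad_cells2 (B_End C) (Writer C M u m) (Writer C M u m)
    (F, (efcomp W F, strength F, efcomp F W)) (G, (efcomp W G, strength G, efcomp G W))"
  using strength_natural[OF assms] strength_cell1 S.etrans_Endo[OF assms] assms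
  unfolding Writer_eq
  by (simp add: B.monad_cells2_iff B_simps cell1_B cell2_B B_whisker efcomp_assoc)

lemma strengthening_strict_two_functor:
  "strict_two_functor (B_End C) (Mnd (B_End C)) strengthening"
proof -
  interpret MB: strict_two_category "Mnd (B_End C)" by (rule B.Mnd_strict_two_category)
  show ?thesis
  proof (unfold_locales, goal_cases)
    case (5 X Y Z F G)
    then show ?case
      by (simp add: strengthening_def B.Mnd_simps B_simps B_whisker strength_comp efcomp_assoc)
  qed (auto simp: strengthening_def B.Mnd_simps Writer_monad strength_cell1 strength_cell2 B_simps
    Cell2_B
      Id1_Writer strength_id S.efunctor_comp_id)
qed

end

theorem theorem5p4:
  fixes C :: "('o, 'a) ccc" and M :: 'o and u m :: 'a
  assumes "cartesian_closed_category C"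
    and "monoid_object C M u m"
  defines "B \<equiv> B_End C"
  defines "D \<equiv> Mnd B"
  shows "\<exists>H \<in> PDist D B.
    constantly D B (two_functor_comp U1 H) (Writer C M u m) \<and>
    two_functor_eq D (two_functor_comp U2 H) two_functor_id"
proof -
  interpret monoid_in_ccc C M u m
    using assms(1,2) by (simp add: monoid_in_ccc_def monoid_in_ccc_axioms_def)
  have S: "strict_two_functor B (Mnd B) strengthening"
    unfolding B_def by (rule strengthening_strict_two_functor)
  have "two_functor_eq B (two_functor_comp forget strengthening) two_functor_id"
    by (simp add: two_functor_eq_def two_functor_comp_def two_functor_id_def forget_def
      strengthening_def)
  note H = section_PDist[OF S this]
  have "constantly D B (two_functor_comp U1 (Mnd_map B strengthening)) (Writer C M u m)"
    using H(2,3) by (auto simp: constantly_def D_def strengthening_def)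
  with H(1,4) show ?thesis
    unfolding D_def by blast
qed

end
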